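(* Let $(G,\mathcal{R})$ be a framed directed graph. Any nonnegative flow has at most one representation as a positive bundle combination. A dense subset of $\mathcal F_{\geq0}(G)$, including all rational flows, is obtained as bundle combinations. If $F\in\mathcal F_{\geq0}(G)$ is an integer flow, then its bundle combination has integral coefficients. Consequently, the bundle subdivisions $\mathcal S_{\geq0}(G,\mathcal{R}):=\{\Delta_{\geq0}(\bar{\mathcal K}) : \bar{\mathcal K}\text{ a maximal bundle of }(G,\mathcal{R})\}$ and $\mathcal S_1(G,\mathcal{R}):=\{\Delta_1(\bar{\mathcal K}) : \bar{\mathcal K}\text{ a maximal bundle of }(G,\mathcal{R})\text{ with at least one route}\}$ are simplicial polyhedral subdivisions of $\mathcal F_{\geq0}(G)$ and $\mathcal F_1(G)$, respectively, covering every rational point.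
   Context: $G$ is a finite directed graph (edge set $E$); $\mathrm{in}(v)$, $\mathrm{out}(v)$ are incoming/outgoing edges at $v$; sources have $\mathrm{in}(v)=\emptyset$, sinks $\mathrm{out}(v)=\emptyset$, other vertices are internal. A flow is $F:E\to\mathbb R$ with inflow equal to outflow at every internal vertex; $\mathcal F_{\geq0}(G)$ is the cone of nonnegative flows and $\mathcal F_1(G)$ the set of nonnegative flows with total flow $1$ leaving the sources. A framing $\mathcal R$ gives at each internal $v$ a linear order on $\mathrm{in}(v)$ and one on $\mathrm{out}(v)$. Routes are directed paths from a source to a sink; bands are directed closed walks not powers of shorter ones, up to rotation (subpaths of bands are subpaths of their powers); trails are routes or bands; $\mathcal I(p)\in\mathbb R^E$ counts edge traversals. An incompatibility is a pair $(e_1Rf_2,e_2Rf_1)$ with $R$ a possibly empty directed path from internal $v$ to internal $w$, $e_1<e_2$ in $\mathrm{in}(v)$, $f_1<f_2$ in $\mathrm{out}(w)$; trails are incompatible if they have subpaths forming an incompatibility. A bundle is a set of pairwise compatible trails (each compatible with itself); write $\bar{\mathcal K}=\mathcal K\cup\mathcal B$ (routes, bands). A $\bar{\mathcal K}$-bundle combination is $\sum_{p\in\bar{\mathcal K}}a_p\mathcal I(p)$ with all $a_p\ge0$; it is unit if $\sum_{p\in\mathcal K}a_p=1$ and positive if all $a_p>0$; a bundle combination is a $\bar{\mathcal K}$-bundle combination for some bundle. $\Delta_1(\bar{\mathcal K})$ is the set of unit $\bar{\mathcal K}$-bundle combinations and $\Delta_{\geq0}(\bar{\mathcal K})$ the set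 of all $\bar{\mathcal K}$-bundle combinations. A pointed polyhedron with vertex set $A$ and extremal ray set $B$ is simplicial (a simplihedron) if every point has a unique expression $\sum_{v\in A}a_vv+\sum_{r\in B}a_rr$ with nonnegative coefficients and $\sum_{v\in A}a_v=1$. A subdivision of a polyhedron $P$ is a set of polyhedra (cells) whose union is dense in $P$ and such that any two distinct cells intersect in a common face of both; it is simplicial if all cells are simplihedra. *)

theory Defs
  imports "HOL-Analysis.Analysis" "Graph_Theory.Arc_Walk" "HOL-Library.Sublist"
begin

section \<open>Polyhedra\<close>

definition recession_cone :: "'c::real_vector set \<Rightarrow> 'c set" where
  "recession_cone P = {d. \<forall>x\<in>P. \<forall>t\<ge>0. x + t *\<^sub>R d \<in> P}"

definition pointed :: "'c::real_vector set \<Rightarrow> bool" where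
  "pointed P \<longleftrightarrow> \<not> (\<exists>x d. d \<noteq> 0 \<and> (\<forall>t::real. x + t *\<^sub>R d \<in> P))"

text \<open>An extremal ray of a pointed polyhedron is a one-dimensional face of its recession cone.
  It is represented by its generator of norm 1, so that each ray occurs exactly once; rescaling the
  generator only rescales the coefficients below.\<close>

definition extremal_rays :: "'c::real_normed_vector set \<Rightarrow> 'c set" where
  "extremal_rays P =
     {r. norm r = 1 \<and> (\<lambda>t. t *\<^sub>R r) ` {0..} face_of recession_cone P}"

text \<open>Vertices and extremal rays get separate coefficient functions because a vertex may coincide,
  as a vector, with the generator of a ray. Coefficient functions are extensional, which makes
  unique existence meaningful. The sums are finite since a polyhedron has finitely many vertices
  and extremal rays.\<close>

definition simplihedron :: "'c::euclidean_space set \<Rightarrow> bool" where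
  "simplihedron P \<longleftrightarrow> polyhedron P \<and> pointed P \<and>
     (let A = {v. v extreme_point_of P}; B = extremal_rays P in
       \<forall>x\<in>P. \<exists>!(a, b). a \<in> A \<rightarrow>\<^sub>E {0::real..} \<and> b \<in> B \<rightarrow>\<^sub>E {0::real..} \<and> (\<Sum>v\<in>A. a v) = 1 \<and>
         x = (\<Sum>v\<in>A. a v *\<^sub>R v) + (\<Sum>r\<in>B. b r *\<^sub>R r))"

definition polyhedral_subdivision :: "'c::euclidean_space set set \<Rightarrow> 'c set \<Rightarrow> bool" where
  "polyhedral_subdivision \<C> P \<longleftrightarrow> polyhedron P \<and> (\<forall>C\<in>\<C>. polyhedron C) \<and>
     \<Union>\<C> \<subseteq> P \<and> P \<subseteq> closure (\<Union>\<C>) \<and>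
     (\<forall>C\<in>\<C>. \<forall>D\<in>\<C>. C \<noteq> D \<longrightarrow> C \<inter> D face_of C \<and> C \<inter> D face_of D)"

definition simplicial_subdivision :: "'c::euclidean_space set set \<Rightarrow> 'c set \<Rightarrow> bool" where
  "simplicial_subdivision \<C> P \<longleftrightarrow> polyhedral_subdivision \<C> P \<and> (\<forall>C\<in>\<C>. simplihedron C)"

section \<open>Flows\<close>

definition sources :: "('a, 'b) pre_digraph \<Rightarrow> 'a set" where
  "sources G = {v \<in> verts G. in_arcs G v = {}}"

definition sinks :: "('a, 'b) pre_digraph \<Rightarrow> 'a set" where
  "sinks G = {v \<in> verts G. out_arcs G v = {}}"

definition internals :: "('a, 'b) pre_digraph \<Rightarrow> 'a set" where
  "internals G = verts G - sources G - sinks G"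

text \<open>The space of real functions on the arcs of \<open>G\<close> is realised as the coordinate subspace of
  \<open>real ^ 'b\<close> of the vectors vanishing outside \<open>arcs G\<close>; thus \<open>arcs G\<close> is an arbitrary finite
  set, possibly empty.\<close>

definition is_flow :: "('a, 'b::finite) pre_digraph \<Rightarrow> real ^ 'b \<Rightarrow> bool" where
  "is_flow G F \<longleftrightarrow> (\<forall>e. e \<notin> arcs G \<longrightarrow> F $ e = 0) \<and>
     (\<forall>v\<in>internals G. (\<Sum>e\<in>in_arcs G v. F $ e) = (\<Sum>e\<in>out_arcs G v. F $ e))"

definition nonneg_flows :: "('a, 'b::finite) pre_digraph \<Rightarrow> (real ^ 'b) set" where
  "nonneg_flows G = {F. is_flow G F \<and> (\<forall>e. 0 \<le> F $ e)}"

definition unit_flows :: "('a, 'b::finite) pre_digraph \<Rightarrow> (real ^ 'b) set" where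
  "unit_flows G = {F \<in> nonneg_flows G. (\<Sum>v\<in>sources G. \<Sum>e\<in>out_arcs G v. F $ e) = 1}"

definition rational_vec :: "real ^ 'b::finite \<Rightarrow> bool" where
  "rational_vec F \<longleftrightarrow> (\<forall>e. F $ e \<in> \<rat>)"

definition integer_vec :: "real ^ 'b::finite \<Rightarrow> bool" where
  "integer_vec F \<longleftrightarrow> (\<forall>e. F $ e \<in> \<int>)"

section \<open>Framings and trails\<close>

text \<open>The orders are reflexive relations, as in the library; a strict comparison is the relation
  together with inequality. Their values at vertices that are not internal play no role.\<close>

record ('a, 'b) framing =
  in_ord :: "'a \<Rightarrow> ('b \<times> 'b) set"
  out_ord :: "'a \<Rightarrow> ('b \<times> 'b) set"

definition is_framing :: "('a, 'b) pre_digraph \<Rightarrow> ('a, 'b) framing \<Rightarrow> bool" where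
  "is_framing G R \<longleftrightarrow> (\<forall>v\<in>internals G.
     linear_order_on (in_arcs G v) (in_ord R v) \<and> linear_order_on (out_arcs G v) (out_ord R v))"

text \<open>Walks are lists of arcs and may repeat vertices and arcs. A band is the set of all rotations
  of a closed walk.\<close>

datatype 'b trail = Route "'b list" | Band "'b list set"

text \<open>Nonemptiness only matters for isolated vertices, which are sources and sinks at once: their
  trivial walk is not a route.\<close>

definition routes :: "('a, 'b) pre_digraph \<Rightarrow> 'b trail set" where
  "routes G = {Route p | p s t. p \<noteq> [] \<and> s \<in> sources G \<and> t \<in> sinks G \<and> pre_digraph.awalk G s p t}"

definition bands :: "('a, 'b) pre_digraph \<Rightarrow> 'b trail set" where
  "bands G = {Band (range (\<lambda>n. rotate n w)) | w u. w \<noteq> [] \<and> pre_digraph.awalk G u w u \<and>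
     \<not> (\<exists>x n. length x < length w \<and> w = concat (replicate n x))}"

definition trails :: "('a, 'b) pre_digraph \<Rightarrow> 'b trail set" where
  "trails G = routes G \<union> bands G"

fun subpath :: "'b list \<Rightarrow> 'b trail \<Rightarrow> bool" where
  "subpath p (Route w) \<longleftrightarrow> sublist p w"
| "subpath p (Band W) \<longleftrightarrow> (\<exists>w\<in>W. \<exists>n. sublist p (concat (replicate n w)))"

fun traversals :: "'b::finite trail \<Rightarrow> real ^ 'b" where
  "traversals (Route w) = (\<chi> e. real (count_list w e))"
| "traversals (Band W) = (\<chi> e. real (count_list (SOME w. w \<in> W) e))"

definition incompatibility ::
  "('a, 'b) pre_digraph \<Rightarrow> ('a, 'b) framing \<Rightarrow> 'b list \<Rightarrow> 'b list \<Rightarrow> bool" where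
  "incompatibility G R p q \<longleftrightarrow> (\<exists>v\<in>internals G. \<exists>w\<in>internals G. \<exists>P e1 e2 f1 f2.
     pre_digraph.awalk G v P w \<and>
     e1 \<noteq> e2 \<and> (e1, e2) \<in> in_ord R v \<and> f1 \<noteq> f2 \<and> (f1, f2) \<in> out_ord R w \<and>
     p = e1 # P @ [f2] \<and> q = e2 # P @ [f1])"

definition incompatible ::
  "('a, 'b) pre_digraph \<Rightarrow> ('a, 'b) framing \<Rightarrow> 'b trail \<Rightarrow> 'b trail \<Rightarrow> bool" where
  "incompatible G R T T' \<longleftrightarrow> (\<exists>p q. (incompatibility G R p q \<or> incompatibility G R q p) \<and>
     subpath p T \<and> subpath q T')"

definition is_bundle :: "('a, 'b) pre_digraph \<Rightarrow> ('a, 'b) framing \<Rightarrow> 'b trail set \<Rightarrow> bool" where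
  "is_bundle G R K \<longleftrightarrow> K \<subseteq> trails G \<and> (\<forall>T\<in>K. \<forall>T'\<in>K. \<not> incompatible G R T T')"

definition maximal_bundle :: "('a, 'b) pre_digraph \<Rightarrow> ('a, 'b) framing \<Rightarrow> 'b trail set \<Rightarrow> bool" where
  "maximal_bundle G R K \<longleftrightarrow> is_bundle G R K \<and> (\<forall>L. is_bundle G R L \<longrightarrow> K \<subseteq> L \<longrightarrow> L = K)"

section \<open>Bundle combinations\<close>

text \<open>Finiteness of bundles is not part of their definition, so the sums are written with
  \<open>has_sum\<close>; over a finite set this is the ordinary sum.\<close>

definition represents :: "'b::finite trail set \<Rightarrow> ('b trail \<Rightarrow> real) \<Rightarrow> real ^ 'b \<Rightarrow> bool" where
  "represents K a F \<longleftrightarrow> (\<forall>T\<in>K. 0 \<le> a T) \<and> ((\<lambda>T. a T *\<^sub>R traversals T) has_sum F) K"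

definition unit_coeffs ::
  "('a, 'b) pre_digraph \<Rightarrow> 'b trail set \<Rightarrow> ('b trail \<Rightarrow> real) \<Rightarrow> bool" where
  "unit_coeffs G K a \<longleftrightarrow> (a has_sum 1) (K \<inter> routes G)"

definition positive_coeffs :: "'b trail set \<Rightarrow> ('b trail \<Rightarrow> real) \<Rightarrow> bool" where
  "positive_coeffs K a \<longleftrightarrow> (\<forall>T\<in>K. 0 < a T)"

definition bundle_cone :: "'b::finite trail set \<Rightarrow> (real ^ 'b) set" where
  "bundle_cone K = {F. \<exists>a. represents K a F}"

definition unit_bundle_polyhedron ::
  "('a, 'b::finite) pre_digraph \<Rightarrow> 'b trail set \<Rightarrow> (real ^ 'b) set" where
  "unit_bundle_polyhedron G K = {F. \<exists>a. represents K a F \<and> unit_coeffs G K a}"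

definition bundle_combinations ::
  "('a, 'b::finite) pre_digraph \<Rightarrow> ('a, 'b) framing \<Rightarrow> (real ^ 'b) set" where
  "bundle_combinations G R = (\<Union>K\<in>{K. is_bundle G R K}. bundle_cone K)"

definition nonneg_bundle_subdivision ::
  "('a, 'b::finite) pre_digraph \<Rightarrow> ('a, 'b) framing \<Rightarrow> (real ^ 'b) set set" where
  "nonneg_bundle_subdivision G R = {bundle_cone K | K. maximal_bundle G R K}"

definition unit_bundle_subdivision ::
  "('a, 'b::finite) pre_digraph \<Rightarrow> ('a, 'b) framing \<Rightarrow> (real ^ 'b) set set" where
  "unit_bundle_subdivision G R =
     {unit_bundle_polyhedron G K | K. maximal_bundle G R K \<and> K \<inter> routes G \<noteq> {}}"

end

theory Submission
  imports Defs
begin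

text \<open>
  For a bundle combination \<open>F\<close> let \<open>W(P)\<close> be the number of occurrences of the arc list \<open>P\<close> in the
  trails, counted with their coefficients; so \<open>W(e) = F(e)\<close>. For a path \<open>Q\<close> between internal vertices
  the matrix \<open>W(e Q f)\<close> has row sums \<open>W(e Q)\<close> and column sums \<open>W(Q f)\<close>, and compatibility says that it
  is supported on a staircase; such a matrix is determined by its row and column sums. By induction on
  the length of \<open>P\<close>, all \<open>W(P)\<close> are determined by \<open>F\<close>. The coefficient of a route \<open>p\<close> is \<open>W(p)\<close>, and that
  of a band \<open>w\<close> is \<open>W(w\<^sup>n)\<close> for large \<open>n\<close>. Hence coefficients are unique, the vectors of a bundle are
  linearly independent, and cones of bundles meet in the cone of the common trails.

  Conversely, an integer flow is cut into unit strands which are joined at each internal vertex in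
  the order prescribed by the framing. The strands link up to routes and powers of bands that do
  not cross. Scaling covers the rational flows, which are dense.
\<close>

section \<open>Simplihedra from unique coefficients\<close>

text \<open>Two obstacles shape the uniqueness proof: bundles are not assumed finite, and no fixed
  list of arcs singles out a band, since a route may wind around it many times before it leaves.
  Uniqueness is therefore proved for finite bundles first, where one exponent can exceed the lengths
  of all trails involved. It makes the traversal vectors linearly independent, so finite bundles
  have at most \<open>CARD('b)\<close> trails, and hence all bundles do. Uniqueness is stated for
  two bundles at once, with coefficients extended by zero. In this form it also yields the
  intersections and the faces of the cones. Density needs rational flows inside the polyhedron
  itself, for unit flows with total flow exactly 1. Rounding each coordinate separately would break
  conservation. A common denominator with errors small against the number of arcs keeps every
  condition, because each of them compares sums of integers.\<close>

lemma nonneg_line_imp_slope_nonneg: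
  fixes a c :: real
  assumes "\<And>t. t \<ge> 0 \<Longrightarrow> 0 \<le> a + t * c"
  shows "0 \<le> c"
proof (rule ccontr)
  assume "\<not> 0 \<le> c"
  then have c: "c < 0" by simp
  have "0 \<le> a + ((\<bar>a\<bar> + 1) / - c) * c"
    by (rule assms) (use c in \<open>simp add: divide_nonneg_neg\<close>)
  moreover have "((\<bar>a\<bar> + 1) / - c) * c = - (\<bar>a\<bar> + 1)"
    using c by (simp add: field_simps)
  ultimately show False by linarith
qed

text \<open>\<open>indep\<close> says that the vectors (v, 1) for v in \<open>V\<close> and (r, 0)
  for r in \<open>B\<close> are linearly independent. This homogenization treats vertices and rays
  alike and lets a vertex coincide with a ray generator as a vector.\<close>

locale simplicial_frame =
  fixes V B :: "'c::euclidean_space set"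
  assumes finite_V: "finite V" and finite_B: "finite B" and V_nonempty: "V \<noteq> {}"
    and norm_B: "r \<in> B \<Longrightarrow> norm r = 1"
    and indep: "\<lbrakk>(\<Sum>v\<in>V. a v) = 0; (\<Sum>v\<in>V. a v *\<^sub>R v) + (\<Sum>r\<in>B. b r *\<^sub>R r) = 0\<rbrakk>
      \<Longrightarrow> (\<forall>v\<in>V. a v = 0) \<and> (\<forall>r\<in>B. b r = 0)"
begin

definition pt :: "('c \<Rightarrow> real) \<Rightarrow> ('c \<Rightarrow> real) \<Rightarrow> 'c" where
  "pt a b = (\<Sum>v\<in>V. a v *\<^sub>R v) + (\<Sum>r\<in>B. b r *\<^sub>R r)"

definition cell :: "'c set" where
  "cell = {pt a b | a b. (\<forall>v\<in>V. 0 \<le> a v) \<and> (\<forall>r\<in>B. 0 \<le> b r) \<and> (\<Sum>v\<in>V. a v) = 1}"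

lemma pt_add_scaleR: "pt a b + t *\<^sub>R pt a' b' = pt (\<lambda>v. a v + t * a' v) (\<lambda>r. b r + t * b' r)"
  by (simp add: pt_def scaleR_add_left sum.distrib scaleR_sum_right scaleR_add_right)

lemma pt_inj:
  assumes "(\<Sum>v\<in>V. a v) = (\<Sum>v\<in>V. a' v)" "pt a b = pt a' b'"
  shows "(\<forall>v\<in>V. a v = a' v) \<and> (\<forall>r\<in>B. b r = b' r)"
proof -
  have "pt (\<lambda>v. a v + (-1) * a' v) (\<lambda>r. b r + (-1) * b' r) = 0"
    unfolding pt_add_scaleR[symmetric] using assms(2) by simp
  then have "(\<forall>v\<in>V. a v + (-1) * a' v = 0) \<and> (\<forall>r\<in>B. b r + (-1) * b' r = 0)"
    using assms(1) by (intro indep) (simp_all add: pt_def sum_subtractf)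
  then show ?thesis by simp
qed

lemma pt_single_V: "v \<in> V \<Longrightarrow> pt (\<lambda>u. if u = v then 1 else 0) (\<lambda>_. 0) = v"
  by (simp add: pt_def finite_V if_distrib[where f="\<lambda>c. c *\<^sub>R _"] cong: if_cong)

lemma pt_single_B: "r \<in> B \<Longrightarrow> pt (\<lambda>_. 0) (\<lambda>u. if u = r then 1 else 0) = r"
  by (simp add: pt_def finite_B if_distrib[where f="\<lambda>c. c *\<^sub>R _"] cong: if_cong)

lemma cellI: "\<lbrakk>\<And>v. v \<in> V \<Longrightarrow> 0 \<le> a v; \<And>r. r \<in> B \<Longrightarrow> 0 \<le> b r; (\<Sum>v\<in>V. a v) = 1\<rbrakk> \<Longrightarrow> pt a b \<in> cell"
  by (auto simp: cell_def)

lemma pt_in_cellD: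
  assumes "pt a b \<in> cell" "(\<Sum>v\<in>V. a v) = 1"
  shows "(\<forall>v\<in>V. 0 \<le> a v) \<and> (\<forall>r\<in>B. 0 \<le> b r)"
proof -
  obtain a' b' where *: "pt a b = pt a' b'" "\<forall>v\<in>V. 0 \<le> a' v" "\<forall>r\<in>B. 0 \<le> b' r" "(\<Sum>v\<in>V. a' v) = 1"
    using assms(1) by (auto simp: cell_def)
  then show ?thesis using pt_inj[of a a' b b'] assms(2) by auto
qed

lemma V_subset_cell: "v \<in> V \<Longrightarrow> v \<in> cell"
  using cellI[of "\<lambda>u. if u = v then 1 else 0" "\<lambda>_. 0"] pt_single_V[of v] finite_V
  by (simp cong: if_cong)

text \<open>Along a half-line from a vertex the coefficients are affine in \<open>t\<close> and stay
  nonnegative, so their slopes are nonnegative. The slopes at \<open>V\<close> also sum to zero and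
  hence vanish.\<close>

lemma recession_cone_cell: "recession_cone cell = {pt (\<lambda>_. 0) b | b. \<forall>r\<in>B. 0 \<le> b r}"
proof (intro subset_antisym subsetI)
  fix d assume d: "d \<in> recession_cone cell"
  obtain v0 where v0: "v0 \<in> V" using V_nonempty by blast
  let ?a = "\<lambda>u. if u = v0 then 1 else 0 :: real"
  have sa: "(\<Sum>v\<in>V. ?a v) = 1" using v0 finite_V by simp
  have in_cell: "v0 + t *\<^sub>R d \<in> cell" if "t \<ge> 0" for t
    using d V_subset_cell[OF v0] that by (auto simp: recession_cone_def)
  obtain a1 b1 where 1: "v0 + d = pt a1 b1" "(\<Sum>v\<in>V. a1 v) = 1"
    using in_cell[of 1] by (auto simp: cell_def)
  define al where "al = (\<lambda>v. a1 v + (-1) * ?a v)"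
  have sal: "(\<Sum>v\<in>V. al v) = 0" using 1(2) sa by (simp add: al_def sum_subtractf)
  have d_eq: "d = pt al b1"
  proof -
    have "d = pt a1 b1 + (-1) *\<^sub>R pt ?a (\<lambda>_. 0)" using pt_single_V[OF v0] 1(1)[symmetric] by simp
    then show ?thesis unfolding pt_add_scaleR al_def by simp
  qed
  have pos: "(\<forall>v\<in>V. 0 \<le> ?a v + t * al v) \<and> (\<forall>r\<in>B. 0 \<le> 0 + t * b1 r)" if "t \<ge> 0" for t
  proof -
    have "v0 + t *\<^sub>R d = pt (\<lambda>v. ?a v + t * al v) (\<lambda>r. 0 + t * b1 r)"
      using pt_single_V[OF v0] d_eq pt_add_scaleR[of ?a "\<lambda>_. 0" t al b1] by simp
    then show ?thesis
      using pt_in_cellD[of "\<lambda>v. ?a v + t * al v" "\<lambda>r. 0 + t * b1 r"] in_cell[OF that] sal sa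
      by (simp add: sum.distrib flip: sum_distrib_left)
  qed
  have "al v \<ge> 0" if "v \<in> V" for v
    using nonneg_line_imp_slope_nonneg[of "?a v" "al v"] pos that by blast
  then have "al v = 0" if "v \<in> V" for v
    using sum_nonneg_eq_0_iff[OF finite_V, of al] sal that by auto
  then have "pt al b1 = pt (\<lambda>_. 0) b1" by (simp add: pt_def)
  moreover have "\<forall>r\<in>B. 0 \<le> b1 r" using pos[of 1] by simp
  ultimately show "d \<in> {pt (\<lambda>_. 0) b | b. \<forall>r\<in>B. 0 \<le> b r}" using d_eq by auto
next
  fix d assume "d \<in> {pt (\<lambda>_. 0) b | b. \<forall>r\<in>B. 0 \<le> b r}"
  then obtain b where b: "d = pt (\<lambda>_. 0) b" "\<forall>r\<in>B. 0 \<le> b r" by auto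
  have "pt a' b' + t *\<^sub>R pt (\<lambda>_. 0) b \<in> cell"
    if "\<forall>v\<in>V. 0 \<le> a' v" "\<forall>r\<in>B. 0 \<le> b' r" "(\<Sum>v\<in>V. a' v) = 1" "t \<ge> 0" for a' b' t
    unfolding pt_add_scaleR using that b(2) by (intro cellI) auto
  then show "d \<in> recession_cone cell" by (auto simp: recession_cone_def b(1) cell_def)
qed

text \<open>A full line bounds the slopes of the coefficients from both sides, so all of them
  vanish, and with them the direction.\<close>

lemma pointed_cell: "pointed cell"
proof -
  have False if d: "d \<noteq> 0" and line: "\<And>t::real. x + t *\<^sub>R d \<in> cell" for x d
  proof -
    have x: "x \<in> cell" using line[of 0] by simp
    then obtain a b where ab: "x = pt a b" "(\<Sum>v\<in>V. a v) = 1"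
      by (auto simp: cell_def)
    obtain a1 b1 where 1: "x + d = pt a1 b1" "(\<Sum>v\<in>V. a1 v) = 1"
      using line[of 1] by (auto simp: cell_def)
    define al where "al = (\<lambda>v. a1 v + (-1) * a v)"
    define be where "be = (\<lambda>v. b1 v + (-1) * b v)"
    have d_eq: "d = pt al be"
      using 1(1) ab(1) pt_add_scaleR[of a1 b1 "-1" a b] unfolding al_def be_def
      by (metis add_diff_cancel_left' diff_conv_add_uminus scaleR_minus1_left)
    have sal: "(\<Sum>v\<in>V. al v) = 0" using 1(2) ab(2) by (simp add: al_def sum_subtractf)
    have pos: "(\<forall>v\<in>V. 0 \<le> a v + t * al v) \<and> (\<forall>r\<in>B. 0 \<le> b r + t * be r)" for t
      using pt_in_cellD[of "\<lambda>v. a v + t * al v" "\<lambda>r. b r + t * be r"] line[of t] sal ab(2)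
      unfolding ab(1) d_eq pt_add_scaleR
      by (simp add: sum.distrib flip: sum_distrib_left)
    have "al v = 0" if "v \<in> V" for v
    proof -
      have "al v \<ge> 0" using nonneg_line_imp_slope_nonneg[of "a v" "al v"] pos that by blast
      moreover have "- al v \<ge> 0"
        using nonneg_line_imp_slope_nonneg[of "a v" "- al v"] pos[of "- _"] that by auto
      ultimately show ?thesis by simp
    qed
    moreover have "be v = 0" if "v \<in> B" for v
    proof -
      have "be v \<ge> 0" using nonneg_line_imp_slope_nonneg[of "b v" "be v"] pos that by blast
      moreover have "- be v \<ge> 0"
        using nonneg_line_imp_slope_nonneg[of "b v" "- be v"] pos[of "- _"] that by auto
      ultimately show ?thesis by simp
    qed
    ultimately have "d = 0" unfolding d_eq pt_def by simp
    then show False using d by simp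
  qed
  then show ?thesis unfolding pointed_def by blast
qed

text \<open>A positive ray coefficient lets a point move both ways along the ray, and a vertex
  coefficient strictly between 0 and 1 puts it inside a segment. Conversely, if a vertex lies inside
  a segment, independence makes the coefficients of both endpoints vanish wherever those of the
  vertex do.\<close>

lemma extreme_points_cell: "{v. v extreme_point_of cell} = V"
proof (intro subset_antisym subsetI)
  fix x assume "x \<in> {v. v extreme_point_of cell}"
  then have x: "x \<in> cell" and ext: "\<And>p q. p \<in> cell \<Longrightarrow> q \<in> cell \<Longrightarrow> x \<notin> open_segment p q"
    by (auto simp: extreme_point_of_def)
  obtain a b where ab: "x = pt a b" "\<forall>v\<in>V. 0 \<le> a v" "\<forall>r\<in>B. 0 \<le> b r" "(\<Sum>v\<in>V. a v) = 1"
    using x by (auto simp: cell_def)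
  have b0: "b r = 0" if r: "r \<in> B" for r
  proof (rule ccontr)
    assume "b r \<noteq> 0"
    then have br: "b r > 0" using ab(3) r by force
    have mem: "x + t *\<^sub>R r \<in> cell" if "t \<ge> - b r" for t
    proof -
      have "x + t *\<^sub>R r = pt (\<lambda>v. a v + t * 0) (\<lambda>u. b u + t * (if u = r then 1 else 0))"
        unfolding pt_add_scaleR[symmetric] pt_single_B[OF r] ab(1) ..
      moreover have "\<dots> \<in> cell" using ab that by (intro cellI) auto
      ultimately show ?thesis by simp
    qed
    have "r \<noteq> 0" using norm_B[OF r] by auto
    then have "(2 * b r) *\<^sub>R r \<noteq> 0" using br by simp
    then have ne: "x + (- b r) *\<^sub>R r \<noteq> x + b r *\<^sub>R r"
      by (auto simp: algebra_simps scaleR_2 simp flip: scaleR_scaleR)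
    have "x = midpoint (x + (- b r) *\<^sub>R r) (x + b r *\<^sub>R r)"
      by (simp add: midpoint_def algebra_simps flip: scaleR_2)
    then have "x \<in> open_segment (x + (- b r) *\<^sub>R r) (x + b r *\<^sub>R r)"
      using ne midpoint_in_open_segment by metis
    then show False using ext mem[of "- b r"] mem[of "b r"] br by auto
  qed
  obtain v where v: "v \<in> V" "a v > 0"
    using ab(2,4) by (metis less_eq_real_def sum.neutral zero_neq_one)
  have "x = v"
  proof (cases "a v = 1")
    case True
    have "sum a (V - {v}) = 0" using sum.remove[OF finite_V v(1), of a] ab(4) True by simp
    then have z: "\<forall>u\<in>V-{v}. a u = 0"
      using sum_nonneg_eq_0_iff[of "V - {v}" a] finite_V ab(2) by auto
    have "x = pt (\<lambda>u. if u = v then 1 else 0) (\<lambda>_. 0)"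
      unfolding ab(1) pt_def using z True b0
      by (intro arg_cong2[where f="(+)"] sum.cong) auto
    then show ?thesis using pt_single_V[OF v(1)] by simp
  next
    case False
    have "a v \<le> sum a V" using member_le_sum[OF v(1), of a] ab(2) finite_V by auto
    then have lt: "a v < 1" using False ab(4) by simp
    \<comment> \<open>\<open>s\<close> is the mass left beside \<open>v\<close>; rescaled by it, the
      remaining coefficients give a point \<open>y\<close> of the cell, and \<open>x\<close> divides
      the segment from \<open>v\<close> to \<open>y\<close>.\<close>
    define s where "s = 1 - a v"
    have s: "s > 0" "s < 1" using lt v by (auto simp: s_def)
    define y where "y = pt (\<lambda>u. if u = v then 0 else a u / s) (\<lambda>_. 0)"
    have sr: "sum a (V - {v}) = s" using sum.remove[OF finite_V v(1), of a] ab(4) by (simp add: s_def)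
    have "(\<Sum>u\<in>V. if u = v then 0 else a u / s) = 1"
      using sum.remove[OF finite_V v(1), of "\<lambda>u. if u = v then 0 else a u / s"] sr s
      by (simp flip: sum_divide_distrib)
    then have y: "y \<in> cell" unfolding y_def using ab(2) s by (intro cellI) auto
    let ?d = "\<lambda>u. if u = v then 1 else 0 :: real"
    have "(1 - s) *\<^sub>R v + s *\<^sub>R y = pt (\<lambda>_. 0) (\<lambda>_. 0) + (1 - s) *\<^sub>R pt ?d (\<lambda>_. 0) + s *\<^sub>R y"
      unfolding pt_single_V[OF v(1)] by (simp add: pt_def)
    also have "\<dots> = pt (\<lambda>u. 0 + (1 - s) * ?d u + s * (if u = v then 0 else a u / s)) (\<lambda>_. 0)"
      unfolding y_def pt_add_scaleR by simp
    also have "(\<lambda>u. 0 + (1 - s) * ?d u + s * (if u = v then 0 else a u / s)) = a"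
      using s(1) by (auto simp: s_def)
    also have "pt a (\<lambda>_. 0) = x" unfolding ab(1) pt_def using b0 by simp
    finally have xe: "x = (1 - s) *\<^sub>R v + s *\<^sub>R y" by simp
    show ?thesis
    proof (cases "v = y")
      case True
      then show ?thesis using xe by (simp flip: scaleR_add_left)
    next
      case False
      then have "x \<in> open_segment v y" using xe s by (auto simp: in_segment)
      then show ?thesis using ext V_subset_cell[OF v(1)] y by blast
    qed
  qed
  then show "x \<in> V" using v by simp
next
  fix v assume v: "v \<in> V"
  let ?d = "\<lambda>u. if u = v then 1 else 0 :: real"
  have False if pq: "p \<in> cell" "q \<in> cell" and seg: "v \<in> open_segment p q" for p q
  proof -
    obtain t where t: "v = (1 - t) *\<^sub>R p + t *\<^sub>R q" "0 < t" "t < 1" and pne: "p \<noteq> q"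
      using seg by (auto simp: in_segment)
    obtain a b where ab: "p = pt a b" "\<forall>v\<in>V. 0 \<le> a v" "\<forall>r\<in>B. 0 \<le> b r" "(\<Sum>v\<in>V. a v) = 1"
      using pq(1) by (auto simp: cell_def)
    obtain a' b' where ab': "q = pt a' b'" "\<forall>v\<in>V. 0 \<le> a' v" "\<forall>r\<in>B. 0 \<le> b' r" "(\<Sum>v\<in>V. a' v) = 1"
      using pq(2) by (auto simp: cell_def)
    have "pt ?d (\<lambda>_. 0) = pt (\<lambda>_. 0) (\<lambda>_. 0) + (1 - t) *\<^sub>R p + t *\<^sub>R q"
      using pt_single_V[OF v] t(1) by (simp add: pt_def)
    also have "\<dots> = pt (\<lambda>u. (1 - t) * a u + t * a' u) (\<lambda>u. (1 - t) * b u + t * b' u)"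
      unfolding ab(1) ab'(1) pt_add_scaleR by simp
    finally have e: "pt ?d (\<lambda>_. 0) = \<dots>" .
    have eqs: "(\<forall>u\<in>V. ?d u = (1 - t) * a u + t * a' u) \<and> (\<forall>r\<in>B. 0 = (1 - t) * b r + t * b' r)"
      by (rule pt_inj[OF _ e])
        (use ab(4) ab'(4) v finite_V in \<open>simp add: sum.distrib flip: sum_distrib_left\<close>)
    have z: "x = 0 \<and> y = 0" if "0 = (1 - t) * x + t * y" "0 \<le> x" "0 \<le> y" for x y
      using that t by (metis add_nonneg_eq_0_iff diff_gt_0_iff_gt less_imp_le mult_nonneg_nonneg
          mult_eq_0_iff less_irrefl)
    have 1: "a u = 0 \<and> a' u = 0" if "u \<in> V" "u \<noteq> v" for u
      using z[of "a u" "a' u"] eqs that ab(2) ab'(2) by auto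
    have 2: "b r = 0 \<and> b' r = 0" if "r \<in> B" for r
      using z[of "b r" "b' r"] eqs that ab(3) ab'(3) by auto
    have 3: "a v = 1" "a' v = 1"
      using sum.remove[OF finite_V v, of a] sum.remove[OF finite_V v, of a'] 1 ab(4) ab'(4) by simp_all
    have "a u = a' u" if "u \<in> V" for u using 1[OF that] 3 by (cases "u = v") auto
    then have "p = q" unfolding ab(1) ab'(1) pt_def using 2 by simp
    then show False using pne by simp
  qed
  then show "v \<in> {v. v extreme_point_of cell}"
    using V_subset_cell[OF v] by (auto simp: extreme_point_of_def)
qed

lemma extremal_rays_cell: "extremal_rays cell = B"
proof (intro subset_antisym subsetI)
  fix d assume "d \<in> extremal_rays cell"
  then have nd: "norm d = 1" and face: "(\<lambda>t. t *\<^sub>R d) ` {0..} face_of recession_cone cell"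
    by (auto simp: extremal_rays_def)
  have "1 *\<^sub>R d \<in> (\<lambda>t. t *\<^sub>R d) ` {0..}" by (rule imageI) simp
  then have "d \<in> recession_cone cell" using face_of_imp_subset[OF face] by auto
  then obtain b where b: "d = pt (\<lambda>_. 0) b" "\<forall>r\<in>B. 0 \<le> b r"
    unfolding recession_cone_cell by auto
  have "\<exists>r\<in>B. b r \<noteq> 0"
  proof (rule ccontr)
    assume "\<not> ?thesis"
    then have "d = 0" by (simp add: b(1) pt_def)
    then show False using nd by simp
  qed
  then obtain r where r: "r \<in> B" "b r > 0" using b(2) by force
  \<comment> \<open>\<open>d\<close> is the midpoint of twice its \<open>r\<close>-component and
    twice the rest, so the face property puts the former on the ray of \<open>d\<close>. Norm 1 then
    turns parallel into equal.\<close>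
  let ?p = "(2 * b r) *\<^sub>R r" and ?q = "2 *\<^sub>R d - (2 * b r) *\<^sub>R r"
  have p_eq: "?p = pt (\<lambda>_. 0) (\<lambda>u. if u = r then 2 * b r else 0)"
    by (simp add: pt_def finite_B r(1) if_distrib[where f="\<lambda>c. c *\<^sub>R _"] cong: if_cong)
  have pin: "?p \<in> recession_cone cell" unfolding recession_cone_cell p_eq using r(2) by auto
  have q_eq: "?q = pt (\<lambda>_. 0) (\<lambda>u. if u = r then 0 else 2 * b u)"
  proof -
    have "?q = pt (\<lambda>_. 0) (\<lambda>_. 0) + 2 *\<^sub>R d + (-1) *\<^sub>R ?p" by (simp add: pt_def)
    also have "\<dots> = pt (\<lambda>_. 0) (\<lambda>u. if u = r then 0 else 2 * b u)"
      unfolding p_eq b(1) pt_add_scaleR by (simp add: pt_def) (intro sum.cong, auto)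
    finally show ?thesis .
  qed
  have qin: "?q \<in> recession_cone cell" unfolding recession_cone_cell q_eq using b(2) by auto
  have "?p \<in> (\<lambda>t. t *\<^sub>R d) ` {0..}"
  proof (cases "?p = ?q")
    case True
    then have "?p = d"
      by (metis add_diff_cancel_left' diff_add_cancel real_vector.scale_left_imp_eq scaleR_2 zero_neq_numeral)
    then show ?thesis using \<open>1 *\<^sub>R d \<in> _\<close> by simp
  next
    case False
    have "d = midpoint ?p ?q" by (simp add: midpoint_def)
    then have "d \<in> open_segment ?p ?q" using False midpoint_in_open_segment by metis
    then show ?thesis
      using face_ofD[OF face _ pin qin] \<open>1 *\<^sub>R d \<in> _\<close> by auto
  qed
  then obtain t where t: "t \<ge> 0" "(2 * b r) *\<^sub>R r = t *\<^sub>R d" by auto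
  have "2 * b r = t" using arg_cong[OF t(2), of norm] norm_B[OF r(1)] nd t(1) r(2) by simp
  then have "r = d" using t(2) r(2) by simp
  then show "d \<in> B" using r by simp
next
  fix r assume r: "r \<in> B"
  have ray_eq: "t *\<^sub>R r = pt (\<lambda>_. 0) (\<lambda>u. if u = r then t else 0)" for t
    by (simp add: pt_def finite_B r if_distrib[where f="\<lambda>c. c *\<^sub>R _"] cong: if_cong)
  have "(\<lambda>t. t *\<^sub>R r) ` {0..} face_of recession_cone cell"
    unfolding face_of_def
  proof (intro conjI ballI impI)
    show "(\<lambda>t. t *\<^sub>R r) ` {0..} \<subseteq> recession_cone cell"
      unfolding recession_cone_cell using ray_eq by force
    show "convex ((\<lambda>t. t *\<^sub>R r) ` {0..})"
      by (intro convex_linear_image) (auto simp: linear_iff scaleR_add_left)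
  next
    fix p q x assume p: "p \<in> recession_cone cell" and q: "q \<in> recession_cone cell"
      and x: "x \<in> (\<lambda>t. t *\<^sub>R r) ` {0..}" and seg: "x \<in> open_segment p q"
    obtain b where b: "p = pt (\<lambda>_. 0) b" "\<forall>r\<in>B. 0 \<le> b r" using p recession_cone_cell by auto
    obtain b' where b': "q = pt (\<lambda>_. 0) b'" "\<forall>r\<in>B. 0 \<le> b' r" using q recession_cone_cell by auto
    obtain s where s: "s \<ge> 0" "x = s *\<^sub>R r" using x by auto
    obtain t where t: "x = (1 - t) *\<^sub>R p + t *\<^sub>R q" "0 < t" "t < 1"
      using seg by (auto simp: in_segment)
    have "pt (\<lambda>_. 0) (\<lambda>u. if u = r then s else 0) = pt (\<lambda>_. 0) (\<lambda>_. 0) + (1 - t) *\<^sub>R p + t *\<^sub>R q"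
      unfolding ray_eq[symmetric] s(2)[symmetric] t(1) by (simp add: pt_def)
    also have "\<dots> = pt (\<lambda>u. 0) (\<lambda>u. (1 - t) * b u + t * b' u)"
      unfolding b(1) b'(1) pt_add_scaleR by simp
    finally have e: "pt (\<lambda>_. 0) (\<lambda>u. if u = r then s else 0) = \<dots>" .
    have eqs: "\<forall>u\<in>B. (if u = r then s else 0) = (1 - t) * b u + t * b' u"
      using pt_inj[OF _ e] by simp
    have z: "x = 0 \<and> y = 0" if "0 = (1 - t) * x + t * y" "0 \<le> x" "0 \<le> y" for x y
      using that t by (metis add_nonneg_eq_0_iff diff_gt_0_iff_gt less_imp_le mult_nonneg_nonneg
          mult_eq_0_iff less_irrefl)
    have 1: "b u = 0 \<and> b' u = 0" if "u \<in> B" "u \<noteq> r" for u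
      using z[of "b u" "b' u"] eqs that b(2) b'(2) by auto
    have "p = b r *\<^sub>R r" unfolding ray_eq b(1) pt_def
      using 1 by (intro arg_cong2[where f="(+)"] sum.cong) auto
    moreover have "q = b' r *\<^sub>R r" unfolding ray_eq b'(1) pt_def
      using 1 by (intro arg_cong2[where f="(+)"] sum.cong) auto
    ultimately show "p \<in> (\<lambda>t. t *\<^sub>R r) ` {0..}" "q \<in> (\<lambda>t. t *\<^sub>R r) ` {0..}"
      using b(2) b'(2) r by auto
  qed
  then show "r \<in> extremal_rays cell" using norm_B[OF r] by (simp add: extremal_rays_def)
qed

lemma simplihedron_cell:
  assumes "polyhedron cell"
  shows "simplihedron cell"
proof -
  have "\<exists>!(a, b). a \<in> V \<rightarrow>\<^sub>E {0::real..} \<and> b \<in> B \<rightarrow>\<^sub>E {0::real..} \<and> (\<Sum>v\<in>V. a v) = 1 \<and>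
         x = (\<Sum>v\<in>V. a v *\<^sub>R v) + (\<Sum>r\<in>B. b r *\<^sub>R r)" if x: "x \<in> cell" for x
  proof -
    obtain a b where ab: "x = pt a b" "\<forall>v\<in>V. 0 \<le> a v" "\<forall>r\<in>B. 0 \<le> b r" "(\<Sum>v\<in>V. a v) = 1"
      using x by (auto simp: cell_def)
    show ?thesis
    proof (rule ex1I[of _ "(restrict a V, restrict b B)"], goal_cases)
      case 1
      then show ?case using ab by (auto simp: pt_def)
    next
      case (2 y)
      obtain a' b' where y: "y = (a', b')" by (cases y)
      have *: "a' \<in> V \<rightarrow>\<^sub>E {0::real..}" "b' \<in> B \<rightarrow>\<^sub>E {0::real..}" "(\<Sum>v\<in>V. a' v) = 1" "x = pt a' b'"
        using 2 by (auto simp: y pt_def)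
      have "(\<forall>v\<in>V. a v = a' v) \<and> (\<forall>r\<in>B. b r = b' r)"
        using pt_inj[of a a' b b'] * ab by simp
      then show ?case unfolding y using *(1,2)
        by (auto simp: PiE_iff extensional_def fun_eq_iff restrict_def)
    qed
  qed
  then show ?thesis
    unfolding simplihedron_def Let_def extreme_points_cell extremal_rays_cell
    by (intro conjI ballI assms pointed_cell)
qed

end

section \<open>Words and trails\<close>

lemma nth_concat_replicate:
  "i < n * length w \<Longrightarrow> concat (replicate n w) ! i = w ! (i mod length w)"
proof (induction n arbitrary: i)
  case (Suc n)
  show ?case
  proof (cases "i < length w")
    case False
    then have "i - length w < n * length w" using Suc.prems by simp
    then show ?thesis using Suc.IH[of "i - length w"] False by (simp add: nth_append le_mod_geq)
  qed (simp add: nth_append)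
qed simp

lemma length_concat_replicate: "length (concat (replicate n w)) = n * length w"
  by (induction n) auto

lemma rotate_concat_replicate: "rotate k (concat (replicate n w)) = concat (replicate n (rotate k w))"
proof (rule nth_equalityI)
  fix i assume "i < length (rotate k (concat (replicate n w)))"
  then have i: "i < n * length w" by (simp add: length_concat_replicate)
  then have pos: "length w > 0" "n * length w > 0" by (auto intro: Nat.gr0I)
  have "rotate k (concat (replicate n w)) ! i = w ! ((k + i) mod length w)"
    using i pos by (simp add: nth_rotate length_concat_replicate nth_concat_replicate mod_mult_self1
        mod_mod_cancel)
  also have "\<dots> = concat (replicate n (rotate k w)) ! i"
    using i pos by (simp add: nth_rotate nth_concat_replicate mod_add_right_eq)
  finally show "rotate k (concat (replicate n w)) ! i = concat (replicate n (rotate k w)) ! i" .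
qed (simp add: length_concat_replicate)

lemma rotate_inverse: "\<exists>m. rotate m (rotate n w) = w"
proof (cases "w = []")
  case False
  have "rotate (n * length w - n) (rotate n w) = rotate (n * length w) w"
    using False by (simp add: rotate_rotate le_add_diff_inverse2 Suc_leI)
  also have "\<dots> = w" by (metis mod_mult_self2_is_0 rotate_conv_mod rotate0 id_apply)
  finally show ?thesis by blast
qed simp

lemma range_rotate_rotate: "range (\<lambda>m. rotate m (rotate n w)) = range (\<lambda>m. rotate m w)"
proof -
  obtain k where k: "rotate k (rotate n w) = w" using rotate_inverse by blast
  have "rotate m w = rotate (m + k) (rotate n w)" for m using k by (metis rotate_rotate)
  then show ?thesis by (auto simp: rotate_rotate)
qed

definition primitive :: "'b list \<Rightarrow> bool" where
  "primitive w \<longleftrightarrow> \<not> (\<exists>x n. length x < length w \<and> w = concat (replicate n x))"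

lemma primitive_rotate:
  assumes "primitive w" shows "primitive (rotate n w)"
  unfolding primitive_def
proof (rule notI, elim exE conjE)
  fix x m assume x: "length x < length (rotate n w)" "rotate n w = concat (replicate m x)"
  obtain k where "rotate k (rotate n w) = w" using rotate_inverse by blast
  then have "w = concat (replicate m (rotate k x))" using x(2) rotate_concat_replicate by metis
  then show False using assms x(1) unfolding primitive_def by (metis length_rotate)
qed

text \<open>Bezout over the natural numbers gives \<open>m * x = k * y + gcd m k\<close>. Adding
  \<open>y\<close> periods \<open>k\<close> turns the shift by the gcd into \<open>x\<close> periods
  \<open>m\<close>, so all shifts go forward.\<close>

lemma period_gcd:
  fixes g :: "nat \<Rightarrow> 'c"
  assumes "\<And>i. g (i + m) = g i" "\<And>i. g (i + k) = g i" "m \<noteq> 0"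
  shows "g (i + gcd m k) = g i"
proof -
  have mult: "g (i + n * p) = g i" if "\<And>i. g (i + p) = g i" for i n p
    by (induction n) (simp_all add: that add.assoc[symmetric] add.commute[of p] flip: add.assoc)
  obtain x y where xy: "m * x = k * y + gcd m k" using bezout_nat[OF assms(3)] by blast
  have "g (i + gcd m k) = g (i + gcd m k + y * k)" using mult[OF assms(2)] by simp
  also have "\<dots> = g (i + x * m)" using xy by (simp add: algebra_simps)
  also have "\<dots> = g i" by (rule mult[OF assms(1)])
  finally show ?thesis .
qed

text \<open>A cyclic period \<open>d\<close> that divides the length makes \<open>w\<close> a power
  of its prefix of length \<open>d\<close>.\<close>

lemma primitive_no_proper_period:
  assumes "primitive w" "d > 0" "d dvd length w" "\<And>i. w ! ((i + d) mod length w) = w ! (i mod length w)"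
  shows "d \<ge> length w"
proof (rule ccontr)
  assume "\<not> d \<ge> length w"
  then have d: "d < length w" by simp
  have mult: "w ! ((i + n * d) mod length w) = w ! (i mod length w)" for i n
  proof (induction n)
    case (Suc n)
    then show ?case using assms(4)[of "i + n * d"] by (simp add: add_ac)
  qed simp
  obtain n where n: "length w = n * d" using assms(3) by (metis dvd_def mult.commute)
  have "w = concat (replicate n (take d w))"
  proof (rule nth_equalityI)
    fix i assume i: "i < length w"
    have "w ! i = w ! ((i mod d + (i div d) * d) mod length w)" using i by simp
    also have "\<dots> = w ! (i mod d)" unfolding mult using d assms(2)
      by (metis mod_less order_less_trans mod_less_divisor)
    finally show "w ! i = concat (replicate n (take d w)) ! i"
      using i d n assms(2) by (simp add: nth_concat_replicate)
  qed (use n d in \<open>simp add: length_concat_replicate\<close>)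
  then show False using assms(1) d unfolding primitive_def by (metis length_take min.absorb2 nat_less_le)
qed

text \<open>Routes and bands are both read through \<open>letter\<close>, a function of the position: it ends after the
  last arc of a route and is periodic for a band. Occurrences in a band are counted by their starting
  positions within one period.\<close>

fun rep :: "'b trail \<Rightarrow> 'b list" where
  "rep (Route w) = w"
| "rep (Band W) = (SOME w. w \<in> W)"

fun letter :: "'b trail \<Rightarrow> nat \<Rightarrow> 'b option" where
  "letter (Route w) i = (if i < length w then Some (w ! i) else None)"
| "letter (Band W) i = Some (rep (Band W) ! (i mod length (rep (Band W))))"

definition matches :: "'b trail \<Rightarrow> nat \<Rightarrow> 'b list \<Rightarrow> bool" where
  "matches T c P \<longleftrightarrow> (\<forall>i<length P. letter T (c + i) = Some (P ! i))"

definition occ :: "'b trail \<Rightarrow> 'b list \<Rightarrow> nat" where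
  "occ T P = card {c. c < length (rep T) \<and> matches T c P}"

lemma matches_snoc: "matches T c (P @ [f]) \<longleftrightarrow> matches T c P \<and> letter T (c + length P) = Some f"
  by (auto simp: matches_def nth_append less_Suc_eq)

lemma matches_Cons: "matches T c (e # P) \<longleftrightarrow> letter T c = Some e \<and> matches T (Suc c) P"
  by (auto simp: matches_def nth_Cons less_Suc_eq_0_disj split: nat.split)

lemma occ_single: "occ T [e] = count_list (rep T) e"
proof -
  have "matches T c [e] \<longleftrightarrow> rep T ! c = e" if "c < length (rep T)" for c
    using that by (cases T) (auto simp: matches_def)
  then have "{c. c < length (rep T) \<and> matches T c [e]} = {c. c < length (rep T) \<and> rep T ! c = e}"
    by auto
  then show ?thesis
    by (simp add: occ_def count_list_eq_length_filter length_filter_conv_card eq_commute)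
qed

lemma traversals_nth: "traversals T $ e = real (occ T [e])"
  by (cases T) (simp_all add: occ_single)

lemma occ_posD: "occ T P \<noteq> 0 \<Longrightarrow> \<exists>c < length (rep T). matches T c P"
  unfolding occ_def by (metis (mono_tags, lifting) Collect_empty_eq card.empty)

lemma occ_eq_1I:
  assumes "\<And>c. c < length (rep T) \<Longrightarrow> matches T c P \<longleftrightarrow> c = c0" "c0 < length (rep T)"
  shows "occ T P = 1"
proof -
  have "{c. c < length (rep T) \<and> matches T c P} = {c0}" using assms by auto
  then show ?thesis by (simp add: occ_def)
qed

section \<open>Trails as walks, and recursions for their occurrence counts\<close>

locale framed_digraph = fin_digraph G for G :: "('a, 'b::finite) pre_digraph" +
  fixes R :: "('a, 'b) framing"
  assumes framing: "is_framing G R"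
begin

lemma internals_iff: "v \<in> internals G \<longleftrightarrow> v \<in> verts G \<and> in_arcs G v \<noteq> {} \<and> out_arcs G v \<noteq> {}"
  by (auto simp: internals_def sources_def sinks_def)

lemma awalk_iff_nth:
  assumes "p \<noteq> []"
  shows "awalk u p v \<longleftrightarrow> set p \<subseteq> arcs G \<and> tail G (hd p) = u \<and> head G (last p) = v \<and>
    (\<forall>i. Suc i < length p \<longrightarrow> head G (p ! i) = tail G (p ! Suc i))"
  using assms
proof (induction p arbitrary: u)
  case (Cons e p)
  show ?case
  proof (cases "p = []")
    case True
    then show ?thesis by (auto simp: awalk_def)
  next
    case False
    have "(\<forall>i. Suc i < length (e # p) \<longrightarrow> head G ((e # p) ! i) = tail G ((e # p) ! Suc i)) \<longleftrightarrow>
      head G e = tail G (hd p) \<and> (\<forall>i. Suc i < length p \<longrightarrow> head G (p ! i) = tail G (p ! Suc i))"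
      using False by (auto simp: nth_Cons hd_conv_nth split: nat.split)
    moreover have "awalk u (e # p) v \<longleftrightarrow> e \<in> arcs G \<and> tail G e = u \<and> awalk (head G e) p v"
      by (auto simp: awalk_def)
    ultimately show ?thesis using Cons.IH[OF False, of "head G e"] False by auto
  qed
qed simp

lemma awalk_rotate:
  assumes "awalk u w u" shows "\<exists>u'. awalk u' (rotate n w) u'"
proof -
  let ?m = "n mod length w"
  obtain x where "awalk u (take ?m w) x" "awalk x (drop ?m w) u"
    using assms awalk_append_iff[of u "take ?m w" "drop ?m w" u] by auto
  then have "awalk x (drop ?m w @ take ?m w) x" using awalk_append_iff by auto
  then show ?thesis by (metis rotate_drop_take)
qed

text \<open>The representative picked by \<open>SOME\<close> is some rotation of the defining word;
  being closed, being primitive and the class of rotations are all invariant under rotation.\<close>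

lemma bands_rep:
  assumes "T \<in> bands G"
  shows "\<exists>u. awalk u (rep T) u" "rep T \<noteq> []" "primitive (rep T)" "T = Band (range (\<lambda>n. rotate n (rep T)))"
proof -
  obtain w u where w: "T = Band (range (\<lambda>n. rotate n w))" "w \<noteq> []" "awalk u w u" "primitive w"
    using assms unfolding bands_def primitive_def by blast
  have "rep T \<in> range (\<lambda>n. rotate n w)" unfolding w(1) rep.simps by (rule someI) (rule rangeI)
  then obtain n where n: "rep T = rotate n w" by auto
  show "\<exists>u. awalk u (rep T) u" unfolding n using awalk_rotate[OF w(3)] .
  show "rep T \<noteq> []" using n w(2) by simp
  show "primitive (rep T)" unfolding n using primitive_rotate w(4) by blast
  show "T = Band (range (\<lambda>n. rotate n (rep T)))" unfolding n range_rotate_rotate by (rule w(1))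
qed

lemma bands_letter: "T \<in> bands G \<Longrightarrow> letter T i = Some (rep T ! (i mod length (rep T)))"
  using bands_rep(4)[of T] by (metis letter.simps(2))

lemma band_arc:
  assumes "T \<in> bands G" shows "rep T ! (i mod length (rep T)) \<in> arcs G"
    "head G (rep T ! (i mod length (rep T))) = tail G (rep T ! (Suc i mod length (rep T)))"
proof -
  note b = bands_rep[OF assms]
  obtain u where "awalk u (rep T) u" using b(1) by blast
  then have w: "set (rep T) \<subseteq> arcs G" "tail G (hd (rep T)) = u" "head G (last (rep T)) = u"
    "\<And>i. Suc i < length (rep T) \<Longrightarrow> head G (rep T ! i) = tail G (rep T ! Suc i)"
    using awalk_iff_nth[OF b(2)] by auto
  show "rep T ! (i mod length (rep T)) \<in> arcs G" using w(1) b(2) by (simp add: subset_eq)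
  show "head G (rep T ! (i mod length (rep T))) = tail G (rep T ! (Suc i mod length (rep T)))"
  proof (cases "Suc (i mod length (rep T)) = length (rep T)")
    case True
    then have "i mod length (rep T) = length (rep T) - 1" by simp
    then show ?thesis using True w(2,3) b(2) by (simp add: mod_Suc hd_conv_nth last_conv_nth)
  next
    case False
    then have "Suc (i mod length (rep T)) < length (rep T)" using b(2) by (simp add: Suc_lessI)
    then show ?thesis using w(4) False by (simp add: mod_Suc)
  qed
qed

lemma routes_rep:
  assumes "T \<in> routes G"
  obtains p where "T = Route p" "p \<noteq> []" "set p \<subseteq> arcs G" "tail G (hd p) \<in> sources G"
    "head G (last p) \<in> sinks G" "\<And>i. Suc i < length p \<Longrightarrow> head G (p ! i) = tail G (p ! Suc i)"
  using assms unfolding routes_def by (auto simp: awalk_iff_nth)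

lemma trails_cases:
  assumes "T \<in> trails G" obtains "T \<in> routes G" | "T \<in> bands G"
  using assms by (auto simp: trails_def)

lemma rep_nonempty: "T \<in> trails G \<Longrightarrow> rep T \<noteq> []"
  by (auto elim!: trails_cases routes_rep dest: bands_rep(2))

lemma letter_arc: "\<lbrakk>T \<in> trails G; letter T i = Some e\<rbrakk> \<Longrightarrow> e \<in> arcs G"
  by (auto elim!: trails_cases routes_rep simp: bands_letter band_arc subset_iff split: if_splits)

lemma letter_Suc: "\<lbrakk>T \<in> trails G; letter T i = Some e; letter T (Suc i) = Some f\<rbrakk> \<Longrightarrow> head G e = tail G f"
  using band_arc(2)[of T i]
  by (auto elim!: trails_cases routes_rep simp: bands_letter split: if_splits)

lemma letter_next: "\<lbrakk>T \<in> trails G; letter T i = Some e; head G e \<notin> sinks G\<rbrakk> \<Longrightarrow> \<exists>f. letter T (Suc i) = Some f"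
proof (erule trails_cases)
  assume e: "letter T i = Some e" "head G e \<notin> sinks G" and "T \<in> routes G"
  then obtain p where p: "T = Route p" "p \<noteq> []" "head G (last p) \<in> sinks G" by (auto elim: routes_rep)
  then have i: "i < length p" "e = p ! i" using e by (auto split: if_splits)
  have "i \<noteq> length p - 1" using e(2) p(2,3) i(2) by (metis last_conv_nth)
  then show ?thesis using i p by auto
qed (simp add: bands_letter)

lemma letter_prev: "\<lbrakk>T \<in> trails G; letter T (Suc i) = Some f\<rbrakk> \<Longrightarrow> \<exists>e. letter T i = Some e"
  by (auto elim!: trails_cases routes_rep simp: bands_letter split: if_splits)

lemma sources_not_head: "e \<in> arcs G \<Longrightarrow> head G e \<notin> sources G"
  by (auto simp: sources_def in_arcs_def)

lemma sinks_not_tail: "e \<in> arcs G \<Longrightarrow> tail G e \<notin> sinks G"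
  by (auto simp: sinks_def out_arcs_def)

lemma matches_walk:
  assumes "T \<in> trails G" "matches T c P"
  shows "set P \<subseteq> arcs G" "Suc i < length P \<Longrightarrow> head G (P ! i) = tail G (P ! Suc i)"
proof -
  show "set P \<subseteq> arcs G"
  proof
    fix e assume "e \<in> set P"
    then obtain j where "letter T (c + j) = Some e"
      using assms(2) by (auto simp: matches_def in_set_conv_nth)
    then show "e \<in> arcs G" by (rule letter_arc[OF assms(1)])
  qed
  assume i: "Suc i < length P"
  then have "letter T (c + i) = Some (P ! i)" "letter T (Suc (c + i)) = Some (P ! Suc i)"
    using assms(2) unfolding matches_def by (metis Suc_lessD, metis add_Suc_right)
  then show "head G (P ! i) = tail G (P ! Suc i)" using letter_Suc assms(1) by blast
qed

text \<open>A trail stops only at a sink, so an occurrence ending at an internal vertex is continued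
  by exactly one arc, with the same starting position.\<close>

lemma occ_snoc:
  assumes T: "T \<in> trails G" and P: "P \<noteq> []" and v: "head G (last P) = v" "v \<in> internals G"
  shows "occ T P = (\<Sum>f\<in>out_arcs G v. occ T (P @ [f]))"
proof -
  let ?S = "\<lambda>P. {c. c < length (rep T) \<and> matches T c P}"
  have "\<exists>f\<in>out_arcs G v. matches T c (P @ [f])" if "matches T c P" for c
  proof -
    have l: "letter T (c + (length P - 1)) = Some (last P)"
      using that P by (simp add: matches_def last_conv_nth)
    then obtain f where f: "letter T (Suc (c + (length P - 1))) = Some f"
      using letter_next[OF T l] v by (auto simp: internals_def)
    then have "f \<in> out_arcs G v" using letter_Suc[OF T l f] v letter_arc[OF T f] by simp
    then show ?thesis using f that P by (intro bexI[of _ f]) (simp_all add: matches_snoc Suc_pred'[symmetric] flip: add_Suc_right)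
  qed
  then have "?S P = (\<Union>f\<in>out_arcs G v. ?S (P @ [f]))" by (auto simp: matches_snoc)
  moreover have "card (\<Union>f\<in>out_arcs G v. ?S (P @ [f])) = (\<Sum>f\<in>out_arcs G v. card (?S (P @ [f])))"
    by (rule card_UN_disjoint) (auto simp: matches_snoc)
  ultimately show ?thesis unfolding occ_def by simp
qed

text \<open>Prepending an arc shifts the starting positions by one; this exchanges the position lost
  at one end for the one gained at the other. A route has a match at neither: it begins at a source,
  and it is over at its length.\<close>

lemma matches_period:
  assumes T: "T \<in> trails G" and P: "P \<noteq> []" and v: "tail G (hd P) \<in> internals G"
  shows "matches T (length (rep T)) P \<longleftrightarrow> matches T 0 P"
  using T
proof (cases rule: trails_cases)
  case 1
  then obtain p where p: "T = Route p" "p \<noteq> []" "tail G (hd p) \<in> sources G" by (auto elim: routes_rep)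
  have "\<not> matches T (length (rep T)) P" using P by (auto simp: matches_def p)
  moreover have "\<not> matches T 0 P"
  proof
    assume "matches T 0 P"
    then have "hd P = hd p" using P p by (auto simp: matches_def hd_conv_nth split: if_splits)
    then show False using v p by (simp add: internals_def)
  qed
  ultimately show ?thesis by simp
qed (simp add: matches_def bands_letter)

lemma occ_Cons:
  assumes T: "T \<in> trails G" and P: "P \<noteq> []" and v: "tail G (hd P) = v" "v \<in> internals G"
  shows "occ T P = (\<Sum>e\<in>in_arcs G v. occ T (e # P))"
proof -
  let ?S = "\<lambda>P. {c. c < length (rep T) \<and> matches T c P}"
  let ?h = "\<lambda>c. of_bool (matches T c P) :: nat"
  have card_eq: "card {c. c < n \<and> Q c} = (\<Sum>c<n. of_bool (Q c))" for n :: nat and Q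
    by (simp add: of_bool_def sum.If_cases Int_def lessThan_def)
  \<comment> \<open>Counting over one position more and splitting off either the last or the first
    of them replaces the starts \<open>c\<close> by \<open>Suc c\<close>.\<close>
  have "occ T P + ?h (length (rep T)) = (\<Sum>c<Suc (length (rep T)). ?h c)"
    by (simp add: occ_def card_eq)
  also have "\<dots> = ?h 0 + (\<Sum>c<length (rep T). ?h (Suc c))" by (rule sum.lessThan_Suc_shift)
  finally have "occ T P = card {c. c < length (rep T) \<and> matches T (Suc c) P}"
    using matches_period[OF T P] v by (simp add: card_eq)
  moreover have "\<exists>e\<in>in_arcs G v. matches T c (e # P)" if "matches T (Suc c) P" for c
  proof -
    have l: "letter T (Suc c) = Some (hd P)"
      using that P by (force simp: matches_def hd_conv_nth)
    then obtain e where e: "letter T c = Some e" using letter_prev[OF T l] by auto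
    then have "e \<in> in_arcs G v" using letter_Suc[OF T e l] v letter_arc[OF T e] by simp
    then show ?thesis using e that by (auto simp: matches_Cons)
  qed
  then have "{c. c < length (rep T) \<and> matches T (Suc c) P} = (\<Union>e\<in>in_arcs G v. ?S (e # P))"
    by (auto simp: matches_Cons)
  moreover have "card (\<Union>e\<in>in_arcs G v. ?S (e # P)) = (\<Sum>e\<in>in_arcs G v. card (?S (e # P)))"
    by (rule card_UN_disjoint) (auto simp: matches_Cons)
  ultimately show ?thesis unfolding occ_def by simp
qed

lemma subpath_iff_matches:
  assumes "T \<in> trails G" shows "subpath P T \<longleftrightarrow> (\<exists>c. matches T c P)"
  using assms
proof (cases rule: trails_cases)
  case 1
  then obtain p where p: "T = Route p" by (auto elim: routes_rep)
  show ?thesis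
  proof
    assume "subpath P T"
    then obtain ps ss where "p = ps @ P @ ss" by (auto simp: p sublist_def)
    then have "matches T (length ps) P" by (auto simp: p matches_def nth_append)
    then show "\<exists>c. matches T c P" ..
  next
    assume "\<exists>c. matches T c P"
    then obtain c where c: "matches T c P" ..
    show "subpath P T"
    proof (cases "P = []")
      case False
      then have "c + (length P - 1) < length p"
        using c by (auto simp: matches_def p split: if_splits)
      then have "c + length P \<le> length p" using False by (cases P) auto
      then have "take (length P) (drop c p) = P"
        using c by (intro nth_equalityI) (auto simp: matches_def p split: if_splits)
      then have "sublist P (drop c p)" by (metis sublist_take)
      then show ?thesis using sublist_drop[of c p] p by (auto intro: sublist_order.order_trans)
    qed (simp add: p)
  qed
next
  case 2
  let ?w = "rep T"
  note b = bands_rep[OF 2]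
  show ?thesis
  proof
    assume "subpath P T"
    then obtain m n where "sublist P (concat (replicate n (rotate m ?w)))"
      by (subst (asm) b(4)) auto
    then obtain ps ss where ps: "concat (replicate n (rotate m ?w)) = ps @ P @ ss"
      by (auto simp: sublist_def)
    have "P ! i = ?w ! ((m + length ps + i) mod length ?w)" if i: "i < length P" for i
    proof -
      have "length (ps @ P @ ss) = n * length ?w"
        by (metis ps length_concat_replicate length_rotate)
      then have "length ps + i < n * length ?w" using i by simp
      then have "concat (replicate n (rotate m ?w)) ! (length ps + i) = ?w ! ((m + length ps + i) mod length ?w)"
        using b(2) by (simp add: nth_concat_replicate nth_rotate mod_add_right_eq add.assoc)
      then show ?thesis using i by (simp add: ps nth_append)
    qed
    then have "matches T (m + length ps) P" by (simp add: matches_def bands_letter[OF 2])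
    then show "\<exists>c. matches T c P" ..
  next
    assume "\<exists>c. matches T c P"
    then obtain c where c: "matches T c P" ..
    \<comment> \<open>Each copy of the band has at least one arc, so this many copies reach at least
      position \<open>c + length P\<close>.\<close>
    let ?n = "c + length P"
    have len: "?n \<le> ?n * length ?w" using b(2) by (simp add: Suc_leI)
    have "take (length P) (drop c (concat (replicate ?n ?w))) = P"
    proof (rule nth_equalityI)
      show "length (take (length P) (drop c (concat (replicate ?n ?w)))) = length P"
        using len unfolding length_take length_drop length_concat_replicate by linarith
      fix i assume "i < length (take (length P) (drop c (concat (replicate ?n ?w))))"
      then have i: "i < length P" by simp
      then have ci: "c + i < ?n * length ?w" using len by linarith
      then have "take (length P) (drop c (concat (replicate ?n ?w))) ! i = concat (replicate ?n ?w) ! (c + i)"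
        using i ci by (subst nth_take, simp, subst nth_drop) (simp_all only: length_concat_replicate less_imp_le)
      also have "\<dots> = P ! i"
        using nth_concat_replicate[OF ci] c i by (simp add: matches_def bands_letter[OF 2])
      finally show "take (length P) (drop c (concat (replicate ?n ?w))) ! i = P ! i" .
    qed
    then have "sublist P (drop c (concat (replicate ?n ?w)))" by (metis sublist_take)
    then have "sublist P (concat (replicate ?n ?w))"
      using sublist_drop by (metis sublist_order.order_trans)
    moreover have "?w \<in> range (\<lambda>n. rotate n ?w)" by (rule range_eqI[of _ _ 0]) simp
    ultimately show "subpath P T"
      using subpath.simps(2)[of P "range (\<lambda>n. rotate n ?w)"] b(4) by metis
  qed
qed

end

section \<open>Uniqueness of coefficients\<close>

lemma linear_order_onD_total:
  "\<lbrakk>linear_order_on A r; x \<in> A; y \<in> A; x \<noteq> y\<rbrakk> \<Longrightarrow> (x, y) \<in> r \<or> (y, x) \<in> r"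
  by (auto simp: linear_order_on_def total_on_def)

text \<open>This is the northwest corner rule: either \<open>A \<times> (Y - B)\<close> or \<open>(X - A) \<times> B\<close>
  carries no mass.\<close>

lemma linear_order_noncrossing_sum:
  fixes M :: "'x \<Rightarrow> 'y \<Rightarrow> real"
  assumes fin: "finite X" "finite Y" and nn: "\<And>x y. x \<in> X \<Longrightarrow> y \<in> Y \<Longrightarrow> 0 \<le> M x y"
    and lin: "linear_order_on X r" "linear_order_on Y s"
    and nc: "\<And>x x' y y'. \<lbrakk>(x, x') \<in> r; x \<noteq> x'; (y, y') \<in> s; y \<noteq> y'\<rbrakk> \<Longrightarrow> M x y' = 0 \<or> M x' y = 0"
    and A: "A \<subseteq> X" "\<And>x x'. x \<in> A \<Longrightarrow> (x', x) \<in> r \<Longrightarrow> x' \<in> A"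
    and B: "B \<subseteq> Y" "\<And>y y'. y \<in> B \<Longrightarrow> (y', y) \<in> s \<Longrightarrow> y' \<in> B"
  shows "(\<Sum>x\<in>A. \<Sum>y\<in>B. M x y) = min (\<Sum>x\<in>A. \<Sum>y\<in>Y. M x y) (\<Sum>y\<in>B. \<Sum>x\<in>X. M x y)"
proof -
  have le1: "(\<Sum>x\<in>A. \<Sum>y\<in>B. M x y) \<le> (\<Sum>x\<in>A. \<Sum>y\<in>Y. M x y)"
    using A B nn fin by (intro sum_mono sum_mono2) auto
  have sw: "(\<Sum>x\<in>A. \<Sum>y\<in>B. M x y) = (\<Sum>y\<in>B. \<Sum>x\<in>A. M x y)" by (rule sum.swap)
  have le2: "(\<Sum>x\<in>A. \<Sum>y\<in>B. M x y) \<le> (\<Sum>y\<in>B. \<Sum>x\<in>X. M x y)"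
    unfolding sw using A B nn fin by (intro sum_mono sum_mono2) auto
  show ?thesis
  proof (cases "\<exists>x\<in>A. \<exists>y\<in>Y - B. M x y \<noteq> 0")
    case True
    then obtain x y' where xy: "x \<in> A" "y' \<in> Y - B" "M x y' \<noteq> 0" by blast
    \<comment> \<open>The entry at \<open>(x, y')\<close> excludes every entry with a larger row and
      a smaller column. As \<open>A\<close> and \<open>B\<close> are down-sets, this covers all of
      \<open>(X - A) \<times> B\<close>.\<close>
    have "M x' y = 0" if "x' \<in> X - A" "y \<in> B" for x' y
    proof -
      have "(x, x') \<in> r" "x \<noteq> x'"
        using linear_order_onD_total[OF lin(1), of x x'] xy(1) that(1) A by blast+
      moreover have "(y, y') \<in> s" "y \<noteq> y'"
        using linear_order_onD_total[OF lin(2), of y y'] xy(2) that(2) B by blast+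
      ultimately show ?thesis using nc xy(3) by blast
    qed
    then have "(\<Sum>y\<in>B. \<Sum>x\<in>X. M x y) = (\<Sum>y\<in>B. \<Sum>x\<in>A. M x y)"
      using A fin by (intro sum.cong sum.mono_neutral_right) auto
    then show ?thesis using le1 sw by simp
  next
    case False
    then have "(\<Sum>x\<in>A. \<Sum>y\<in>Y. M x y) = (\<Sum>x\<in>A. \<Sum>y\<in>B. M x y)"
      using B fin by (intro sum.cong sum.mono_neutral_right) auto
    then show ?thesis using le2 by simp
  qed
qed

text \<open>Sums over products of down-sets depend on the margins alone. A principal down-set
  without its top element is again a down-set, so a single entry is an alternating sum of four such
  corner sums.\<close>

lemma linear_order_noncrossing_unique:
  fixes M N :: "'x \<Rightarrow> 'y \<Rightarrow> real"
  assumes fin: "finite X" "finite Y"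
    and nnM: "\<And>x y. x \<in> X \<Longrightarrow> y \<in> Y \<Longrightarrow> 0 \<le> M x y"
    and nnN: "\<And>x y. x \<in> X \<Longrightarrow> y \<in> Y \<Longrightarrow> 0 \<le> N x y"
    and lin: "linear_order_on X r" "linear_order_on Y s"
    and ncM: "\<And>x x' y y'. \<lbrakk>(x, x') \<in> r; x \<noteq> x'; (y, y') \<in> s; y \<noteq> y'\<rbrakk> \<Longrightarrow> M x y' = 0 \<or> M x' y = 0"
    and ncN: "\<And>x x' y y'. \<lbrakk>(x, x') \<in> r; x \<noteq> x'; (y, y') \<in> s; y \<noteq> y'\<rbrakk> \<Longrightarrow> N x y' = 0 \<or> N x' y = 0"
    and row: "\<And>x. x \<in> X \<Longrightarrow> (\<Sum>y\<in>Y. M x y) = (\<Sum>y\<in>Y. N x y)"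
    and col: "\<And>y. y \<in> Y \<Longrightarrow> (\<Sum>x\<in>X. M x y) = (\<Sum>x\<in>X. N x y)"
    and xy: "x \<in> X" "y \<in> Y"
  shows "M x y = N x y"
proof -
  have r: "r \<subseteq> X \<times> X" "trans r" "antisym r" "refl_on X r"
    using lin(1) by (auto simp: order_on_defs refl_on_def)
  have s: "s \<subseteq> Y \<times> Y" "trans s" "antisym s" "refl_on Y s"
    using lin(2) by (auto simp: order_on_defs refl_on_def)
  define A where "A = {x'. (x', x) \<in> r}"
  define B where "B = {y'. (y', y) \<in> s}"
  have AX: "A \<subseteq> X" "x \<in> A" and BY: "B \<subseteq> Y" "y \<in> B"
    using r s xy by (auto simp: A_def B_def refl_on_def)
  have dA: "\<And>x x'. x \<in> A \<Longrightarrow> (x', x) \<in> r \<Longrightarrow> x' \<in> A"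
    using r(2) by (auto simp: A_def dest: transD)
  have dA': "\<And>u x'. u \<in> A - {x} \<Longrightarrow> (x', u) \<in> r \<Longrightarrow> x' \<in> A - {x}"
    using r(2,3) by (auto simp: A_def dest: transD antisymD)
  have dB: "\<And>x x'. x \<in> B \<Longrightarrow> (x', x) \<in> s \<Longrightarrow> x' \<in> B"
    using s(2) by (auto simp: B_def dest: transD)
  have dB': "\<And>u x'. u \<in> B - {y} \<Longrightarrow> (x', u) \<in> s \<Longrightarrow> x' \<in> B - {y}"
    using s(2,3) by (auto simp: B_def dest: transD antisymD)
  have eq: "(\<Sum>x\<in>A. \<Sum>y\<in>B. M x y) = (\<Sum>x\<in>A. \<Sum>y\<in>B. N x y)"
    if A: "A \<subseteq> X" "\<And>x x'. x \<in> A \<Longrightarrow> (x', x) \<in> r \<Longrightarrow> x' \<in> A"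
    and B: "B \<subseteq> Y" "\<And>y y'. y \<in> B \<Longrightarrow> (y', y) \<in> s \<Longrightarrow> y' \<in> B" for A B
  proof -
    have "(\<Sum>x\<in>A. \<Sum>y\<in>Y. M x y) = (\<Sum>x\<in>A. \<Sum>y\<in>Y. N x y)"
      by (intro sum.cong refl row) (use A(1) in auto)
    moreover have "(\<Sum>y\<in>B. \<Sum>x\<in>X. M x y) = (\<Sum>y\<in>B. \<Sum>x\<in>X. N x y)"
      by (intro sum.cong refl col) (use B(1) in auto)
    ultimately show ?thesis
      using linear_order_noncrossing_sum[of X Y M r s A B, OF fin nnM lin ncM A B]
        linear_order_noncrossing_sum[of X Y N r s A B, OF fin nnN lin ncN A B] by simp
  qed
  have split: "H x y = (\<Sum>x\<in>A. \<Sum>y\<in>B. H x y) - (\<Sum>x\<in>A - {x}. \<Sum>y\<in>B. H x y)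
    - ((\<Sum>x\<in>A. \<Sum>y\<in>B - {y}. H x y) - (\<Sum>x\<in>A - {x}. \<Sum>y\<in>B - {y}. H x y))" for H :: "'x \<Rightarrow> 'y \<Rightarrow> real"
  proof -
    have "finite A" "finite B" using AX BY fin finite_subset by auto
    then show ?thesis using sum.remove[of A x "\<lambda>x. \<Sum>y\<in>B. H x y"]
        sum.remove[of A x "\<lambda>x. \<Sum>y\<in>B - {y}. H x y"] sum.remove[of B y "\<lambda>y. H x y"] AX BY by simp
  qed
  have sub: "A - {x} \<subseteq> X" "B - {y} \<subseteq> Y" using AX BY by auto
  show ?thesis
    unfolding split[of M] split[of N]
    using eq[OF AX(1) dA BY(1) dB] eq[OF sub(1) dA' BY(1) dB] eq[OF AX(1) dA sub(2) dB']
      eq[OF sub(1) dA' sub(2) dB'] by simp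
qed

section \<open>Weights of arc lists in a combination of trails\<close>

context framed_digraph
begin

definition weight :: "'b trail set \<Rightarrow> ('b trail \<Rightarrow> real) \<Rightarrow> 'b list \<Rightarrow> real" where
  "weight K a P = (\<Sum>T\<in>K. a T * real (occ T P))"

lemma weight_single: "weight K a [e] = (\<Sum>T\<in>K. a T *\<^sub>R traversals T) $ e"
  by (simp add: weight_def traversals_nth sum_component)

lemma weight_snoc:
  assumes "K \<subseteq> trails G" "P \<noteq> []" "head G (last P) = v" "v \<in> internals G"
  shows "weight K a P = (\<Sum>f\<in>out_arcs G v. weight K a (P @ [f]))"
proof -
  have "weight K a P = (\<Sum>T\<in>K. \<Sum>f\<in>out_arcs G v. a T * real (occ T (P @ [f])))"
    unfolding weight_def using assms
    by (intro sum.cong refl) (subst occ_snoc, auto simp: sum_distrib_left)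
  then show ?thesis unfolding weight_def by (subst sum.swap)
qed

lemma weight_Cons:
  assumes "K \<subseteq> trails G" "P \<noteq> []" "tail G (hd P) = v" "v \<in> internals G"
  shows "weight K a P = (\<Sum>e\<in>in_arcs G v. weight K a (e # P))"
proof -
  have "weight K a P = (\<Sum>T\<in>K. \<Sum>e\<in>in_arcs G v. a T * real (occ T (e # P)))"
    unfolding weight_def using assms
    by (intro sum.cong refl) (subst occ_Cons, auto simp: sum_distrib_left)
  then show ?thesis unfolding weight_def by (subst sum.swap)
qed

lemma weight_nonneg: "(\<And>T. T \<in> K \<Longrightarrow> 0 \<le> a T) \<Longrightarrow> 0 \<le> weight K a P"
  unfolding weight_def by (intro sum_nonneg) simp

lemma weight_nonzeroD:
  assumes "weight K a P \<noteq> 0" shows "\<exists>T\<in>K. \<exists>c. matches T c P"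
proof -
  obtain T where "T \<in> K" "occ T P \<noteq> 0" using assms unfolding weight_def
    by (metis (mono_tags, lifting) sum.neutral mult_eq_0_iff of_nat_0)
  then show ?thesis using occ_posD by blast
qed

text \<open>Two nonzero weights come from trails of the bundle that contain the two lists. These may
  be one and the same trail, so the compatibility of each trail with itself enters here.\<close>

lemma weight_noncrossing:
  assumes K: "is_bundle G R K" and v: "v \<in> internals G" and w: "w \<in> internals G"
    and Q: "awalk v Q w"
    and e: "(e1, e2) \<in> in_ord R v" "e1 \<noteq> e2" and f: "(f1, f2) \<in> out_ord R w" "f1 \<noteq> f2"
  shows "weight K a (e1 # Q @ [f2]) = 0 \<or> weight K a (e2 # Q @ [f1]) = 0"
proof (rule ccontr)
  assume "\<not> ?thesis"
  then obtain T c T' c' where T: "T \<in> K" "matches T c (e1 # Q @ [f2])"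
    and T': "T' \<in> K" "matches T' c' (e2 # Q @ [f1])"
    using weight_nonzeroD by meson
  have "K \<subseteq> trails G" using K by (simp add: is_bundle_def)
  then have "subpath (e1 # Q @ [f2]) T" "subpath (e2 # Q @ [f1]) T'"
    using T T' subpath_iff_matches by blast+
  moreover have "incompatibility G R (e1 # Q @ [f2]) (e2 # Q @ [f1])"
    unfolding incompatibility_def using v w Q e f by blast
  ultimately have "incompatible G R T T'" unfolding incompatible_def by blast
  then show False using K T(1) T'(1) by (auto simp: is_bundle_def)
qed

lemma weight_unique:
  assumes K: "is_bundle G R K" "\<And>T. T \<in> K \<Longrightarrow> 0 \<le> a T"
    and L: "is_bundle G R L" "\<And>T. T \<in> L \<Longrightarrow> 0 \<le> b T"
    and single: "\<And>e. weight K a [e] = weight L b [e]"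
    and P: "P \<noteq> []"
  shows "weight K a P = weight L b P"
  using P
proof (induction P rule: length_induct)
  case (1 P)
  have KT: "K \<subseteq> trails G" and LT: "L \<subseteq> trails G" using K L by (auto simp: is_bundle_def)
  obtain e P' where P: "P = e # P'" using 1(2) by (cases P) auto
  show ?case
  proof (cases "P' = []")
    case True
    then show ?thesis using single P by simp
  next
    case False
    then obtain Q f where P': "P' = Q @ [f]" by (metis rev_exhaust)
    show ?thesis
    \<comment> \<open>Only a list that is read in some trail is known to be a walk; for every other
      list both weights are zero.\<close>
    proof (cases "\<exists>T\<in>K \<union> L. \<exists>c. matches T c P")
      case False
      then show ?thesis using weight_nonzeroD[of K a P] weight_nonzeroD[of L b P] by fastforce
    next
      case True
      then obtain T c where T: "T \<in> trails G" "matches T c P" using KT LT by blast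
      note walk = matches_walk[OF T]
      define v where "v = head G e"
      define w where "w = tail G f"
      have e: "e \<in> in_arcs G v" and f: "f \<in> out_arcs G w" using walk(1) P P' by (auto simp: v_def w_def)
      have hdP': "tail G (hd P') = v" using walk(2)[of 0] P False by (simp add: v_def hd_conv_nth)
      have lastQ: "head G (last (e # Q)) = w"
        using walk(2)[of "length Q"] unfolding P P' w_def
        by (auto simp: nth_append last_conv_nth nth_Cons' split: if_splits)
      have arcs: "set P' \<subseteq> arcs G" using walk(1) P by auto
      then have "hd P' \<in> out_arcs G v" using hdP' hd_in_set[OF False] by auto
      moreover have v: "v \<in> verts G" using e by (auto simp: v_def)
      ultimately have vi: "v \<in> internals G" using e by (auto simp: internals_iff)
      have "last (e # Q) \<in> in_arcs G w" using lastQ walk(1) P P' by (auto split: if_splits)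
      moreover have "w \<in> verts G" using f by (auto simp: w_def)
      ultimately have wi: "w \<in> internals G" using f by (auto simp: internals_iff)
      have Q: "awalk v Q w"
      proof (cases "Q = []")
        case True
        then show ?thesis using lastQ v by (simp add: v_def awalk_Nil_iff)
      next
        case False
        have "head G (Q ! i) = tail G (Q ! Suc i)" if "Suc i < length Q" for i
          using walk(2)[of "Suc i"] that unfolding P P' by (simp add: nth_append)
        then show ?thesis using False lastQ hdP' arcs by (simp add: awalk_iff_nth P')
      qed
      let ?M = "\<lambda>e f. weight K a (e # Q @ [f])" and ?N = "\<lambda>e f. weight L b (e # Q @ [f])"
      have lin: "linear_order_on (in_arcs G v) (in_ord R v)" "linear_order_on (out_arcs G w) (out_ord R w)"
        using framing vi wi by (auto simp: is_framing_def)
      \<comment> \<open>The margins are the weights of \<open>e' # Q\<close> and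
        \<open>Q @ [f']\<close>. Both lists are one arc shorter than \<open>P\<close>, so the
        induction hypothesis applies.\<close>
      have "?M e f = ?N e f"
      proof (rule linear_order_noncrossing_unique[OF _ _ _ _ lin, of ?M ?N])
        fix e' assume e': "e' \<in> in_arcs G v"
        have last: "head G (last (e' # Q)) = w"
          using lastQ e' v_def by (auto split: if_splits)
        have "weight K a (e' # Q) = weight L b (e' # Q)" using 1(1) P P' by simp
        then show "(\<Sum>f\<in>out_arcs G w. ?M e' f) = (\<Sum>f\<in>out_arcs G w. ?N e' f)"
          using weight_snoc[OF KT _ last wi, of a] weight_snoc[OF LT _ last wi, of b] by simp
      next
        fix f' assume f': "f' \<in> out_arcs G w"
        have hd: "tail G (hd (Q @ [f'])) = v"
          using hdP' f' unfolding P' w_def by (cases Q) auto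
        have "weight K a (Q @ [f']) = weight L b (Q @ [f'])" using 1(1) P P' by simp
        then show "(\<Sum>e\<in>in_arcs G v. ?M e f') = (\<Sum>e\<in>in_arcs G v. ?N e f')"
          using weight_Cons[OF KT _ hd vi, of a] weight_Cons[OF LT _ hd vi, of b] by simp
      qed (use weight_noncrossing[OF K(1) vi wi Q] weight_noncrossing[OF L(1) vi wi Q] e f in
          \<open>auto intro!: weight_nonneg K L\<close>)
      then show ?thesis by (simp add: P P')
    qed
  qed
qed

definition source_arcs :: "'b set" where
  "source_arcs = {e \<in> arcs G. tail G e \<in> sources G}"

text \<open>No arc ends at a source, so an arc leaving one has no predecessor in a trail, whereas in
  a band every position, read modulo the period, has one.\<close>

lemma source_letter:
  assumes T: "T \<in> trails G" and l: "letter T c = Some e" and e: "e \<in> source_arcs"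
  shows "T \<in> routes G" "c = 0"
proof -
  have no_prev: False if l': "letter T (Suc d) = Some e" for d
  proof -
    obtain e' where e': "letter T d = Some e'" using letter_prev[OF T l'] by blast
    then show False
      using letter_Suc[OF T e' l'] sources_not_head[OF letter_arc[OF T e']] e by (simp add: source_arcs_def)
  qed
  then show "c = 0" using l by (cases c) auto
  then have l0: "letter T 0 = Some e" using l by simp
  have "T \<notin> bands G"
  proof
    assume b: "T \<in> bands G"
    have "length (rep T) \<noteq> 0" using rep_nonempty[OF T] by simp
    then obtain d where "length (rep T) = Suc d" by (meson not0_implies_Suc)
    then have "letter T (Suc d) = Some e" using l0 by (simp add: bands_letter[OF b])
    then show False by (rule no_prev)
  qed
  then show "T \<in> routes G" using T by (simp add: trails_def)
qed

text \<open>The arc list of a route fits into a trail only as a whole: its first arc leaves a source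
  and so sits at position 0 of a route, and its last arc ends at a sink, where no trail
  continues.\<close>

lemma occ_route:
  assumes T: "T \<in> trails G" and p: "Route p \<in> routes G"
  shows "occ T p = (if T = Route p then 1 else 0)"
proof -
  from p obtain pp: "p \<noteq> []" "set p \<subseteq> arcs G" "tail G (hd p) \<in> sources G" "head G (last p) \<in> sinks G"
    by (auto elim: routes_rep)
  have c0: "T = Route p \<and> c = 0" if c: "matches T c p" for c
  proof -
    have l: "letter T c = Some (hd p)" using c pp(1) by (auto simp: matches_def hd_conv_nth)
    have "hd p \<in> source_arcs" using pp hd_in_set[OF pp(1)] by (auto simp: source_arcs_def)
    note start = source_letter[OF T l this]
    from start(1) obtain q where q: "T = Route q" "q \<noteq> []" by (auto elim: routes_rep)
    have "length p - 1 < length q" using c pp(1) start(2) by (auto simp: matches_def q split: if_splits)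
    then have le: "length p \<le> length q" by simp
    have "length p = length q"
    proof (rule ccontr)
      assume "length p \<noteq> length q"
      then have lt: "length p < length q" using le by simp
      have l1: "letter T (length p - 1) = Some (last p)"
        using c pp(1) start(2) by (simp add: matches_def last_conv_nth)
      have l2: "letter T (Suc (length p - 1)) = Some (q ! length p)" using lt pp(1) by (simp add: q)
      have "head G (last p) = tail G (q ! length p)" using letter_Suc[OF T l1 l2] .
      then show False using sinks_not_tail[OF letter_arc[OF T l2]] pp(4) by simp
    qed
    then have "q = p" using c start(2) by (intro nth_equalityI) (auto simp: matches_def q)
    then show ?thesis using start(2) by (simp add: q)
  qed
  show ?thesis
  proof (cases "T = Route p")
    case True
    then have "occ T p = 1" using pp(1) c0 by (intro occ_eq_1I[of _ _ 0]) (auto simp: matches_def)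
    then show ?thesis using True by simp
  next
    case False
    then show ?thesis using occ_posD[of T p] c0 by auto
  qed
qed

text \<open>A window whose length is at least the product of the two periods determines both periodic words.
  Then the gcd of the periods is a common period, and primitivity makes the words rotations of
  each other.\<close>

lemma occ_band_power:
  assumes T: "T \<in> trails G" and T0: "T0 \<in> bands G" and n: "n > length (rep T)"
  shows "occ T (concat (replicate n (rep T0))) = (if T = T0 then 1 else 0)"
proof -
  define w where "w = rep T0"
  define k where "k = length w"
  define P where "P = concat (replicate n w)"
  note b0 = bands_rep[OF T0, folded w_def]
  have k: "k > 0" using b0(2) by (simp add: k_def)
  have lenP: "length P = n * k" by (simp add: P_def k_def length_concat_replicate)
  have nthP: "i < n * k \<Longrightarrow> P ! i = w ! (i mod k)" for i by (simp add: P_def k_def nth_concat_replicate)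
  have key: "T = T0 \<and> c = 0" if c: "c < length (rep T)" "matches T c P" for c
    using T
  proof (cases rule: trails_cases)
    case 1
    then obtain q where q: "T = Route q" by (auto elim: routes_rep)
    \<comment> \<open>A route is too short for the window: its length is below \<open>n\<close>,
      that of the window is \<open>n * k\<close>.\<close>
    have "n * k - 1 < length P" using k n by (simp add: lenP)
    then have "c + (n * k - 1) < length q" using c(2) by (auto simp: matches_def q split: if_splits)
    moreover have "n \<le> n * k" using k by simp
    ultimately have False using n k unfolding q rep.simps by linarith
    then show ?thesis ..
  next
    case 2
    define u where "u = rep T"
    define m where "m = length u"
    note b = bands_rep[OF 2, folded u_def]
    have m: "m > 0" using b(2) by (simp add: m_def)
    have eq0: "u ! ((c + i) mod m) = w ! (i mod k)" if "i < n * k" for i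
      using c(2) that nthP[OF that] by (simp add: matches_def lenP bands_letter[OF 2] u_def[symmetric] m_def[symmetric])
    \<comment> \<open>As \<open>n\<close> exceeds the period \<open>m\<close> of \<open>T\<close>,
      the window contains a full common period \<open>m * k\<close>, which extends the equation to
      all positions.\<close>
    have "m * k \<le> n * k" using n by (simp add: m_def u_def)
    have eq: "u ! ((c + i) mod m) = w ! (i mod k)" for i
    proof -
      have "i mod (m * k) < n * k"
        using m k \<open>m * k \<le> n * k\<close> by (metis less_le_trans mod_less_divisor nat_0_less_mult_iff)
      from eq0[OF this] have "u ! ((c + i mod (m * k)) mod m) = w ! (i mod k)"
        by (simp add: mod_mod_cancel)
      moreover have "(c + i mod (m * k)) mod m = (c + i) mod m"
        by (metis dvd_triv_left mod_add_right_eq mod_mod_cancel)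
      ultimately show ?thesis by simp
    qed
    have wm: "w ! ((i + m) mod k) = w ! (i mod k)" for i
      using eq[of "i + m"] eq[of i] by (simp add: add.assoc[symmetric])
    have uk: "u ! ((j + k) mod m) = u ! (j mod m)" for j
    proof -
      \<comment> \<open>\<open>c * (m - 1)\<close> stands for \<open>-c\<close> modulo
        \<open>m\<close>, so that \<open>c + i\<close> is congruent to \<open>j\<close>.\<close>
      define i where "i = j + c * (m - 1)"
      have ci: "c + i = j + c * m" using m by (cases m) (simp_all add: i_def)
      have "u ! ((j + k) mod m) = u ! ((c + (i + k)) mod m)"
        using ci by (metis add.assoc add.commute mod_mult_self1)
      also have "\<dots> = u ! ((c + i) mod m)" unfolding eq by simp
      also have "\<dots> = u ! (j mod m)" by (simp add: ci)
      finally show ?thesis .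
    qed
    have "w ! ((i + gcd m k) mod k) = w ! (i mod k)" for i
      by (rule period_gcd[of "\<lambda>i. w ! (i mod k)"]) (use wm m in auto)
    then have "gcd m k \<ge> k"
      using primitive_no_proper_period[OF b0(3), of "gcd m k"] k unfolding k_def by auto
    moreover have "u ! ((i + gcd m k) mod m) = u ! (i mod m)" for i
      by (rule period_gcd[of "\<lambda>i. u ! (i mod m)"]) (use uk m in auto)
    then have "gcd m k \<ge> m"
      using primitive_no_proper_period[OF b(3), of "gcd m k"] m unfolding m_def by auto
    ultimately have mk: "m = k" using m k
      by (metis gcd_le1_nat gcd_le2_nat le_antisym less_irrefl_nat)
    have "w = rotate c u"
      using eq mk by (intro nth_equalityI) (auto simp: k_def[symmetric] m_def[symmetric] nth_rotate)
    then have "T = T0" using b(4) b0(4) range_rotate_rotate by metis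
    \<comment> \<open>The word is now invariant under rotation by \<open>c\<close>; a nonzero
      \<open>c\<close> below its length would give the proper period \<open>gcd c k\<close>.\<close>
    moreover have "c = 0"
    proof (rule ccontr)
      assume "c \<noteq> 0"
      have "u = w" using \<open>T = T0\<close> by (simp add: u_def w_def)
      have "w ! ((i + gcd c k) mod k) = w ! (i mod k)" for i
        by (rule period_gcd[of "\<lambda>i. w ! (i mod k)"])
          (use eq \<open>c \<noteq> 0\<close> \<open>u = w\<close> mk in \<open>auto simp: add.commute\<close>)
      then have "gcd c k \<ge> k"
        using primitive_no_proper_period[OF b0(3), of "gcd c k"] \<open>c \<noteq> 0\<close> unfolding k_def by auto
      moreover have "gcd c k \<le> c" using \<open>c \<noteq> 0\<close> by (simp add: gcd_le1_nat)
      ultimately show False using c(1) mk by (simp add: m_def u_def)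
    qed
    ultimately show ?thesis ..
  qed
  show ?thesis unfolding w_def[symmetric] P_def[symmetric]
  proof (cases "T = T0")
    case True
    have "matches T0 0 P" by (simp add: matches_def lenP nthP bands_letter[OF T0] w_def[symmetric] k_def[symmetric])
    then have "occ T P = 1" using True key k by (intro occ_eq_1I[of _ _ 0]) (auto simp: k_def w_def)
    then show "occ T P = (if T = T0 then 1 else 0)" using True by simp
  next
    case False
    then show "occ T P = (if T = T0 then 1 else 0)" using occ_posD[of T P] key by auto
  qed
qed

text \<open>Extension by zero compares two different bundles: a trail that belongs to only one of
  them has coefficient zero. Independence, intersections and faces all rest on this form.\<close>

proposition bundle_coefficients_unique:
  assumes fin: "finite K" "finite L"
    and K: "is_bundle G R K" "\<And>T. T \<in> K \<Longrightarrow> 0 \<le> a T"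
    and L: "is_bundle G R L" "\<And>T. T \<in> L \<Longrightarrow> 0 \<le> b T"
    and eq: "(\<Sum>T\<in>K. a T *\<^sub>R traversals T) = (\<Sum>T\<in>L. b T *\<^sub>R traversals T)"
  shows "(if T \<in> K then a T else 0) = (if T \<in> L then b T else 0)"
proof (cases "T \<in> trails G")
  case False
  then show ?thesis using K L by (auto simp: is_bundle_def)
next
  case T: True
  have KT: "K \<subseteq> trails G" and LT: "L \<subseteq> trails G" using K L by (auto simp: is_bundle_def)
  have "\<exists>P. P \<noteq> [] \<and> (\<forall>T'\<in>K \<union> L. occ T' P = (if T' = T then 1 else 0))"
    using T
  proof (cases rule: trails_cases)
    case 1
    then obtain p where "T = Route p" "p \<noteq> []" by (auto elim: routes_rep)
    then show ?thesis using occ_route 1 KT LT by (intro exI[of _ p]) blast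
  next
    case 2
    \<comment> \<open>One exponent that exceeds the length of every trail of both bundles, as
      \<open>occ_band_power\<close> requires.\<close>
    define n where "n = Suc (\<Sum>T\<in>K \<union> L. length (rep T))"
    have "n > length (rep T')" if "T' \<in> K \<union> L" for T'
      using member_le_sum[OF that, of "\<lambda>T. length (rep T)"] fin by (simp add: n_def)
    then have "\<forall>T'\<in>K \<union> L. occ T' (concat (replicate n (rep T))) = (if T' = T then 1 else 0)"
      using occ_band_power[OF _ 2] KT LT by blast
    moreover have "concat (replicate n (rep T)) \<noteq> []"
      using rep_nonempty[OF T] by (simp add: n_def)
    ultimately show ?thesis by blast
  qed
  then obtain P where P: "P \<noteq> []" "\<forall>T'\<in>K \<union> L. occ T' P = (if T' = T then 1 else 0)" by blast
  have pick: "weight S c P = (if T \<in> S then c T else 0)" if "S \<subseteq> K \<union> L" for S c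
  proof -
    have "finite S" using that fin finite_subset by blast
    have "weight S c P = (\<Sum>T'\<in>S. if T' = T then c T' else 0)"
      unfolding weight_def using P(2) that by (intro sum.cong) auto
    then show ?thesis using \<open>finite S\<close> by simp
  qed
  have "weight K a P = weight L b P"
    by (rule weight_unique[OF K L _ P(1)]) (simp_all add: weight_single eq)
  then show ?thesis using pick by simp
qed

section \<open>Linear independence, finiteness and maximal bundles\<close>

lemma is_bundle_subset: "\<lbrakk>is_bundle G R K; L \<subseteq> K\<rbrakk> \<Longrightarrow> is_bundle G R L"
  by (auto simp: is_bundle_def)

text \<open>Uniqueness concerns nonnegative coefficients. Adding the constant \<open>?N\<close> to
  all of them turns a linear relation into two nonnegative combinations with the same value.\<close>

lemma bundle_traversals_independent:
  assumes K: "is_bundle G R K" "finite K" and eq: "(\<Sum>T\<in>K. c T *\<^sub>R traversals T) = 0" and T: "T \<in> K"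
  shows "c T = 0"
proof -
  let ?N = "\<Sum>T\<in>K. \<bar>c T\<bar>"
  have "0 \<le> ?N + c T" if "T \<in> K" for T
    using member_le_sum[OF that, of "\<lambda>T. \<bar>c T\<bar>"] K(2) by (simp add: abs_le_iff)
  moreover have "0 \<le> ?N" by (simp add: sum_nonneg)
  moreover have "(\<Sum>T\<in>K. (?N + c T) *\<^sub>R traversals T) = (\<Sum>T\<in>K. ?N *\<^sub>R traversals T)"
    using eq by (simp add: scaleR_add_left sum.distrib)
  ultimately have "?N + c T = ?N"
    using bundle_coefficients_unique[OF K(2,2,1) _ K(1), of "\<lambda>T. ?N + c T" "\<lambda>_. ?N" T] T by simp
  then show ?thesis by simp
qed

lemma bundle_traversals_pair:
  assumes K: "is_bundle G R K" and ST: "S \<in> K" "T \<in> K" "S \<noteq> T"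
    and eq: "c *\<^sub>R traversals S + d *\<^sub>R traversals T = 0"
  shows "c = 0"
  using bundle_traversals_independent[OF is_bundle_subset[OF K, of "{S, T}"], of "\<lambda>U. if U = S then c else d" S]
    ST eq by simp

lemma bundle_traversals_inj:
  assumes K: "is_bundle G R K" shows "inj_on traversals K"
proof (rule inj_onI, rule ccontr)
  fix S T assume "S \<in> K" "T \<in> K" "traversals S = traversals T" "S \<noteq> T"
  then show False using bundle_traversals_pair[OF K, of S T 1 "-1"] by simp
qed

lemma bundle_card_le:
  assumes K: "is_bundle G R K" "finite K"
  shows "card K \<le> CARD('b)"
proof -
  note inj = bundle_traversals_inj[OF K(1)]
  have "independent (traversals ` K)"
  proof -
    have "\<forall>v\<in>traversals ` K. u v = 0" if "(\<Sum>v\<in>traversals ` K. u v *\<^sub>R v) = 0" for u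
    proof -
      have "(\<Sum>T\<in>K. u (traversals T) *\<^sub>R traversals T) = 0"
        using that by (simp add: sum.reindex[OF inj])
      then show ?thesis
        using bundle_traversals_independent[OF K, of "\<lambda>T. u (traversals T)"] by blast
    qed
    then show ?thesis unfolding dependent_finite[OF finite_imageI[OF K(2)]] by blast
  qed
  then have "card (traversals ` K) \<le> DIM(real ^ 'b)" using independent_bound by blast
  then show ?thesis by (simp add: card_image[OF inj])
qed

lemma bundle_finite:
  assumes "is_bundle G R K" shows "finite K"
proof (rule ccontr)
  assume "infinite K"
  then obtain L where L: "L \<subseteq> K" "finite L" "card L = Suc (CARD('b))"
    using infinite_arbitrarily_large by blast
  then show False using bundle_card_le[OF is_bundle_subset[OF assms L(1)] L(2)] by simp
qed

text \<open>The dimension bounds the size of all bundles, so among those containing \<open>K\<close>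
  there is one of greatest cardinality.\<close>

lemma bundle_extends_to_maximal:
  assumes "is_bundle G R K" shows "\<exists>L. maximal_bundle G R L \<and> K \<subseteq> L"
proof -
  let ?S = "\<lambda>L. is_bundle G R L \<and> K \<subseteq> L"
  obtain L where L: "?S L" "\<And>L'. ?S L' \<Longrightarrow> card L' \<le> card L"
    using ex_has_greatest_nat[of ?S K card "Suc (CARD('b))"] assms bundle_card_le bundle_finite le_imp_less_Suc
    by blast
  have "L' = L" if "is_bundle G R L'" "L \<subseteq> L'" for L'
    using L that card_seteq[OF bundle_finite[OF that(1)] that(2)] by auto
  then show ?thesis using L(1) unfolding maximal_bundle_def by blast
qed

end

section \<open>Decomposition of integer flows\<close>

lemma finite_strict_order_rank:
  assumes fin: "finite A"
    and A: "\<And>x. x \<in> A \<Longrightarrow> \<not> lt x x"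
      "\<And>x y z. \<lbrakk>x \<in> A; y \<in> A; z \<in> A; lt x y; lt y z\<rbrakk> \<Longrightarrow> lt x z"
      "\<And>x y. \<lbrakk>x \<in> A; y \<in> A; x \<noteq> y\<rbrakk> \<Longrightarrow> lt x y \<or> lt y x"
  shows "\<exists>r. bij_betw r A {..<card A} \<and> (\<forall>x\<in>A. \<forall>y\<in>A. lt x y \<longleftrightarrow> r x < r y)"
proof -
  define r where "r x = card {y \<in> A. lt y x}" for x
  have mono: "r x < r y" if "x \<in> A" "y \<in> A" "lt x y" for x y
    unfolding r_def
  proof (rule psubset_card_mono)
    show "{z \<in> A. lt z x} \<subset> {z \<in> A. lt z y}" using that A(1)[OF that(1)] A(2)[OF _ that(1,2) _ that(3)] by blast
  qed (use fin in simp)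
  have inj: "inj_on r A" by (rule inj_onI) (metis A(3) mono less_irrefl)
  have "r x < card A" if "x \<in> A" for x
    unfolding r_def using A(1)[OF that] that fin by (intro psubset_card_mono) auto
  then have im: "r ` A = {..<card A}"
    by (intro card_subset_eq) (auto simp: card_image[OF inj])
  have "lt x y \<longleftrightarrow> r x < r y" if "x \<in> A" "y \<in> A" for x y
    using mono[OF that] mono[OF that(2,1)] A(3)[OF that] by fastforce
  then show ?thesis using inj im by (auto simp: bij_betw_def)
qed

lemma finite_strict_order_iso:
  assumes fin: "finite A" "finite B" "card A = card B"
    and A: "\<And>x. x \<in> A \<Longrightarrow> \<not> lt x x"
      "\<And>x y z. \<lbrakk>x \<in> A; y \<in> A; z \<in> A; lt x y; lt y z\<rbrakk> \<Longrightarrow> lt x z"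
      "\<And>x y. \<lbrakk>x \<in> A; y \<in> A; x \<noteq> y\<rbrakk> \<Longrightarrow> lt x y \<or> lt y x"
    and B: "\<And>x. x \<in> B \<Longrightarrow> \<not> lt' x x"
      "\<And>x y z. \<lbrakk>x \<in> B; y \<in> B; z \<in> B; lt' x y; lt' y z\<rbrakk> \<Longrightarrow> lt' x z"
      "\<And>x y. \<lbrakk>x \<in> B; y \<in> B; x \<noteq> y\<rbrakk> \<Longrightarrow> lt' x y \<or> lt' y x"
  shows "\<exists>f. bij_betw f A B \<and> (\<forall>x\<in>A. \<forall>y\<in>A. lt x y \<longrightarrow> lt' (f x) (f y))"
proof -
  have "\<exists>r. bij_betw r A {..<card A} \<and> (\<forall>x\<in>A. \<forall>y\<in>A. lt x y \<longleftrightarrow> r x < r y)"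
    by (rule finite_strict_order_rank[OF fin(1)]) (erule A(1), erule (4) A(2), erule (2) A(3))
  then obtain r where r: "bij_betw r A {..<card A}" "\<forall>x\<in>A. \<forall>y\<in>A. lt x y \<longleftrightarrow> r x < r y"
    by blast
  have "\<exists>r. bij_betw r B {..<card B} \<and> (\<forall>x\<in>B. \<forall>y\<in>B. lt' x y \<longleftrightarrow> r x < r y)"
    by (rule finite_strict_order_rank[OF fin(2)]) (erule B(1), erule (4) B(2), erule (2) B(3))
  then obtain r' where r': "bij_betw r' B {..<card B}" "\<forall>x\<in>B. \<forall>y\<in>B. lt' x y \<longleftrightarrow> r' x < r' y"
    by blast
  define f where "f = inv_into B r' \<circ> r"
  have b: "bij_betw r A {..<card B}" using r(1) fin(3) by simp
  have bij: "bij_betw f A B"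
    unfolding f_def by (rule bij_betw_trans[OF b bij_betw_inv_into[OF r'(1)]])
  have rf: "r' (f x) = r x" if "x \<in> A" for x
  proof -
    have "r x \<in> r' ` B" using that b r'(1) by (auto simp: bij_betw_def)
    then show ?thesis by (simp add: f_def f_inv_into_f)
  qed
  have "lt' (f x) (f y)" if xy: "x \<in> A" "y \<in> A" "lt x y" for x y
    using r(2) r'(2) xy rf bij_betwE[OF bij] by simp
  then show ?thesis using bij by blast
qed

section \<open>Orbits of a partial bijection\<close>

definition chain :: "'s set \<Rightarrow> ('s \<Rightarrow> 's) \<Rightarrow> 's list \<Rightarrow> bool" where
  "chain D \<sigma> xs \<longleftrightarrow> (\<forall>i. Suc i < length xs \<longrightarrow> xs ! i \<in> D \<and> \<sigma> (xs ! i) = xs ! Suc i)"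

text \<open>These are the two shapes of a complete orbit of a bijection from \<open>D\<close> onto
  \<open>C\<close>: a path from a point without preimage to a point without image, or a
  cycle.\<close>

definition open_or_cyclic :: "'s set \<Rightarrow> 's set \<Rightarrow> ('s \<Rightarrow> 's) \<Rightarrow> 's list \<Rightarrow> bool" where
  "open_or_cyclic D C \<sigma> xs \<longleftrightarrow>
    (hd xs \<notin> C \<and> last xs \<notin> D) \<or> (last xs \<in> D \<and> \<sigma> (last xs) = hd xs)"

lemma chain_snoc:
  assumes "chain D \<sigma> xs" "last xs \<in> D" shows "chain D \<sigma> (xs @ [\<sigma> (last xs)])"
  unfolding chain_def
proof (intro allI impI)
  fix i assume i: "Suc i < length (xs @ [\<sigma> (last xs)])"
  show "(xs @ [\<sigma> (last xs)]) ! i \<in> D \<and> \<sigma> ((xs @ [\<sigma> (last xs)]) ! i) = (xs @ [\<sigma> (last xs)]) ! Suc i"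
  proof (cases "Suc i < length xs")
    case True
    then show ?thesis using assms(1) by (simp add: chain_def nth_append)
  next
    case False
    then have len: "length xs = Suc i" using i by simp
    then have "xs ! i = last xs" by (metis diff_Suc_1 last_conv_nth list.size(3) nat.distinct(1))
    then show ?thesis using len assms(2) by (simp add: nth_append)
  qed
qed

text \<open>A longest chain, started outside \<open>C\<close> whenever possible, is a complete
  orbit. It stops outside \<open>D\<close> or at a point whose image already occurs in it, and by
  injectivity that image is the start.\<close>

lemma ex_orbit:
  assumes S: "finite S" "D \<subseteq> S" "C \<subseteq> S" and bij: "bij_betw \<sigma> D C" and ne: "S \<noteq> {}"
  shows "\<exists>xs. xs \<noteq> [] \<and> distinct xs \<and> set xs \<subseteq> S \<and> chain D \<sigma> xs \<and> open_or_cyclic D C \<sigma> xs"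
proof -
  have inj: "inj_on \<sigma> D" and im: "\<sigma> ` D = C" using bij by (auto simp: bij_betw_def)
  obtain x0 where x0: "x0 \<in> S" "C = S \<or> x0 \<notin> C" using ne S(3) by blast
  let ?Q = "\<lambda>xs. xs \<noteq> [] \<and> distinct xs \<and> set xs \<subseteq> S \<and> chain D \<sigma> xs \<and> hd xs = x0"
  have "?Q [x0]" using x0 by (simp add: chain_def)
  moreover have "length xs < Suc (card S)" if "?Q xs" for xs
    using that S(1) card_mono distinct_card by (metis le_imp_less_Suc)
  ultimately obtain xs where xs: "?Q xs" and max: "\<And>ys. ?Q ys \<Longrightarrow> length ys \<le> length xs"
    using ex_has_greatest_nat[of ?Q "[x0]" length "Suc (card S)"] by blast
  have "open_or_cyclic D C \<sigma> xs"
  proof (cases "last xs \<in> D")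
    case False
    \<comment> \<open>If every point had a preimage, counting would give \<open>D = S\<close> and
      the chain could not stop outside \<open>D\<close>. Hence its start was chosen outside
      \<open>C\<close>.\<close>
    have "C \<noteq> S"
    proof
      assume "C = S"
      then have "card D = card S" using bij_betw_same_card[OF bij] by simp
      then have "D = S" using S by (simp add: card_subset_eq)
      moreover have "last xs \<in> S" using xs last_in_set by blast
      ultimately show False using False by simp
    qed
    then show ?thesis using False x0 xs by (auto simp: open_or_cyclic_def)
  next
    case True
    have inS: "\<sigma> (last xs) \<in> S" using True im S(3) by blast
    have "\<sigma> (last xs) \<in> set xs"
    proof (rule ccontr)
      assume "\<sigma> (last xs) \<notin> set xs"
      then have "?Q (xs @ [\<sigma> (last xs)])"
        using xs True inS chain_snoc[of D \<sigma> xs] by simp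
      from max[OF this] show False by simp
    qed
    then obtain j where j: "j < length xs" "\<sigma> (last xs) = xs ! j" by (metis in_set_conv_nth)
    have "j = 0"
    proof (rule ccontr)
      assume "j \<noteq> 0"
      then obtain i where i: "j = Suc i" by (cases j) auto
      then have "xs ! i \<in> D" "\<sigma> (xs ! i) = \<sigma> (last xs)" using xs j by (auto simp: chain_def)
      then have "xs ! i = xs ! (length xs - 1)" using inj True xs by (auto simp: inj_on_def last_conv_nth)
      then show False using xs i j nth_eq_iff_index_eq[of xs i "length xs - 1"] by simp
    qed
    then show ?thesis using True j(2) xs hd_conv_nth[of xs] unfolding open_or_cyclic_def by metis
  qed
  then show ?thesis using xs by blast
qed

text \<open>This makes an orbit removable: outside its set \<open>X\<close> of points,
  \<open>\<sigma>\<close> is still a bijection from \<open>D - X\<close> onto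
  \<open>C - X\<close>.\<close>

lemma orbit_closed:
  assumes bij: "bij_betw \<sigma> D C" and xs: "xs \<noteq> []" "chain D \<sigma> xs" "open_or_cyclic D C \<sigma> xs"
    and x: "x \<in> D"
  shows "\<sigma> x \<in> set xs \<longleftrightarrow> x \<in> set xs"
proof
  have inj: "inj_on \<sigma> D" and im: "\<sigma> ` D = C" using bij by (auto simp: bij_betw_def)
  {
    assume "x \<in> set xs"
    then obtain i where i: "i < length xs" "x = xs ! i" by (metis in_set_conv_nth)
    show "\<sigma> x \<in> set xs"
    proof (cases "Suc i < length xs")
      case True
      then show ?thesis using xs(2) i by (auto simp: chain_def)
    next
      case False
      then have "i = length xs - 1" using i by simp
      then have "x = last xs" using i xs(1) by (simp add: last_conv_nth)
      then show ?thesis using xs(1,3) x by (auto simp: open_or_cyclic_def)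
    qed
  next
    assume "\<sigma> x \<in> set xs"
    then obtain j where j: "j < length xs" "\<sigma> x = xs ! j" by (metis in_set_conv_nth)
    show "x \<in> set xs"
    proof (cases j)
      case 0
      then have "\<sigma> x = hd xs" using j xs(1) by (simp add: hd_conv_nth)
      moreover have "\<sigma> x \<in> C" using x im by blast
      ultimately have "last xs \<in> D" "\<sigma> (last xs) = \<sigma> x" using xs(3) by (auto simp: open_or_cyclic_def)
      then have "x = last xs" using inj x by (auto simp: inj_on_def)
      then show ?thesis using xs(1) by simp
    next
      case (Suc i)
      then have "xs ! i \<in> D" "\<sigma> (xs ! i) = \<sigma> x" using xs(2) j by (auto simp: chain_def)
      then have "x = xs ! i" using inj x by (auto simp: inj_on_def)
      then show ?thesis using j Suc by simp
    qed
  }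
qed

lemma orbit_decomposition:
  assumes "finite S" "D \<subseteq> S" "C \<subseteq> S" "bij_betw \<sigma> D C"
  shows "\<exists>\<L>. finite \<L> \<and> \<Union>(set ` \<L>) = S \<and> (\<forall>xs\<in>\<L>. \<forall>ys\<in>\<L>. xs \<noteq> ys \<longrightarrow> set xs \<inter> set ys = {}) \<and>
    (\<forall>xs\<in>\<L>. xs \<noteq> [] \<and> distinct xs \<and> chain D \<sigma> xs \<and> open_or_cyclic D C \<sigma> xs)"
  using assms
proof (induction "card S" arbitrary: S D C rule: less_induct)
  case less
  show ?case
  proof (cases "S = {}")
    case True
    then show ?thesis by (intro exI[of _ "{}"]) simp
  next
    case False
    obtain xs where xs: "xs \<noteq> []" "distinct xs" "set xs \<subseteq> S" "chain D \<sigma> xs" "open_or_cyclic D C \<sigma> xs"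
      using ex_orbit[OF less.prems False] by blast
    define X where "X = set xs"
    have closed: "\<sigma> x \<in> X \<longleftrightarrow> x \<in> X" if "x \<in> D" for x
      unfolding X_def using orbit_closed[OF less.prems(4) xs(1,4,5) that] .
    have inj: "inj_on \<sigma> D" and im: "\<sigma> ` D = C" using less.prems(4) by (auto simp: bij_betw_def)
    have "\<sigma> ` (D - X) = C - X" using closed im by auto
    then have bij: "bij_betw \<sigma> (D - X) (C - X)" using inj_on_subset[OF inj] by (auto simp: bij_betw_def)
    have "hd xs \<in> S \<inter> X" using xs(1,3) by (auto simp: X_def)
    then have "card (S - X) < card S" using less.prems(1)
      by (intro psubset_card_mono) auto
    from less.hyps[OF this _ _ _ bij] less.prems(1-3)
    obtain \<L> where L: "finite \<L>" "\<Union>(set ` \<L>) = S - X"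
      "\<And>xs ys. xs \<in> \<L> \<Longrightarrow> ys \<in> \<L> \<Longrightarrow> xs \<noteq> ys \<Longrightarrow> set xs \<inter> set ys = {}"
      "\<And>xs. xs \<in> \<L> \<Longrightarrow> xs \<noteq> [] \<and> distinct xs \<and> chain (D - X) \<sigma> xs \<and> open_or_cyclic (D - X) (C - X) \<sigma> xs"
      by (metis (no_types, lifting) Diff_mono finite_Diff subset_refl)
    \<comment> \<open>The lists found in the remainder avoid \<open>X\<close>, so their endpoints
      lie in \<open>D - X\<close> or \<open>C - X\<close> exactly if they lie in \<open>D\<close> or
      \<open>C\<close>.\<close>
    have "chain D \<sigma> ys \<and> open_or_cyclic D C \<sigma> ys" if ys: "ys \<in> \<L>" for ys
    proof -
      have "set ys \<inter> X = {}" using L(2) ys by blast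
      then have "hd ys \<notin> X" "last ys \<notin> X" using L(4)[OF ys] by (meson disjoint_iff hd_in_set last_in_set)+
      then show ?thesis using L(4)[OF ys] by (auto simp: chain_def open_or_cyclic_def)
    qed
    moreover have "set ys \<inter> X = {}" if "ys \<in> \<L>" for ys using L(2) that by blast
    ultimately show ?thesis using xs L unfolding X_def
      by (intro exI[of _ "insert xs \<L>"]) (auto simp: Int_commute)
  qed
qed

text \<open>A root of a root is a root, so a shortest one is primitive.\<close>

lemma ex_primitive_root:
  assumes "w \<noteq> []" shows "\<exists>x m. w = concat (replicate m x) \<and> x \<noteq> [] \<and> primitive x"
proof -
  let ?Q = "\<lambda>x. \<exists>m. w = concat (replicate m x)"
  have "?Q w" by (rule exI[of _ 1]) simp
  then obtain x where x: "?Q x" and least: "\<And>y. ?Q y \<Longrightarrow> length x \<le> length y"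
    using ex_has_least_nat[of ?Q w length] by blast
  then obtain m where m: "w = concat (replicate m x)" by blast
  have "primitive x" unfolding primitive_def
  proof (rule notI, elim exE conjE)
    fix y n assume y: "length y < length x" "x = concat (replicate n y)"
    have "concat (replicate m (concat (replicate n y))) = concat (replicate (m * n) y)"
      by (induction m) (simp_all add: replicate_add)
    then have "?Q y" using m y(2) by metis
    then show False using least y(1) by fastforce
  qed
  moreover have "x \<noteq> []" using m assms by (cases m) (auto simp: concat_eq_Nil_conv)
  ultimately show ?thesis using m by blast
qed

lemma count_list_concat_replicate: "count_list (concat (replicate m x)) e = m * count_list x e"
  by (induction m) auto

lemma count_list_rotate: "count_list (rotate n x) e = count_list x e"
proof -
  have "count_list (rotate n x) e = count_list (drop (n mod length x) x) e + count_list (take (n mod length x) x) e"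
    by (simp add: rotate_drop_take)
  also have "\<dots> = count_list x e"
    by (metis add.commute append_take_drop_id count_list_append)
  finally show ?thesis .
qed

text \<open>Breaking ties by the strand number also orders the strands of a single arc, and that
  order can be transported along a common path.\<close>

definition strand_less :: "('b \<times> 'b) set \<Rightarrow> 'b \<times> nat \<Rightarrow> 'b \<times> nat \<Rightarrow> bool" where
  "strand_less r p q \<longleftrightarrow> (fst p \<noteq> fst q \<and> (fst p, fst q) \<in> r) \<or> (fst p = fst q \<and> snd p < snd q)"

lemma strand_less_order:
  assumes "linear_order_on X r"
  shows "\<not> strand_less r p p"
    "\<lbrakk>strand_less r p q; strand_less r q s\<rbrakk> \<Longrightarrow> strand_less r p s"
    "\<lbrakk>fst p \<in> X; fst q \<in> X; p \<noteq> q\<rbrakk> \<Longrightarrow> strand_less r p q \<or> strand_less r q p"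
proof -
  have r: "trans r" "antisym r" using assms by (auto simp: order_on_defs)
  show "\<not> strand_less r p p" by (simp add: strand_less_def)
  show "\<lbrakk>strand_less r p q; strand_less r q s\<rbrakk> \<Longrightarrow> strand_less r p s"
    using transD[OF r(1), of "fst p" "fst q" "fst s"] antisymD[OF r(2), of "fst p" "fst q"]
    unfolding strand_less_def by auto
  show "\<lbrakk>fst p \<in> X; fst q \<in> X; p \<noteq> q\<rbrakk> \<Longrightarrow> strand_less r p q \<or> strand_less r q p"
    using linear_order_onD_total[OF assms, of "fst p" "fst q"] linorder_neq_iff[of "snd p" "snd q"]
    unfolding strand_less_def prod_eq_iff by metis
qed

section \<open>Strands of an integer flow and their noncrossing matching\<close>

context framed_digraph
begin

definition strands :: "('b \<Rightarrow> nat) \<Rightarrow> 'b set \<Rightarrow> ('b \<times> nat) set" where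
  "strands f A = (SIGMA e:A. {..<f e})"

text \<open>An integer flow \<open>f\<close> is split into \<open>f e\<close> unit strands \<open>(e, i)\<close> along each arc. At every internal
  vertex the incoming strands are connected to the outgoing ones in increasing order.\<close>

definition noncrossing_matching :: "('b \<Rightarrow> nat) \<Rightarrow> ('b \<times> nat \<Rightarrow> 'b \<times> nat) \<Rightarrow> bool" where
  "noncrossing_matching f \<sigma> \<longleftrightarrow> (\<forall>v\<in>internals G.
     bij_betw \<sigma> (strands f (in_arcs G v)) (strands f (out_arcs G v)) \<and>
     (\<forall>p\<in>strands f (in_arcs G v). \<forall>q\<in>strands f (in_arcs G v).
        strand_less (in_ord R v) p q \<longrightarrow> strand_less (out_ord R v) (\<sigma> p) (\<sigma> q)))"

lemma ex_noncrossing_matching: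
  assumes "\<And>v. v \<in> internals G \<Longrightarrow> (\<Sum>e\<in>in_arcs G v. f e) = (\<Sum>e\<in>out_arcs G v. f e)"
  shows "\<exists>\<sigma>. noncrossing_matching f \<sigma>"
proof -
  have "\<exists>g. bij_betw g (strands f (in_arcs G v)) (strands f (out_arcs G v)) \<and>
     (\<forall>p\<in>strands f (in_arcs G v). \<forall>q\<in>strands f (in_arcs G v).
        strand_less (in_ord R v) p q \<longrightarrow> strand_less (out_ord R v) (g p) (g q))"
    if v: "v \<in> internals G" for v
  proof (rule finite_strict_order_iso)
    have lin: "linear_order_on (in_arcs G v) (in_ord R v)" "linear_order_on (out_arcs G v) (out_ord R v)"
      using framing v by (auto simp: is_framing_def)
    show "card (strands f (in_arcs G v)) = card (strands f (out_arcs G v))"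
      using assms[OF v] by (simp add: strands_def card_SigmaI)
    show "strand_less (in_ord R v) x z" if "strand_less (in_ord R v) x y" "strand_less (in_ord R v) y z" for x y z
      using strand_less_order(2)[OF lin(1)] that by blast
    show "strand_less (out_ord R v) x z" if "strand_less (out_ord R v) x y" "strand_less (out_ord R v) y z" for x y z
      using strand_less_order(2)[OF lin(2)] that by blast
    show "strand_less (in_ord R v) x y \<or> strand_less (in_ord R v) y x"
      if "x \<in> strands f (in_arcs G v)" "y \<in> strands f (in_arcs G v)" "x \<noteq> y" for x y
      using strand_less_order(3)[OF lin(1), of x y] that by (auto simp: strands_def)
    show "strand_less (out_ord R v) x y \<or> strand_less (out_ord R v) y x"
      if "x \<in> strands f (out_arcs G v)" "y \<in> strands f (out_arcs G v)" "x \<noteq> y" for x y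
      using strand_less_order(3)[OF lin(2), of x y] that by (auto simp: strands_def)
  qed (auto simp: strands_def strand_less_def)
  then obtain g where g: "\<And>v. v \<in> internals G \<Longrightarrow>
     bij_betw (g v) (strands f (in_arcs G v)) (strands f (out_arcs G v)) \<and>
     (\<forall>p\<in>strands f (in_arcs G v). \<forall>q\<in>strands f (in_arcs G v).
        strand_less (in_ord R v) p q \<longrightarrow> strand_less (out_ord R v) (g v p) (g v q))"
    by metis
  \<comment> \<open>A strand enters only the head of its arc, so the bijections chosen at the
    vertices combine into one map.\<close>
  define \<sigma> where "\<sigma> p = g (head G (fst p)) p" for p
  have \<sigma>: "\<sigma> p = g v p" if "p \<in> strands f (in_arcs G v)" for p v
    using that by (auto simp: \<sigma>_def strands_def)
  have "noncrossing_matching f \<sigma>"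
    unfolding noncrossing_matching_def
  proof (intro ballI conjI)
    fix v assume v: "v \<in> internals G"
    show "bij_betw \<sigma> (strands f (in_arcs G v)) (strands f (out_arcs G v))"
      using g[OF v] \<sigma> by (simp cong: bij_betw_cong)
  qed (use g \<sigma> in simp)
  then show ?thesis by blast
qed

text \<open>The lift \<open>z\<close> to strands is indexed by positions, not by arcs: a trail may
  use several strands of one arc, and the lift of a band can have a longer period than the
  band.\<close>

definition carried :: "('b \<Rightarrow> nat) \<Rightarrow> ('b \<times> nat \<Rightarrow> 'b \<times> nat) \<Rightarrow> 'b trail \<Rightarrow> bool" where
  "carried f \<sigma> T \<longleftrightarrow> (\<exists>z. \<forall>i e. letter T i = Some e \<longrightarrow> z i \<in> strands f (arcs G) \<and> fst (z i) = e \<and>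
     (\<forall>e'. letter T (Suc i) = Some e' \<longrightarrow> \<sigma> (z i) = z (Suc i)))"

text \<open>Two strands keep their order along a common path, so they cannot leave it in the opposite order.\<close>

lemma carried_compatible:
  assumes \<sigma>: "noncrossing_matching f \<sigma>" and T: "T \<in> trails G" "carried f \<sigma> T"
    and T': "T' \<in> trails G" "carried f \<sigma> T'"
    and inc: "incompatibility G R p q" "subpath p T" "subpath q T'"
  shows False
proof -
  obtain v w Q e1 e2 f1 f2 where
    v: "v \<in> internals G" and w: "w \<in> internals G"
    and e: "e1 \<noteq> e2" "(e1, e2) \<in> in_ord R v" and fo: "f1 \<noteq> f2" "(f1, f2) \<in> out_ord R w"
    and p: "p = e1 # Q @ [f2]" and q: "q = e2 # Q @ [f1]"
    using inc(1) unfolding incompatibility_def by blast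
  have lin: "linear_order_on (in_arcs G u) (in_ord R u)" "linear_order_on (out_arcs G u) (out_ord R u)"
    if "u \<in> internals G" for u
    using framing that by (auto simp: is_framing_def)
  obtain c where c: "matches T c p" using subpath_iff_matches T(1) inc(2) by blast
  obtain c' where c': "matches T' c' q" using subpath_iff_matches T'(1) inc(3) by blast
  obtain z where z: "\<And>i e. letter T i = Some e \<Longrightarrow> z i \<in> strands f (arcs G) \<and> fst (z i) = e \<and>
     (\<forall>e'. letter T (Suc i) = Some e' \<longrightarrow> \<sigma> (z i) = z (Suc i))" using T(2) unfolding carried_def by blast
  obtain z' where z': "\<And>i e. letter T' i = Some e \<Longrightarrow> z' i \<in> strands f (arcs G) \<and> fst (z' i) = e \<and>
     (\<forall>e'. letter T' (Suc i) = Some e' \<longrightarrow> \<sigma> (z' i) = z' (Suc i))" using T'(2) unfolding carried_def by blast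
  \<comment> \<open>\<open>N\<close> is the position of the last arc in both lists; the common path
    occupies the positions from 1 to \<open>N - 1\<close>.\<close>
  define N where "N = Suc (length Q)"
  have len: "length p = Suc N" "length q = Suc N" by (auto simp: p q N_def)
  have zi: "z (c + i) \<in> strands f (arcs G) \<and> fst (z (c + i)) = p ! i" if "i \<le> N" for i
    using z[of "c + i" "p ! i"] c that by (simp add: matches_def len)
  have zi': "z' (c' + i) \<in> strands f (arcs G) \<and> fst (z' (c' + i)) = q ! i" if "i \<le> N" for i
    using z'[of "c' + i" "q ! i"] c' that by (simp add: matches_def len)
  have zs: "\<sigma> (z (c + i)) = z (c + Suc i)" if "i < N" for i
    using z[of "c + i" "p ! i"] c that unfolding matches_def len by (metis add_Suc_right less_SucI not_less_eq)
  have zs': "\<sigma> (z' (c' + i)) = z' (c' + Suc i)" if "i < N" for i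
    using z'[of "c' + i" "q ! i"] c' that unfolding matches_def len by (metis add_Suc_right less_SucI not_less_eq)
  note walk = matches_walk[OF T(1) c] and walk' = matches_walk[OF T'(1) c']
  have e_in: "e1 \<in> in_arcs G v" "e2 \<in> in_arcs G v"
    using lin(1)[OF v] e(2) by (auto simp: order_on_defs refl_on_def)
  have f_out: "f1 \<in> out_arcs G w" "f2 \<in> out_arcs G w"
    using lin(2)[OF w] fo(2) by (auto simp: order_on_defs refl_on_def)
  have step: "strand_less (out_ord R u) (z (c + Suc i)) (z' (c' + Suc i))"
    if i: "i < N" and u: "u \<in> internals G" "head G (p ! i) = u" "head G (q ! i) = u"
      and less: "strand_less (in_ord R u) (z (c + i)) (z' (c' + i))" for i u
  proof -
    have "z (c + i) \<in> strands f (in_arcs G u)" "z' (c' + i) \<in> strands f (in_arcs G u)"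
      using zi[of i] zi'[of i] i u by (auto simp: strands_def)
    then show ?thesis
      using \<sigma> u(1) less zs[OF i] zs'[OF i] unfolding noncrossing_matching_def by metis
  qed
  have tail_int: "tail G (p ! Suc i) \<in> internals G" if "i < N" for i
  proof -
    have "p ! i \<in> arcs G" "p ! Suc i \<in> arcs G" using walk(1) that len by (auto simp: subset_eq)
    then show ?thesis using walk(2)[of i] that len by (auto simp: internals_iff in_arcs_def out_arcs_def)
  qed
  have main: "strand_less (out_ord R (tail G (p ! Suc i))) (z (c + Suc i)) (z' (c' + Suc i))"
    if "i < N" for i
    using that
  proof (induction i)
    case 0
    have "strand_less (in_ord R v) (z (c + 0)) (z' (c' + 0))"
      using zi[of 0] zi'[of 0] e by (simp add: strand_less_def p q)
    moreover have "v = tail G (p ! Suc 0)" using walk(2)[of 0] e_in len 0 by (simp add: p)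
    ultimately show ?case using step[of 0 v] v e_in 0 by (simp add: p q)
  next
    case (Suc i)
    have pq: "p ! Suc i = q ! Suc i" using Suc.prems by (auto simp: p q nth_append N_def)
    let ?u = "tail G (p ! Suc (Suc i))"
    have u: "head G (p ! Suc i) = ?u" using walk(2)[of "Suc i"] Suc.prems len by simp
    \<comment> \<open>Both strands lie on the same arc, where only their numbers are compared. So
      the order in which they left the previous vertex is the order in which they enter the next
      one.\<close>
    have "strand_less (in_ord R ?u) (z (c + Suc i)) (z' (c' + Suc i))"
      using Suc zi[of "Suc i"] zi'[of "Suc i"] pq by (simp add: strand_less_def)
    then show ?case using step[of "Suc i" ?u] Suc.prems tail_int[of "Suc i"] u pq by simp
  qed
  have pN: "p ! N = f2" "q ! N = f1" by (auto simp: p q N_def nth_append)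
  have "N = Suc (length Q)" by (simp add: N_def)
  then have "strand_less (out_ord R w) (z (c + N)) (z' (c' + N))"
    using main[of "length Q"] pN f_out by (simp add: out_arcs_def)
  then have "(f2, f1) \<in> out_ord R w" using zi[of N] zi'[of N] pN fo(1) by (simp add: strand_less_def)
  then show False using fo lin(2)[OF w] by (auto simp: order_on_defs dest: antisymD)
qed

text \<open>The two ends of an open orbit are not internal vertices, so they are a source and a
  sink. A cyclic orbit closes up to a power of a band. The factor \<open>m\<close> is the exponent,
  and 1 for a route.\<close>

lemma orbit_trail:
  assumes \<sigma>: "noncrossing_matching f \<sigma>"
    and D: "D = {p \<in> strands f (arcs G). head G (fst p) \<in> internals G}"
    and C: "C = {p \<in> strands f (arcs G). tail G (fst p) \<in> internals G}"
    and xs: "xs \<noteq> []" "set xs \<subseteq> strands f (arcs G)" "chain D \<sigma> xs" "open_or_cyclic D C \<sigma> xs"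
  shows "\<exists>T m. T \<in> trails G \<and> carried f \<sigma> T \<and> (\<forall>e. count_list (map fst xs) e = m * count_list (rep T) e)"
proof -
  define w where "w = map fst xs"
  have w: "w \<noteq> []" "length w = length xs" "set w \<subseteq> arcs G" using xs by (auto simp: w_def strands_def)
  have wn: "w ! i = fst (xs ! i)" if "i < length xs" for i using that by (simp add: w_def)
  have tail_\<sigma>: "tail G (fst (\<sigma> p)) = head G (fst p)" if "p \<in> D" for p
  proof -
    let ?v = "head G (fst p)"
    have v: "?v \<in> internals G" and p: "p \<in> strands f (in_arcs G ?v)"
      using that by (auto simp: D strands_def)
    have "\<sigma> p \<in> strands f (out_arcs G ?v)"
      using \<sigma> v p unfolding noncrossing_matching_def by (meson bij_betwE)
    then show ?thesis by (auto simp: strands_def)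
  qed
  have walk: "head G (w ! i) = tail G (w ! Suc i)" if "Suc i < length w" for i
    using tail_\<sigma>[of "xs ! i"] xs(3) that w(2) by (simp add: chain_def wn)
  have in_w: "hd w \<in> arcs G" "last w \<in> arcs G" using w(1,3) by auto
  have hdw: "hd w = fst (hd xs)" "last w = fst (last xs)" using xs(1) by (simp_all add: w_def hd_map last_map)
  show ?thesis
  proof (cases "hd xs \<notin> C \<and> last xs \<notin> D")
    case True
    then have "tail G (hd w) \<notin> internals G" "head G (last w) \<notin> internals G"
      using subsetD[OF xs(2) hd_in_set[OF xs(1)]] subsetD[OF xs(2) last_in_set[OF xs(1)]]
      by (simp_all add: C D hdw)
    then have "tail G (hd w) \<in> sources G" "head G (last w) \<in> sinks G"
      using in_w sinks_not_tail sources_not_head by (auto simp: internals_def)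
    moreover have "awalk (tail G (hd w)) w (head G (last w))"
      using awalk_iff_nth[OF w(1)] w(3) walk by simp
    ultimately have "Route w \<in> routes G" using w(1) unfolding routes_def by blast
    moreover have "carried f \<sigma> (Route w)"
      unfolding carried_def using xs wn w(2)
      by (intro exI[of _ "\<lambda>i. xs ! i"]) (auto simp: chain_def split: if_splits)
    ultimately show ?thesis
      by (intro exI[of _ "Route w"] exI[of _ "1::nat"]) (simp add: trails_def w_def)
  next
    case False
    then have cyc: "last xs \<in> D" "\<sigma> (last xs) = hd xs" using xs(4) by (auto simp: open_or_cyclic_def)
    let ?n = "length xs"
    have n: "?n > 0" using xs(1) by simp
    have next_xs: "xs ! (i mod ?n) \<in> D \<and> \<sigma> (xs ! (i mod ?n)) = xs ! (Suc i mod ?n)" for i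
    proof (cases "Suc (i mod ?n) = ?n")
      case True
      then have "i mod ?n = ?n - 1" by simp
      then show ?thesis using True cyc xs(1) by (simp add: mod_Suc last_conv_nth hd_conv_nth)
    next
      case False
      then have "Suc (i mod ?n) < ?n" using n by (simp add: Suc_lessI)
      then show ?thesis using xs(3) False by (simp add: chain_def mod_Suc)
    qed
    obtain x m where x: "w = concat (replicate m x)" "x \<noteq> []" "primitive x"
      using ex_primitive_root[OF w(1)] by blast
    have lenw: "?n = m * length x" using w(2) x(1) by (metis length_concat_replicate)
    \<comment> \<open>The length of the primitive root divides that of the orbit, so arcs can be
      read modulo the shorter period while strands keep the longer one.\<close>
    have nth_x: "x ! (i mod length x) = fst (xs ! (i mod ?n))" for i
    proof -
      have "w ! (i mod ?n) = x ! ((i mod ?n) mod length x)"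
        using x(1) lenw n by (metis mod_less_divisor nth_concat_replicate)
      then show ?thesis using wn n lenw by (simp add: mod_mod_cancel)
    qed
    have "awalk (tail G (hd x)) x (tail G (hd x))"
      unfolding awalk_iff_nth[OF x(2)]
    proof (intro conjI allI impI)
      show "set x \<subseteq> arcs G" using w(3) x lenw n unfolding x(1) by auto
      have hx: "head G (x ! (i mod length x)) = tail G (x ! (Suc i mod length x))" for i
        unfolding nth_x using tail_\<sigma> next_xs by metis
      show "head G (x ! i) = tail G (x ! Suc i)" if "Suc i < length x" for i
        using hx[of i] that by simp
      show "head G (last x) = tail G (hd x)"
        using hx[of "length x - 1"] x(2) by (simp add: last_conv_nth hd_conv_nth)
    qed simp
    then have T: "Band (range (\<lambda>n. rotate n x)) \<in> bands G" (is "?T \<in> _")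
      unfolding bands_def using x(2,3) unfolding primitive_def by blast
    have "rep ?T \<in> range (\<lambda>n. rotate n x)" unfolding rep.simps by (rule someI) (rule rangeI)
    \<comment> \<open>The representative from which the band is read may start \<open>s\<close> arcs
      later; the lift is shifted accordingly.\<close>
    then obtain s where s: "rep ?T = rotate s x" by auto
    have "letter ?T i = Some (fst (xs ! ((s + i) mod ?n)))" for i
      using x(2) unfolding bands_letter[OF T] s nth_x[symmetric]
      by (simp add: nth_rotate mod_add_right_eq)
    moreover have "xs ! (i mod ?n) \<in> strands f (arcs G)" for i
      using xs(2) n by (simp add: subset_eq)
    ultimately have "carried f \<sigma> ?T"
      unfolding carried_def using next_xs
      by (intro exI[of _ "\<lambda>i. xs ! ((s + i) mod ?n)"]) simp
    moreover have "count_list (map fst xs) e = m * count_list (rep ?T) e" for e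
      unfolding s count_list_rotate w_def[symmetric] by (subst x(1)) (rule count_list_concat_replicate)
    ultimately show ?thesis using T unfolding trails_def by blast
  qed
qed

proposition integer_flow_bundle_combination:
  assumes F: "F \<in> nonneg_flows G" "integer_vec F"
  shows "\<exists>K (a :: 'b trail \<Rightarrow> nat). is_bundle G R K \<and> finite K \<and> F = (\<Sum>T\<in>K. real (a T) *\<^sub>R traversals T)"
proof -
  define f where "f e = nat \<lfloor>F $ e\<rfloor>" for e
  have Ff: "F $ e = real (f e)" for e
    using F unfolding f_def nonneg_flows_def integer_vec_def by (auto elim: Ints_cases)
  have "(\<Sum>e\<in>in_arcs G v. f e) = (\<Sum>e\<in>out_arcs G v. f e)" if "v \<in> internals G" for v
  proof -
    have "(\<Sum>e\<in>in_arcs G v. real (f e)) = (\<Sum>e\<in>out_arcs G v. real (f e))"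
      using F(1) that by (simp add: nonneg_flows_def is_flow_def flip: Ff)
    then show ?thesis by (metis of_nat_eq_iff of_nat_sum)
  qed
  then obtain \<sigma> where \<sigma>: "noncrossing_matching f \<sigma>" using ex_noncrossing_matching by blast
  define S where "S = strands f (arcs G)"
  define D where "D = {p \<in> strands f (arcs G). head G (fst p) \<in> internals G}"
  define C where "C = {p \<in> strands f (arcs G). tail G (fst p) \<in> internals G}"
  have fin: "finite S" by (simp add: S_def strands_def)
  have \<sigma>v: "bij_betw \<sigma> (strands f (in_arcs G v)) (strands f (out_arcs G v))" if "v \<in> internals G" for v
    using \<sigma> that by (simp add: noncrossing_matching_def)
  have \<sigma>D: "\<sigma> p \<in> strands f (out_arcs G (head G (fst p)))" "p \<in> strands f (in_arcs G (head G (fst p)))"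
    if "p \<in> D" for p
  proof -
    show "p \<in> strands f (in_arcs G (head G (fst p)))" using that by (auto simp: D_def strands_def)
    then show "\<sigma> p \<in> strands f (out_arcs G (head G (fst p)))"
      using \<sigma>v[of "head G (fst p)"] that by (auto simp: D_def bij_betw_def)
  qed
  \<comment> \<open>\<open>D\<close> consists of the strands entering internal vertices,
    \<open>C\<close> of those leaving them. The images of strands with different heads leave
    different vertices, so the bijections at the single vertices unite.\<close>
  have "bij_betw \<sigma> D C"
    unfolding bij_betw_def
  proof
    show "inj_on \<sigma> D"
    proof (rule inj_onI)
      fix p q assume pq: "p \<in> D" "q \<in> D" "\<sigma> p = \<sigma> q"
      have h: "head G (fst p) = head G (fst q)"
        using \<sigma>D(1)[OF pq(1)] \<sigma>D(1)[OF pq(2)] pq(3) by (auto simp: strands_def)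
      have "inj_on \<sigma> (strands f (in_arcs G (head G (fst q))))"
        using \<sigma>v[of "head G (fst q)"] pq(2) by (auto simp: D_def bij_betw_def)
      then show "p = q" using \<sigma>D(2)[OF pq(1)] \<sigma>D(2)[OF pq(2)] pq(3) h by (auto dest: inj_onD)
    qed
    show "\<sigma> ` D = C"
    proof (intro subset_antisym subsetI)
      fix p assume "p \<in> \<sigma> ` D"
      then obtain q where q: "q \<in> D" "p = \<sigma> q" by auto
      then show "p \<in> C" using \<sigma>D(1)[OF q(1)] by (auto simp: C_def D_def strands_def)
    next
      fix p assume p: "p \<in> C"
      let ?v = "tail G (fst p)"
      have "p \<in> strands f (out_arcs G ?v)" "?v \<in> internals G" using p by (auto simp: C_def strands_def)
      then have "p \<in> \<sigma> ` strands f (in_arcs G ?v)"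
        using \<sigma>v[of ?v] unfolding bij_betw_def by simp
      then obtain q where q: "p = \<sigma> q" "q \<in> strands f (in_arcs G ?v)" by (rule imageE)
      moreover have "q \<in> D" using q(2) \<open>?v \<in> internals G\<close> by (auto simp: D_def strands_def)
      ultimately show "p \<in> \<sigma> ` D" by blast
    qed
  qed
  then obtain \<L> where L: "finite \<L>" "\<Union>(set ` \<L>) = S" "\<forall>xs\<in>\<L>. \<forall>ys\<in>\<L>. xs \<noteq> ys \<longrightarrow> set xs \<inter> set ys = {}"
    "\<forall>xs\<in>\<L>. xs \<noteq> [] \<and> distinct xs \<and> chain D \<sigma> xs \<and> open_or_cyclic D C \<sigma> xs"
    using orbit_decomposition[OF fin, of D C \<sigma>] unfolding D_def C_def S_def by blast
  have "\<exists>T m. T \<in> trails G \<and> carried f \<sigma> T \<and> (\<forall>e. count_list (map fst xs) e = m * count_list (rep T) e)"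
    if "xs \<in> \<L>" for xs
    using orbit_trail[OF \<sigma> D_def C_def, of xs] L(2,4) that unfolding S_def by blast
  then obtain t m where tm: "\<And>xs. xs \<in> \<L> \<Longrightarrow> t xs \<in> trails G \<and> carried f \<sigma> (t xs) \<and>
    (\<forall>e. count_list (map fst xs) e = m xs * count_list (rep (t xs)) e)" by metis
  define K where "K = t ` \<L>"
  \<comment> \<open>Different orbits may yield the same trail, possibly with different exponents;
    their multiplicities add up.\<close>
  define a where "a T = (\<Sum>xs\<in>{xs \<in> \<L>. t xs = T}. m xs)" for T
  \<comment> \<open>All these trails are carried by one matching, hence compatible with each other
    and with themselves.\<close>
  have "is_bundle G R K"
    unfolding is_bundle_def K_def
  proof (intro conjI ballI notI)
    show "t ` \<L> \<subseteq> trails G" using tm by auto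
    fix T T' assume "T \<in> t ` \<L>" "T' \<in> t ` \<L>" "incompatible G R T T'"
    then show False using tm carried_compatible[OF \<sigma>] unfolding incompatible_def by blast
  qed
  moreover have "F = (\<Sum>T\<in>K. real (a T) *\<^sub>R traversals T)"
  proof (rule vec_eq_iff[THEN iffD2], rule allI)
    fix e
    \<comment> \<open>The flow on \<open>e\<close> is its number of strands, which is then counted
      orbit by orbit.\<close>
    have "f e = (\<Sum>p\<in>S. of_bool (fst p = e))"
    proof (cases "e \<in> arcs G")
      case True
      have "(\<Sum>p\<in>S. of_bool (fst p = e)) = card (S \<inter> {p. fst p = e})"
        using fin by simp
      also have "S \<inter> {p. fst p = e} = {e} \<times> {..<f e}" using True by (auto simp: S_def strands_def)
      finally show ?thesis by (simp add: card_cartesian_product)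
    next
      case False
      then have "F $ e = 0" using F(1) by (auto simp: nonneg_flows_def is_flow_def)
      moreover have "(\<Sum>p\<in>S. of_bool (fst p = e)) = (0::nat)"
        using False by (intro sum.neutral) (auto simp: S_def strands_def)
      ultimately show ?thesis by (simp add: Ff)
    qed
    also have "\<dots> = (\<Sum>xs\<in>\<L>. \<Sum>p\<in>set xs. of_bool (fst p = e))"
      unfolding L(2)[symmetric] using L(1,3) by (intro sum.UNION_disjoint) auto
    also have "\<dots> = (\<Sum>xs\<in>\<L>. m xs * occ (t xs) [e])"
    proof (rule sum.cong[OF refl])
      fix xs assume xs: "xs \<in> \<L>"
      have "(\<Sum>p\<in>set xs. of_bool (fst p = e)) = sum_list (map (\<lambda>p. of_bool (fst p = e)) xs)"
        using L(4) xs by (simp add: sum_list_distinct_conv_sum_set)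
      also have "\<dots> = count_list (map fst xs) e" by (induction xs) auto
      finally show "(\<Sum>p\<in>set xs. of_bool (fst p = e)) = m xs * occ (t xs) [e]"
        using tm[OF xs] by (simp add: occ_single)
    qed
    also have "\<dots> = (\<Sum>T\<in>K. \<Sum>xs\<in>{xs \<in> \<L>. t xs = T}. m xs * occ (t xs) [e])"
      unfolding K_def by (rule sum.image_gen[OF L(1)])
    also have "\<dots> = (\<Sum>T\<in>K. a T * occ T [e])"
      unfolding a_def sum_distrib_right by (intro sum.cong refl) auto
    finally show "F $ e = (\<Sum>T\<in>K. real (a T) *\<^sub>R traversals T) $ e"
      by (simp add: Ff sum_component traversals_nth)
  qed
  ultimately show ?thesis using L(1) unfolding K_def by blast
qed

end

section \<open>The subdivisions\<close>

context framed_digraph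
begin

definition total_flow :: "real ^ 'b \<Rightarrow> real" where
  "total_flow F = (\<Sum>v\<in>sources G. \<Sum>e\<in>out_arcs G v. F $ e)"

lemma total_flow_alt: "total_flow F = (\<Sum>e\<in>source_arcs. F $ e)"
proof -
  have "source_arcs = (\<Union>v\<in>sources G. out_arcs G v)" by (auto simp: source_arcs_def)
  moreover have "finite (sources G)" by (simp add: sources_def)
  ultimately show ?thesis unfolding total_flow_def by (auto intro!: sum.UNION_disjoint[symmetric])
qed

lemma total_flow_sum: "total_flow (\<Sum>x\<in>A. F x) = (\<Sum>x\<in>A. total_flow (F x))"
  unfolding total_flow_alt by (simp add: sum_component) (rule sum.swap)

lemma total_flow_scaleR: "total_flow (c *\<^sub>R F) = c * total_flow F"
  unfolding total_flow_alt by (simp add: sum_distrib_left)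

text \<open>Among the arcs of a route only the first leaves a source, and it is traversed once; a
  band has no such arc.\<close>

lemma total_flow_traversals:
  assumes T: "T \<in> trails G"
  shows "total_flow (traversals T) = (if T \<in> routes G then 1 else 0)"
proof (cases "T \<in> routes G")
  case True
  then obtain p where p: "T = Route p" "p \<noteq> []" "set p \<subseteq> arcs G" "tail G (hd p) \<in> sources G"
    by (auto elim: routes_rep)
  have "occ T [e] = (if e = hd p then 1 else 0)" if e: "e \<in> source_arcs" for e
  proof -
    have "{c. c < length (rep T) \<and> matches T c [e]} = (if e = hd p then {0} else {})"
    proof -
      have "matches T c [e] \<longleftrightarrow> letter T c = Some e" for c by (simp add: matches_def)
      moreover have "letter T 0 = Some (hd p)" using p(1,2) by (simp add: hd_conv_nth)
      then have "letter T c = Some e \<longleftrightarrow> c = 0 \<and> e = hd p" for c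
        using source_letter(2)[OF T _ e] by (metis option.inject)
      ultimately show ?thesis using rep_nonempty[OF T] by auto
    qed
    then show ?thesis by (simp add: occ_def)
  qed
  then have "total_flow (traversals T) = (\<Sum>e\<in>source_arcs. if e = hd p then 1 else 0)"
    unfolding total_flow_alt traversals_nth by (intro sum.cong) auto
  moreover have "hd p \<in> source_arcs" using p hd_in_set[OF p(2)] by (auto simp: source_arcs_def)
  ultimately show ?thesis using True by simp
next
  case False
  have "occ T [e] = 0" if e: "e \<in> source_arcs" for e
  proof (rule ccontr)
    assume "occ T [e] \<noteq> 0"
    then obtain c where "letter T c = Some e" using occ_posD by (fastforce simp: matches_def)
    then show False using source_letter(1)[OF T _ e] False by blast
  qed
  then show ?thesis unfolding total_flow_alt traversals_nth using False by simp
qed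

text \<open>Inflow and outflow at an internal vertex both count the passages \<open>[e, f]\<close>
  through it.\<close>

lemma traversals_nonneg_flow:
  assumes T: "T \<in> trails G" shows "traversals T \<in> nonneg_flows G"
proof -
  have "occ T [e] = 0" if "e \<notin> arcs G" for e
    using occ_posD[of T "[e]"] matches_walk(1)[OF T, of _ "[e]"] that by auto
  moreover have "(\<Sum>e\<in>in_arcs G v. occ T [e]) = (\<Sum>f\<in>out_arcs G v. occ T [f])" if v: "v \<in> internals G" for v
  proof -
    have "(\<Sum>e\<in>in_arcs G v. occ T [e]) = (\<Sum>e\<in>in_arcs G v. \<Sum>f\<in>out_arcs G v. occ T [e, f])"
      using occ_snoc[OF T, of "[_]" v] v by (intro sum.cong) auto
    also have "\<dots> = (\<Sum>f\<in>out_arcs G v. \<Sum>e\<in>in_arcs G v. occ T [e, f])" by (rule sum.swap)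
    also have "\<dots> = (\<Sum>f\<in>out_arcs G v. occ T [f])"
      using occ_Cons[OF T, of "[_]" v] v by (intro sum.cong) auto
    finally show ?thesis .
  qed
  ultimately show ?thesis
    unfolding nonneg_flows_def is_flow_def by (auto simp: traversals_nth simp flip: of_nat_sum)
qed

lemma nonneg_flows_conic:
  "\<lbrakk>F \<in> nonneg_flows G; 0 \<le> c\<rbrakk> \<Longrightarrow> c *\<^sub>R F \<in> nonneg_flows G"
  by (auto simp: nonneg_flows_def is_flow_def simp flip: sum_distrib_left)

lemma nonneg_flows_sum:
  "(\<And>x. x \<in> A \<Longrightarrow> F x \<in> nonneg_flows G) \<Longrightarrow> (\<Sum>x\<in>A. F x) \<in> nonneg_flows G"
proof (induction A rule: infinite_finite_induct)
  case (insert x A)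
  then show ?case by (auto simp: nonneg_flows_def is_flow_def sum.distrib)
qed (auto simp: nonneg_flows_def is_flow_def)

lemma polyhedron_nonneg_flows: "polyhedron (nonneg_flows G)"
proof -
  let ?cons = "\<lambda>v. (\<Sum>e\<in>in_arcs G v. axis e 1) - (\<Sum>e\<in>out_arcs G v. axis e (1::real)) :: real ^ 'b"
  have "nonneg_flows G = \<Inter>((\<lambda>e. {F. axis e 1 \<bullet> F \<ge> 0}) ` UNIV) \<inter>
    \<Inter>((\<lambda>e. {F. axis e 1 \<bullet> F = 0}) ` (- arcs G)) \<inter> \<Inter>((\<lambda>v. {F. ?cons v \<bullet> F = 0}) ` internals G)"
    by (auto simp: nonneg_flows_def is_flow_def inner_axis' inner_diff_left inner_sum_left)
  also have "polyhedron \<dots>"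
    by (intro polyhedron_Int polyhedron_Inter)
      (auto simp: internals_def polyhedron_halfspace_ge polyhedron_hyperplane)
  finally show ?thesis .
qed

lemma total_flow_inner: "total_flow F = (\<Sum>e\<in>source_arcs. axis e 1) \<bullet> F"
  by (simp add: total_flow_alt inner_sum_left inner_axis')

lemma polyhedron_total_flow: "polyhedron {F. total_flow F = c}"
  unfolding total_flow_inner by (rule polyhedron_hyperplane)

lemma unit_flows_eq: "unit_flows G = nonneg_flows G \<inter> {F. total_flow F = 1}"
  by (auto simp: unit_flows_def total_flow_def)

section \<open>Cones and unit polyhedra of bundles\<close>

lemma represents_iff:
  assumes "is_bundle G R K"
  shows "represents K a F \<longleftrightarrow> (\<forall>T\<in>K. 0 \<le> a T) \<and> F = (\<Sum>T\<in>K. a T *\<^sub>R traversals T)"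
  unfolding represents_def using bundle_finite[OF assms] by (auto simp: has_sum_finite_iff)

lemma bundle_cone_eq:
  assumes "is_bundle G R K"
  shows "bundle_cone K = {\<Sum>T\<in>K. a T *\<^sub>R traversals T | a. \<forall>T\<in>K. 0 \<le> a T}"
  unfolding bundle_cone_def represents_iff[OF assms] by auto

lemma bundle_cone_subset_flows:
  assumes K: "is_bundle G R K" shows "bundle_cone K \<subseteq> nonneg_flows G"
  unfolding bundle_cone_eq[OF K] using K
  by (auto simp: is_bundle_def intro!: nonneg_flows_sum nonneg_flows_conic traversals_nonneg_flow)

lemma total_flow_combination:
  assumes K: "is_bundle G R K"
  shows "total_flow (\<Sum>T\<in>K. a T *\<^sub>R traversals T) = (\<Sum>T\<in>K \<inter> routes G. a T)"
proof -
  have "total_flow (\<Sum>T\<in>K. a T *\<^sub>R traversals T) = (\<Sum>T\<in>K. if T \<in> routes G then a T else 0)"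
    unfolding total_flow_sum total_flow_scaleR using K
    by (intro sum.cong) (auto simp: total_flow_traversals is_bundle_def)
  then show ?thesis using bundle_finite[OF K] by (simp add: sum.inter_restrict)
qed

text \<open>The total flow of a combination is the sum of its route coefficients, so the unit
  condition cuts the cone by a hyperplane. Intersections and faces of unit cells are thus inherited
  from the cones.\<close>

lemma unit_bundle_polyhedron_eq:
  assumes K: "is_bundle G R K"
  shows "unit_bundle_polyhedron G K = bundle_cone K \<inter> {F. total_flow F = 1}"
  unfolding unit_bundle_polyhedron_def bundle_cone_def unit_coeffs_def
  using bundle_finite[OF K] total_flow_combination[OF K]
  by (auto simp: represents_iff[OF K] has_sum_finite_iff)

lemma bundle_cone_mono:
  assumes L: "is_bundle G R L" and KL: "K \<subseteq> L"
  shows "bundle_cone K \<subseteq> bundle_cone L"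
proof
  note K = is_bundle_subset[OF L KL]
  fix F assume "F \<in> bundle_cone K"
  then obtain a where a: "F = (\<Sum>T\<in>K. a T *\<^sub>R traversals T)" "\<forall>T\<in>K. 0 \<le> a T"
    by (auto simp: bundle_cone_eq[OF K])
  have "F = (\<Sum>T\<in>L. (if T \<in> K then a T else 0) *\<^sub>R traversals T)"
    unfolding a(1) using KL bundle_finite[OF L] by (intro sum.mono_neutral_cong_left) auto
  then show "F \<in> bundle_cone L" unfolding bundle_cone_eq[OF L] using a(2)
    by (auto intro!: exI[of _ "\<lambda>T. if T \<in> K then a T else 0"])
qed

lemma bundle_cone_Int:
  assumes K: "is_bundle G R K" and L: "is_bundle G R L"
  shows "bundle_cone K \<inter> bundle_cone L = bundle_cone (K \<inter> L)"
proof
  show "bundle_cone (K \<inter> L) \<subseteq> bundle_cone K \<inter> bundle_cone L"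
    using bundle_cone_mono[OF K, of "K \<inter> L"] bundle_cone_mono[OF L, of "K \<inter> L"] by auto
  show "bundle_cone K \<inter> bundle_cone L \<subseteq> bundle_cone (K \<inter> L)"
  proof
    fix F assume F: "F \<in> bundle_cone K \<inter> bundle_cone L"
    obtain a where a: "F = (\<Sum>T\<in>K. a T *\<^sub>R traversals T)" "\<forall>T\<in>K. 0 \<le> a T"
      using F by (auto simp: bundle_cone_eq[OF K])
    obtain b where b: "F = (\<Sum>T\<in>L. b T *\<^sub>R traversals T)" "\<forall>T\<in>L. 0 \<le> b T"
      using F by (auto simp: bundle_cone_eq[OF L])
    have "(if T \<in> K then a T else 0) = (if T \<in> L then b T else 0)" for T
      using bundle_coefficients_unique[OF bundle_finite[OF K] bundle_finite[OF L] K _ L, of a b T] a b by auto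
    then have "a T = 0" if "T \<in> K - L" for T using that by (metis DiffE)
    then have "F = (\<Sum>T\<in>K \<inter> L. a T *\<^sub>R traversals T)"
      unfolding a(1) using bundle_finite[OF K] by (intro sum.mono_neutral_right) auto
    then show "F \<in> bundle_cone (K \<inter> L)"
      unfolding bundle_cone_eq[OF is_bundle_subset[OF K Int_lower1]] using a(2) by auto
  qed
qed

text \<open>By uniqueness, the coefficients of a point inside a segment are a strict convex
  combination of those of the endpoints. They vanish outside \<open>L\<close>, so by nonnegativity
  those of the endpoints vanish there too.\<close>

lemma bundle_cone_face:
  assumes K: "is_bundle G R K" and LK: "L \<subseteq> K"
  shows "bundle_cone L face_of bundle_cone K"
proof -
  note L = is_bundle_subset[OF K LK]
  have conv: "convex (bundle_cone L)"
  proof (rule convexI)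
    fix p q :: "real ^ 'b" and u v :: real
    assume pq: "p \<in> bundle_cone L" "q \<in> bundle_cone L" and uv: "0 \<le> u" "0 \<le> v" "u + v = 1"
    obtain a where a: "p = (\<Sum>T\<in>L. a T *\<^sub>R traversals T)" "\<forall>T\<in>L. 0 \<le> a T"
      using pq(1) by (auto simp: bundle_cone_eq[OF L])
    obtain b where b: "q = (\<Sum>T\<in>L. b T *\<^sub>R traversals T)" "\<forall>T\<in>L. 0 \<le> b T"
      using pq(2) by (auto simp: bundle_cone_eq[OF L])
    have "u *\<^sub>R p + v *\<^sub>R q = (\<Sum>T\<in>L. (u * a T + v * b T) *\<^sub>R traversals T)"
      by (simp add: a b scaleR_add_left sum.distrib scaleR_sum_right)
    then show "u *\<^sub>R p + v *\<^sub>R q \<in> bundle_cone L"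
      unfolding bundle_cone_eq[OF L] using a(2) b(2) uv
      by (auto intro!: exI[of _ "\<lambda>T. u * a T + v * b T"])
  qed
  have "p \<in> bundle_cone L \<and> q \<in> bundle_cone L"
    if pq: "p \<in> bundle_cone K" "q \<in> bundle_cone K" and x: "x \<in> bundle_cone L" "x \<in> open_segment p q" for p q x
  proof -
    obtain a where a: "p = (\<Sum>T\<in>K. a T *\<^sub>R traversals T)" "\<forall>T\<in>K. 0 \<le> a T"
      using pq(1) by (auto simp: bundle_cone_eq[OF K])
    obtain b where b: "q = (\<Sum>T\<in>K. b T *\<^sub>R traversals T)" "\<forall>T\<in>K. 0 \<le> b T"
      using pq(2) by (auto simp: bundle_cone_eq[OF K])
    obtain c where c: "x = (\<Sum>T\<in>L. c T *\<^sub>R traversals T)" "\<forall>T\<in>L. 0 \<le> c T"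
      using x(1) by (auto simp: bundle_cone_eq[OF L])
    obtain t where t: "x = (1 - t) *\<^sub>R p + t *\<^sub>R q" "0 < t" "t < 1"
      using x(2) by (auto simp: in_segment)
    have "x = (\<Sum>T\<in>K. ((1 - t) * a T + t * b T) *\<^sub>R traversals T)"
      by (simp add: t a b scaleR_add_left sum.distrib scaleR_sum_right)
    then have eq: "(\<Sum>T\<in>K. ((1 - t) * a T + t * b T) *\<^sub>R traversals T) = (\<Sum>T\<in>L. c T *\<^sub>R traversals T)"
      using c by simp
    have nn: "\<And>T. T \<in> K \<Longrightarrow> 0 \<le> (1 - t) * a T + t * b T" using a b t by simp
    have "a T = 0 \<and> b T = 0" if "T \<in> K - L" for T
    proof -
      have "(1 - t) * a T + t * b T = 0"
        using bundle_coefficients_unique[OF bundle_finite[OF K] bundle_finite[OF L] K nn L _ eq, of T] c(2) that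
        by auto
      moreover have "0 \<le> (1 - t) * a T" "0 \<le> t * b T" using a b t that by auto
      ultimately have "(1 - t) * a T = 0" "t * b T = 0" by linarith+
      then show ?thesis using t by simp
    qed
    then have "p = (\<Sum>T\<in>L. a T *\<^sub>R traversals T)" "q = (\<Sum>T\<in>L. b T *\<^sub>R traversals T)"
      unfolding a b using bundle_finite[OF K] LK by (auto intro!: sum.mono_neutral_right)
    then show ?thesis unfolding bundle_cone_eq[OF L] using a(2) b(2) LK by blast
  qed
  then show ?thesis unfolding face_of_def using conv bundle_cone_mono[OF K LK] by blast
qed

lemma polyhedron_bundle_cone:
  assumes K: "is_bundle G R K" shows "polyhedron (bundle_cone K)"
proof -
  note fin = bundle_finite[OF K]
  have "convex_cone hull (traversals ` K) = bundle_cone K"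
  proof (rule hull_unique)
    show "traversals ` K \<subseteq> bundle_cone K"
    proof
      fix x assume "x \<in> traversals ` K"
      then obtain T where T: "T \<in> K" "x = traversals T" by auto
      have "x = (\<Sum>S\<in>K. (if S = T then 1 else 0) *\<^sub>R traversals S)"
        using T fin by (simp add: if_distrib[where f="\<lambda>c. c *\<^sub>R _"] cong: if_cong)
      then show "x \<in> bundle_cone K" unfolding bundle_cone_eq[OF K]
        by (auto intro!: exI[of _ "\<lambda>S. if S = T then 1 else 0"])
    qed
    have "convex (bundle_cone K)" using bundle_cone_face[OF K order_refl] by (simp add: face_of_def)
    moreover have "conic (bundle_cone K)" unfolding conic_def
    proof (intro allI impI)
      fix x and c :: real assume "x \<in> bundle_cone K" "0 \<le> c"
      then obtain a where "x = (\<Sum>T\<in>K. a T *\<^sub>R traversals T)" "\<forall>T\<in>K. 0 \<le> a T"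
        by (auto simp: bundle_cone_eq[OF K])
      then show "c *\<^sub>R x \<in> bundle_cone K" unfolding bundle_cone_eq[OF K] using \<open>0 \<le> c\<close>
        by (auto simp: scaleR_sum_right intro!: exI[of _ "\<lambda>T. c * a T"])
    qed
    moreover have "0 \<in> bundle_cone K" unfolding bundle_cone_eq[OF K]
      by (auto intro!: exI[of _ "\<lambda>_. 0"])
    ultimately show "convex_cone (bundle_cone K)" by (auto simp: convex_cone_def)
  next
    fix S assume S: "traversals ` K \<subseteq> S" "convex_cone S"
    have "(\<Sum>T\<in>K'. a T *\<^sub>R traversals T) \<in> S" if "K' \<subseteq> K" "\<forall>T\<in>K. 0 \<le> a T" for a K'
      using finite_subset[OF that(1) fin] that
    proof (induction K' rule: finite_induct)
      case empty
      then show ?case using convex_cone_contains_0[OF S(2)] by simp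
    next
      case (insert T K')
      then show ?case using S(1) by (auto intro!: convex_cone_add[OF S(2)] convex_cone_scaleR[OF S(2)])
    qed
    then show "bundle_cone K \<subseteq> S" unfolding bundle_cone_eq[OF K] by blast
  qed
  then show ?thesis using polyhedron_convex_cone_hull[of "traversals ` K"] fin by simp
qed

section \<open>The cells as simplihedra\<close>

definition unit_traversals :: "'b trail \<Rightarrow> real ^ 'b" where
  "unit_traversals T = (1 / norm (traversals T)) *\<^sub>R traversals T"

lemma bundle_traversals_nonzero:
  assumes K: "is_bundle G R K" and T: "T \<in> K" shows "traversals T \<noteq> 0"
  using bundle_traversals_independent[OF is_bundle_subset[OF K, of "{T}"], of "\<lambda>_. 1" T] T by auto

lemma bundle_unit_traversals_inj:
  assumes K: "is_bundle G R K" shows "inj_on unit_traversals K"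
proof (rule inj_onI, rule ccontr)
  fix S T assume ST: "S \<in> K" "T \<in> K" "unit_traversals S = unit_traversals T" "S \<noteq> T"
  then show False
    using bundle_traversals_pair[OF K ST(1,2,4), of "1 / norm (traversals S)" "- 1 / norm (traversals T)"]
      bundle_traversals_nonzero[OF K ST(1)]
    by (simp add: unit_traversals_def)
qed

lemma sum_unit_traversals:
  assumes K: "is_bundle G R K"
  shows "(\<Sum>r\<in>unit_traversals ` K. b r *\<^sub>R r) = (\<Sum>T\<in>K. (b (unit_traversals T) / norm (traversals T)) *\<^sub>R traversals T)"
  unfolding sum.reindex[OF bundle_unit_traversals_inj[OF K]] by (simp add: unit_traversals_def)

text \<open>The frame has the apex 0 as its only vertex. Its rays are the traversal vectors scaled
  to norm 1, as in \<open>extremal_rays\<close>, and the norms move into the coefficients.\<close>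

lemma simplihedron_bundle_cone:
  assumes K: "is_bundle G R K" shows "simplihedron (bundle_cone K)"
proof -
  note fin = bundle_finite[OF K] and ne = bundle_traversals_nonzero[OF K]
  interpret simplicial_frame "{0}" "unit_traversals ` K"
  proof
    fix r assume "r \<in> unit_traversals ` K"
    then show "norm r = 1" using ne by (auto simp: unit_traversals_def)
  next
    fix a b :: "real ^ 'b \<Rightarrow> real"
    assume a: "(\<Sum>v\<in>{0}. a v) = 0" and b: "(\<Sum>v\<in>{0}. a v *\<^sub>R v) + (\<Sum>r\<in>unit_traversals ` K. b r *\<^sub>R r) = 0"
    have "(\<Sum>T\<in>K. (b (unit_traversals T) / norm (traversals T)) *\<^sub>R traversals T) = 0"
      using b by (simp add: sum_unit_traversals[OF K])
    then show "(\<forall>v\<in>{0}. a v = 0) \<and> (\<forall>r\<in>unit_traversals ` K. b r = 0)"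
      using bundle_traversals_independent[OF K fin, of "\<lambda>T. b (unit_traversals T) / norm (traversals T)"] a ne
      by auto
  qed (use fin in auto)
  have "cell = bundle_cone K"
  proof (intro subset_antisym subsetI)
    fix x assume "x \<in> cell"
    then obtain a b where b: "x = pt a b" "\<forall>r\<in>unit_traversals ` K. 0 \<le> b r" by (auto simp: cell_def)
    then show "x \<in> bundle_cone K"
      unfolding bundle_cone_eq[OF K] pt_def sum_unit_traversals[OF K]
      by (auto intro!: exI[of _ "\<lambda>T. b (unit_traversals T) / norm (traversals T)"])
  next
    fix x assume "x \<in> bundle_cone K"
    then obtain a where a: "x = (\<Sum>T\<in>K. a T *\<^sub>R traversals T)" "\<forall>T\<in>K. 0 \<le> a T"
      by (auto simp: bundle_cone_eq[OF K])
    define b where "b r = (let T = inv_into K unit_traversals r in a T * norm (traversals T))" for r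
    have b: "b (unit_traversals T) = a T * norm (traversals T)" if "T \<in> K" for T
      using that bundle_unit_traversals_inj[OF K] by (simp add: b_def)
    have "x = pt (\<lambda>_. 1) b"
      unfolding a(1) pt_def sum_unit_traversals[OF K] using b ne by simp
    then show "x \<in> cell" using a(2) b by (auto intro!: cellI)
  qed
  then show ?thesis using simplihedron_cell polyhedron_bundle_cone[OF K] by simp
qed

text \<open>Routes alone contribute to the total flow and give the vertices; bands give the rays. A
  route in \<open>K\<close> provides the vertex that the frame requires.\<close>

lemma simplihedron_unit_bundle_polyhedron:
  assumes K: "is_bundle G R K" and ne_routes: "K \<inter> routes G \<noteq> {}"
  shows "simplihedron (unit_bundle_polyhedron G K)"
proof -
  note fin = bundle_finite[OF K] and ne = bundle_traversals_nonzero[OF K]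
  define P where "P = K \<inter> routes G"
  define B where "B = K - routes G"
  have PB: "K = P \<union> B" "P \<inter> B = {}" and sub: "P \<subseteq> K" "B \<subseteq> K" by (auto simp: P_def B_def)
  note finP = finite_subset[OF sub(1) fin] and finB = finite_subset[OF sub(2) fin]
  have injP: "inj_on traversals P" using bundle_traversals_inj[OF K] sub inj_on_subset by blast
  have B: "is_bundle G R B" using is_bundle_subset[OF K] sub by blast
  have sum_eq: "(\<Sum>v\<in>traversals ` P. a v *\<^sub>R v) + (\<Sum>r\<in>unit_traversals ` B. b r *\<^sub>R r) =
      (\<Sum>T\<in>K. (if T \<in> P then a (traversals T) else b (unit_traversals T) / norm (traversals T)) *\<^sub>R traversals T)"
    for a b :: "real ^ 'b \<Rightarrow> real"
  proof -
    let ?c = "\<lambda>T. (if T \<in> P then a (traversals T) else b (unit_traversals T) / norm (traversals T)) *\<^sub>R traversals T"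
    have "(\<Sum>T\<in>K. ?c T) = (\<Sum>T\<in>P. ?c T) + (\<Sum>T\<in>B. ?c T)"
      unfolding PB(1) using finP finB PB(2) by (intro sum.union_disjoint)
    moreover have "(\<Sum>T\<in>P. ?c T) = (\<Sum>v\<in>traversals ` P. a v *\<^sub>R v)"
      by (simp add: sum.reindex[OF injP])
    moreover have "(\<Sum>T\<in>B. ?c T) = (\<Sum>r\<in>unit_traversals ` B. b r *\<^sub>R r)"
      unfolding sum_unit_traversals[OF B] using PB(2) by (intro sum.cong) auto
    ultimately show ?thesis by simp
  qed
  interpret simplicial_frame "traversals ` P" "unit_traversals ` B"
  proof
    fix r assume "r \<in> unit_traversals ` B"
    then show "norm r = 1" using ne sub by (auto simp: unit_traversals_def)
  next
    fix a b :: "real ^ 'b \<Rightarrow> real"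
    assume "(\<Sum>v\<in>traversals ` P. a v *\<^sub>R v) + (\<Sum>r\<in>unit_traversals ` B. b r *\<^sub>R r) = 0"
    then have z: "(if T \<in> P then a (traversals T) else b (unit_traversals T) / norm (traversals T)) = 0" if "T \<in> K" for T
      unfolding sum_eq using bundle_traversals_independent[OF K fin,
          of "\<lambda>T. if T \<in> P then a (traversals T) else b (unit_traversals T) / norm (traversals T)" T] that by blast
    have "a (traversals T) = 0" if "T \<in> P" for T using z[of T] that sub by auto
    moreover have "b (unit_traversals T) = 0" if "T \<in> B" for T
    proof -
      have "T \<notin> P" "T \<in> K" using that PB by auto
      then show ?thesis using z[of T] ne[of T] by simp
    qed
    ultimately show "(\<forall>v\<in>traversals ` P. a v = 0) \<and> (\<forall>r\<in>unit_traversals ` B. b r = 0)" by blast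
  qed (use finP finB ne_routes in \<open>auto simp: P_def\<close>)
  have "cell = unit_bundle_polyhedron G K"
  proof (intro subset_antisym subsetI)
    fix x assume "x \<in> cell"
    then obtain a b where ab: "x = pt a b" "\<forall>v\<in>traversals ` P. 0 \<le> a v" "\<forall>r\<in>unit_traversals ` B. 0 \<le> b r"
      "(\<Sum>v\<in>traversals ` P. a v) = 1" by (auto simp: cell_def)
    define c where "c T = (if T \<in> P then a (traversals T) else b (unit_traversals T) / norm (traversals T))" for T
    have x: "x = (\<Sum>T\<in>K. c T *\<^sub>R traversals T)" unfolding ab(1) pt_def sum_eq c_def ..
    have "\<forall>T\<in>K. 0 \<le> c T" using ab(2,3) PB by (auto simp: c_def)
    moreover have "total_flow x = 1"
      unfolding x total_flow_combination[OF K] P_def[symmetric] using ab(4)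
      by (simp add: c_def sum.reindex[OF injP])
    ultimately show "x \<in> unit_bundle_polyhedron G K"
      unfolding unit_bundle_polyhedron_eq[OF K] bundle_cone_eq[OF K] using x by auto
  next
    fix x assume "x \<in> unit_bundle_polyhedron G K"
    then obtain c where c: "x = (\<Sum>T\<in>K. c T *\<^sub>R traversals T)" "\<forall>T\<in>K. 0 \<le> c T" "total_flow x = 1"
      by (auto simp: unit_bundle_polyhedron_eq[OF K] bundle_cone_eq[OF K])
    \<comment> \<open>Coefficients of a combination belong to trails, those of a frame to vectors;
      injectivity of \<open>traversals\<close> and \<open>unit_traversals\<close> allows the
      transfer.\<close>
    define a where "a v = c (inv_into P traversals v)" for v
    define b where "b r = (let T = inv_into B unit_traversals r in c T * norm (traversals T))" for r
    have a: "a (traversals T) = c T" if "T \<in> P" for T using that injP by (simp add: a_def)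
    have b: "b (unit_traversals T) = c T * norm (traversals T)" if "T \<in> B" for T
      using that bundle_unit_traversals_inj[OF B] by (simp add: b_def)
    have "x = pt a b"
      unfolding c(1) pt_def sum_eq using a b ne PB by (intro sum.cong) auto
    moreover have "(\<Sum>v\<in>traversals ` P. a v) = 1"
      using c(3) unfolding c(1) total_flow_combination[OF K] P_def[symmetric]
      by (simp add: sum.reindex[OF injP] a)
    ultimately show "x \<in> cell" using c(2) a b sub by (auto intro!: cellI)
  qed
  moreover have "polyhedron (unit_bundle_polyhedron G K)"
    unfolding unit_bundle_polyhedron_eq[OF K]
    by (intro polyhedron_Int polyhedron_bundle_cone K polyhedron_total_flow)
  ultimately show ?thesis using simplihedron_cell by simp
qed

section \<open>Rational flows and their density\<close>

lemma rational_vec_denominator: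
  fixes F :: "real ^ 'b"
  assumes "rational_vec F" obtains N :: nat where "N > 0" "integer_vec (real N *\<^sub>R F)"
proof -
  have "\<exists>d::nat. d > 0 \<and> real d * F $ e \<in> \<int>" for e
  proof -
    obtain i d where "F $ e = real_of_int i / real_of_int d" "d > 0"
      using assms unfolding rational_vec_def by (meson Rats_cases')
    then have "real (nat d) * F $ e = of_int i" by simp
    then show ?thesis using \<open>d > 0\<close> by (metis Ints_of_int zero_less_nat_eq)
  qed
  then obtain d where d: "\<And>e. d e > (0::nat)" "\<And>e. real (d e) * F $ e \<in> \<int>" by metis
  define N where "N = (\<Prod>e\<in>UNIV. d e)"
  have "real N * F $ e \<in> \<int>" for e
  proof -
    have "real N * F $ e = real (\<Prod>e\<in>UNIV - {e}. d e) * (real (d e) * F $ e)"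
      unfolding N_def by (subst prod.remove[of _ e]) auto
    then show ?thesis using d(2)[of e] by (simp only: Ints_mult Ints_of_nat)
  qed
  moreover have "N > 0" using d(1) by (simp add: N_def prod_pos)
  ultimately show ?thesis using that[of N] by (simp add: integer_vec_def)
qed

lemma rational_flow_bundle_combination:
  assumes F: "F \<in> nonneg_flows G" "rational_vec F"
  shows "\<exists>K. maximal_bundle G R K \<and> F \<in> bundle_cone K"
proof -
  obtain N :: nat where N: "N > 0" "integer_vec (real N *\<^sub>R F)" using rational_vec_denominator[OF F(2)] .
  obtain K and a :: "'b trail \<Rightarrow> nat" where
    K: "is_bundle G R K" "finite K" "real N *\<^sub>R F = (\<Sum>T\<in>K. real (a T) *\<^sub>R traversals T)"
    using integer_flow_bundle_combination[OF nonneg_flows_conic[OF F(1)] N(2)] by auto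
  have "F = (1 / real N) *\<^sub>R (real N *\<^sub>R F)" using N(1) by simp
  also have "\<dots> = (\<Sum>T\<in>K. (real (a T) / real N) *\<^sub>R traversals T)"
    unfolding K(3) by (simp add: scaleR_sum_right)
  finally have "F \<in> bundle_cone K" unfolding bundle_cone_eq[OF K(1)]
    by (auto intro!: exI[of _ "\<lambda>T. real (a T) / real N"])
  moreover obtain L where "maximal_bundle G R L" "K \<subseteq> L" using bundle_extends_to_maximal[OF K(1)] by blast
  ultimately show ?thesis using bundle_cone_mono[of L K] unfolding maximal_bundle_def by blast
qed

text \<open>The numerators of a simultaneous Dirichlet approximation satisfy the conservation laws up to an
  error less than 1. Being integers, they satisfy them exactly.\<close>

lemma rational_flow_approximation:
  assumes F: "F \<in> nonneg_flows G" and eps: "\<epsilon> > 0"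
  shows "\<exists>F'\<in>nonneg_flows G. rational_vec F' \<and> dist F' F < \<epsilon> \<and> (total_flow F = 1 \<longrightarrow> total_flow F' = 1)"
proof -
  let ?n = "CARD('b)"
  obtain h :: "nat \<Rightarrow> 'b" where h: "bij_betw h {0..<?n} UNIV"
    using ex_bij_betw_nat_finite[of "UNIV :: 'b set"] by auto
  obtain N0 :: nat where N0: "real N0 > real ?n / \<epsilon>" using reals_Archimedean2 by blast
  \<comment> \<open>\<open>N0\<close> brings the distance bound \<open>?n / N\<close> below
    \<open>\<epsilon>\<close>, and \<open>2 * ?n\<close> keeps twice the error \<open>?n / N\<close>
    of a sum below 1.\<close>
  define N where "N = N0 + 2 * ?n + 1"
  have N: "N > 0" "real (2 * ?n) < real N" "real ?n / \<epsilon> < real N" using N0 by (auto simp: N_def)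
  obtain q p where q: "0 < q" and p: "\<And>i. i < ?n \<Longrightarrow> \<bar>of_int q * F $ h i - of_int (p i)\<bar> < 1 / N"
    using Dirichlet_approx_simult[OF N(1), of ?n "\<lambda>i. F $ h i"] by metis
  define P where "P e = p (inv_into {0..<?n} h e)" for e
  have P: "\<bar>of_int (P e) - of_int q * F $ e\<bar> < 1 / N" for e
  proof -
    have "e \<in> h ` {0..<?n}" using h by (auto simp: bij_betw_def)
    then have "inv_into {0..<?n} h e < ?n" "h (inv_into {0..<?n} h e) = e"
      using inv_into_into[of e h "{0..<?n}"] by (auto simp: f_inv_into_f)
    then show ?thesis using p[of "inv_into {0..<?n} h e"] by (simp add: P_def abs_minus_commute)
  qed
  have near: "\<bar>(\<Sum>e\<in>A. of_int (P e)) - of_int q * (\<Sum>e\<in>A. F $ e)\<bar> \<le> ?n / N" for A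
  proof -
    have "\<bar>(\<Sum>e\<in>A. of_int (P e)) - of_int q * (\<Sum>e\<in>A. F $ e)\<bar> = \<bar>\<Sum>e\<in>A. of_int (P e) - of_int q * F $ e\<bar>"
      by (simp add: sum_subtractf sum_distrib_left)
    also have "\<dots> \<le> (\<Sum>e\<in>A. 1 / N)"
      using P by (intro order_trans[OF sum_abs] sum_mono) (simp add: less_imp_le)
    also have "\<dots> \<le> ?n / N" using card_mono[of UNIV A] N(1) by (simp add: divide_right_mono)
    finally show ?thesis .
  qed
  have nN: "2 * (?n / N) < 1" using N by (simp add: field_simps)
  have N1: "1 / real N \<le> 1" using N(1) by simp
  define F' where "F' = (\<chi> e. real_of_int (P e) / real_of_int q)"
  have flow: "is_flow G F'"
    unfolding is_flow_def
  proof (intro conjI allI impI ballI)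
    fix e assume "e \<notin> arcs G"
    then have "F $ e = 0" using F by (auto simp: nonneg_flows_def is_flow_def)
    then have "\<bar>real_of_int (P e)\<bar> < 1" using P[of e] N1 by simp
    then have "P e = 0" by linarith
    then show "F' $ e = 0" by (simp add: F'_def)
  next
    fix v assume "v \<in> internals G"
    then have cons: "(\<Sum>e\<in>in_arcs G v. F $ e) = (\<Sum>e\<in>out_arcs G v. F $ e)"
      using F by (auto simp: nonneg_flows_def is_flow_def)
    have "\<bar>(\<Sum>e\<in>in_arcs G v. of_int (P e)) - (\<Sum>e\<in>out_arcs G v. real_of_int (P e))\<bar> < 1"
      using near[of "in_arcs G v", unfolded cons] near[of "out_arcs G v"] nN by linarith
    then have "\<bar>real_of_int ((\<Sum>e\<in>in_arcs G v. P e) - (\<Sum>e\<in>out_arcs G v. P e))\<bar> < 1" by simp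
    then have "(\<Sum>e\<in>in_arcs G v. P e) = (\<Sum>e\<in>out_arcs G v. P e)" by linarith
    then show "(\<Sum>e\<in>in_arcs G v. F' $ e) = (\<Sum>e\<in>out_arcs G v. F' $ e)"
      by (simp add: F'_def flip: sum_divide_distrib of_int_sum)
  qed
  moreover have "0 \<le> F' $ e" for e
  proof -
    have "0 \<le> of_int q * F $ e" using F q by (auto simp: nonneg_flows_def)
    \<comment> \<open>An integer above -1 is nonnegative, so the approximation stays in the cone
      even where \<open>F\<close> vanishes.\<close>
    then have "real_of_int (P e) > -1" using P[of e] N1 by linarith
    then have "P e \<ge> 0" by linarith
    then show ?thesis using q by (simp add: F'_def)
  qed
  moreover have "rational_vec F'" by (simp add: rational_vec_def F'_def)
  moreover have "dist F' F < \<epsilon>"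
  proof -
    have "\<bar>F' $ e - F $ e\<bar> \<le> 1 / N" for e
    proof -
      have "of_int q * \<bar>F' $ e - F $ e\<bar> = \<bar>of_int q * (F' $ e - F $ e)\<bar>" using q by (simp add: abs_mult)
      also have "\<dots> = \<bar>of_int (P e) - of_int q * F $ e\<bar>" using q by (simp add: F'_def right_diff_distrib)
      finally have "of_int q * \<bar>F' $ e - F $ e\<bar> \<le> 1 / N" using P[of e] by simp
      moreover have "1 * \<bar>F' $ e - F $ e\<bar> \<le> of_int q * \<bar>F' $ e - F $ e\<bar>"
        using q by (intro mult_right_mono) auto
      ultimately show ?thesis by simp
    qed
    then have "(\<Sum>e\<in>UNIV. \<bar>(F' - F) $ e\<bar>) \<le> (\<Sum>e\<in>(UNIV::'b set). 1 / N)" by (intro sum_mono) simp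
    then have "dist F' F \<le> ?n / N" using norm_le_l1_cart[of "F' - F"] by (simp add: dist_norm)
    also have "\<dots> < \<epsilon>" using N(1,3) eps by (simp add: field_simps)
    finally show ?thesis .
  qed
  \<comment> \<open>Normalization survives for the same reason as conservation: the numerators at
    the source arcs add up to an integer at distance less than 1 from \<open>q\<close>.\<close>
  moreover have "total_flow F' = 1" if "total_flow F = 1"
  proof -
    have "\<bar>(\<Sum>e\<in>source_arcs. real_of_int (P e)) - of_int q\<bar> < 1"
      using near[of source_arcs] that nN by (simp add: total_flow_alt)
    then have "\<bar>real_of_int ((\<Sum>e\<in>source_arcs. P e) - q)\<bar> < 1" by simp
    then have "(\<Sum>e\<in>source_arcs. P e) = q" by linarith
    then show ?thesis using q by (simp add: total_flow_alt F'_def flip: sum_divide_distrib of_int_sum)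
  qed
  ultimately show ?thesis by (auto simp: nonneg_flows_def)
qed

end

theorem theorem9p6:
  fixes G :: "('a, 'b::finite) pre_digraph" and R :: "('a, 'b) framing"
  assumes "fin_digraph G" and "is_framing G R"
  shows
    "(\<forall>F\<in>nonneg_flows G. \<forall>K a L b.
        is_bundle G R K \<and> positive_coeffs K a \<and> represents K a F \<and>
        is_bundle G R L \<and> positive_coeffs L b \<and> represents L b F
        \<longrightarrow> K = L \<and> (\<forall>T\<in>K. a T = b T)) \<and>
     bundle_combinations G R \<subseteq> nonneg_flows G \<and>
     nonneg_flows G \<subseteq> closure (bundle_combinations G R) \<and>
     {F \<in> nonneg_flows G. rational_vec F} \<subseteq> bundle_combinations G R \<and>
     (\<forall>F\<in>nonneg_flows G. integer_vec F \<longrightarrow>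
        (\<forall>K a. is_bundle G R K \<and> represents K a F \<longrightarrow> (\<forall>T\<in>K. a T \<in> \<int>))) \<and>
     simplicial_subdivision (nonneg_bundle_subdivision G R) (nonneg_flows G) \<and>
     {F \<in> nonneg_flows G. rational_vec F} \<subseteq> \<Union>(nonneg_bundle_subdivision G R) \<and>
     simplicial_subdivision (unit_bundle_subdivision G R) (unit_flows G) \<and>
     {F \<in> unit_flows G. rational_vec F} \<subseteq> \<Union>(unit_bundle_subdivision G R)"
proof -
  interpret framed_digraph G R
    using assms by (simp add: framed_digraph_def framed_digraph_axioms_def)
  have unique: "(if T \<in> K then a T else 0) = (if T \<in> L then b T else 0)"
    if "is_bundle G R K" "represents K a F" "is_bundle G R L" "represents L b F" for K a L b F T
    using that bundle_coefficients_unique[OF bundle_finite bundle_finite, of K L a b T]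
    by (simp add: represents_iff)
  have 1: "K = L \<and> (\<forall>T\<in>K. a T = b T)"
    if "is_bundle G R K \<and> positive_coeffs K a \<and> represents K a F \<and>
        is_bundle G R L \<and> positive_coeffs L b \<and> represents L b F" for K a L b F
  proof -
    have eq: "(if T \<in> K then a T else 0) = (if T \<in> L then b T else 0)" for T
      using unique that by blast
    \<comment> \<open>Positive coefficients mark exactly the trails of a bundle, so equal extensions
      by zero have equal supports.\<close>
    have "T \<in> K \<longleftrightarrow> T \<in> L" for T
      using that eq[of T] by (auto simp: positive_coeffs_def split: if_splits)
    moreover have "a T = b T" if "T \<in> K" for T
      using calculation[of T] eq[of T] that by simp
    ultimately show ?thesis by blast
  qed
  have 2: "bundle_combinations G R \<subseteq> nonneg_flows G"
    unfolding bundle_combinations_def using bundle_cone_subset_flows by blast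
  have maximal: "is_bundle G R K" if "maximal_bundle G R K" for K
    using that by (simp add: maximal_bundle_def)
  have 7: "{F \<in> nonneg_flows G. rational_vec F} \<subseteq> \<Union>(nonneg_bundle_subdivision G R)"
    unfolding nonneg_bundle_subdivision_def using rational_flow_bundle_combination by blast
  have sub: "\<Union>(nonneg_bundle_subdivision G R) \<subseteq> bundle_combinations G R"
    unfolding nonneg_bundle_subdivision_def bundle_combinations_def using maximal by blast
  have dense: "nonneg_flows G \<subseteq> closure (\<Union>(nonneg_bundle_subdivision G R))"
  proof
    fix F assume F: "F \<in> nonneg_flows G"
    show "F \<in> closure (\<Union>(nonneg_bundle_subdivision G R))"
      unfolding closure_approachable using rational_flow_approximation[OF F] 7 by blast
  qed
  \<comment> \<open>An integer flow has one combination with natural coefficients; uniqueness passes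
    integrality on to every other combination.\<close>
  have 5: "a T \<in> \<int>"
    if F: "F \<in> nonneg_flows G" "integer_vec F" and K: "is_bundle G R K" "represents K a F" "T \<in> K" for F K a T
  proof -
    obtain L and b :: "'b trail \<Rightarrow> nat" where
      L: "is_bundle G R L" "F = (\<Sum>T\<in>L. real (b T) *\<^sub>R traversals T)"
      using integer_flow_bundle_combination[OF F] by blast
    then have "represents L (\<lambda>T. real (b T)) F" by (simp add: represents_iff)
    from unique[OF K(1,2) L(1) this, of T] show ?thesis using K(3) by (auto split: if_splits)
  qed
  have 6: "simplicial_subdivision (nonneg_bundle_subdivision G R) (nonneg_flows G)"
    unfolding simplicial_subdivision_def polyhedral_subdivision_def
  proof (intro conjI ballI impI)
    show "polyhedron (nonneg_flows G)" by (rule polyhedron_nonneg_flows)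
    show "\<Union>(nonneg_bundle_subdivision G R) \<subseteq> nonneg_flows G" using sub 2 by blast
    show "nonneg_flows G \<subseteq> closure (\<Union>(nonneg_bundle_subdivision G R))" by (rule dense)
    fix C assume "C \<in> nonneg_bundle_subdivision G R"
    then obtain K where K: "C = bundle_cone K" "is_bundle G R K"
      unfolding nonneg_bundle_subdivision_def using maximal by blast
    show "polyhedron C" "simplihedron C"
      using K polyhedron_bundle_cone simplihedron_bundle_cone by auto
    fix D assume "D \<in> nonneg_bundle_subdivision G R"
    then obtain L where L: "D = bundle_cone L" "is_bundle G R L"
      unfolding nonneg_bundle_subdivision_def using maximal by blast
    show "C \<inter> D face_of C" "C \<inter> D face_of D"
      unfolding K(1) L(1) bundle_cone_Int[OF K(2) L(2)]
      using bundle_cone_face[OF K(2)] bundle_cone_face[OF L(2)] by auto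
  qed
  have 9: "{F \<in> unit_flows G. rational_vec F} \<subseteq> \<Union>(unit_bundle_subdivision G R)"
  proof
    fix F assume "F \<in> {F \<in> unit_flows G. rational_vec F}"
    then have F: "F \<in> nonneg_flows G" "rational_vec F" "total_flow F = 1" by (auto simp: unit_flows_eq)
    obtain K where K: "maximal_bundle G R K" "F \<in> bundle_cone K"
      using rational_flow_bundle_combination[OF F(1,2)] by blast
    note bK = maximal[OF K(1)]
    \<comment> \<open>Without a route every combination has total flow 0, so the cone found for
      \<open>F\<close> does yield a unit cell.\<close>
    have "K \<inter> routes G \<noteq> {}"
    proof
      assume "K \<inter> routes G = {}"
      then have "total_flow F = 0" using K(2) by (auto simp: bundle_cone_eq[OF bK] total_flow_combination[OF bK])
      then show False using F(3) by simp
    qed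
    then show "F \<in> \<Union>(unit_bundle_subdivision G R)"
      unfolding unit_bundle_subdivision_def using K F(3) unit_bundle_polyhedron_eq[OF bK] by blast
  qed
  have 8: "simplicial_subdivision (unit_bundle_subdivision G R) (unit_flows G)"
    unfolding simplicial_subdivision_def polyhedral_subdivision_def
  proof (intro conjI ballI impI)
    show "polyhedron (unit_flows G)"
      unfolding unit_flows_eq by (intro polyhedron_Int polyhedron_nonneg_flows polyhedron_total_flow)
    show "\<Union>(unit_bundle_subdivision G R) \<subseteq> unit_flows G"
      unfolding unit_bundle_subdivision_def unit_flows_eq
      using maximal unit_bundle_polyhedron_eq bundle_cone_subset_flows by blast
    show "unit_flows G \<subseteq> closure (\<Union>(unit_bundle_subdivision G R))"
    proof
      fix F assume "F \<in> unit_flows G"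
      then have F: "F \<in> nonneg_flows G" "total_flow F = 1" by (auto simp: unit_flows_eq)
      show "F \<in> closure (\<Union>(unit_bundle_subdivision G R))"
        unfolding closure_approachable
      proof (intro allI impI)
        fix \<epsilon> :: real assume "\<epsilon> > 0"
        \<comment> \<open>The approximation has total flow exactly 1, so it is a rational unit flow
          and lies in a cell.\<close>
        then obtain F' where F': "F' \<in> nonneg_flows G" "rational_vec F'" "dist F' F < \<epsilon>" "total_flow F' = 1"
          using rational_flow_approximation[OF F(1)] F(2) by blast
        then have "F' \<in> \<Union>(unit_bundle_subdivision G R)" using 9 by (auto simp: unit_flows_eq)
        then show "\<exists>y\<in>\<Union>(unit_bundle_subdivision G R). dist y F < \<epsilon>" using F'(3) by blast
      qed
    qed
    fix C assume "C \<in> unit_bundle_subdivision G R"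
    then obtain K where K: "C = unit_bundle_polyhedron G K" "is_bundle G R K" "K \<inter> routes G \<noteq> {}"
      unfolding unit_bundle_subdivision_def using maximal by blast
    show simp: "simplihedron C" unfolding K(1) by (rule simplihedron_unit_bundle_polyhedron[OF K(2,3)])
    then show "polyhedron C" by (simp add: simplihedron_def)
    fix D assume "D \<in> unit_bundle_subdivision G R"
    then obtain L where L: "D = unit_bundle_polyhedron G L" "is_bundle G R L"
      unfolding unit_bundle_subdivision_def using maximal by blast
    have CD: "C \<inter> D = bundle_cone (K \<inter> L) \<inter> {F. total_flow F = 1}"
      unfolding K(1) L(1) unit_bundle_polyhedron_eq[OF K(2)] unit_bundle_polyhedron_eq[OF L(2)]
      using bundle_cone_Int[OF K(2) L(2)] by blast
    \<comment> \<open>Intersecting with a convex set preserves the face relation between the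
      cones.\<close>
    have conv: "convex {F. total_flow F = 1}" by (intro polyhedron_imp_convex polyhedron_total_flow)
    show "C \<inter> D face_of C" "C \<inter> D face_of D"
      unfolding CD unfolding K(1) L(1) unit_bundle_polyhedron_eq[OF K(2)] unit_bundle_polyhedron_eq[OF L(2)]
      using face_of_slice[OF bundle_cone_face[OF K(2)] conv] face_of_slice[OF bundle_cone_face[OF L(2)] conv] by auto
  qed
  have 3: "nonneg_flows G \<subseteq> closure (bundle_combinations G R)"
    using dense closure_mono[OF sub] by blast
  have 4: "{F \<in> nonneg_flows G. rational_vec F} \<subseteq> bundle_combinations G R"
    using 7 sub by blast
  show ?thesis using 1 2 3 4 5 6 7 8 9 by (intro conjI) blast+
qed

end
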